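(* Consider the scalar Gaussian wiretap channel with amplitude constraint $\mathsf{R}>0$ and noise variances $0<\sigma_1^2<\sigma_2^2$. Let $X^\star$ be a secrecy-capacity-achieving input, let $Y_1^\star,Y_2^\star$ be the corresponding outputs at the legitimate and malicious receivers, and let \[ g(y)=\mathbb{E}\left[\log\frac{f_{Y_2^\star}(y+N)}{f_{Y_1^\star}(y)}\right], \quad y\in\mathbb{R}, \] with $N\sim\mathcal{N}(0,\sigma_2^2-\sigma_1^2)$. Let $C_s=C_s(\sigma_1^2,\sigma_2^2,\mathsf{R},1)$, \[ \kappa_1=\log\left(\frac{\sigma_2}{\sigma_1}\right)-C_s,\qquad L= \mathsf{R} \frac{\sigma_2+\sigma_1}{ \sigma_2-\sigma_1} +\sqrt{ \frac{ \frac{\sigma_2^2-\sigma_1^2}{\sigma_2^2}+2C_s}{ \frac{1}{\sigma_1^2}-\frac{1}{\sigma_2^2} } }. \] Then \[ |\mathrm{supp}(P_{X^\star})| \le \mathrm{N}\left([-L,L], g(\cdot)+\kappa_1\right) <\infty , \] and moreover \[ \mathrm{N}\left([-L,L], g(\cdot)+\kappa_1\right) \le \rho \frac{\mathsf{R}^2}{\sigma_1^2} + O( \log(\mathsf{R}) ), \] where $\rho= (2e+1)^2 \left( \frac{\sigma_2+\sigma_1}{ \sigma_2-\sigma_1} \right)^2+ \left(\frac{\sigma_2+\sigma_1}{ \sigma_2-\sigma_1}+1 \right)^2$ and the $O(\log\mathsf{R})$ term is as $\mathsf{R}\to\infty$ with $\sigma_1,\sigma_2$ fixed.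
   Context: Scalar Gaussian wiretap channel: $Y_1=X+N_1$, $Y_2=X+N_2$ with $N_1\sim\mathcal{N}(0,\sigma_1^2)$, $N_2\sim\mathcal{N}(0,\sigma_2^2)$, $X,N_1,N_2$ mutually independent. $C_s(\sigma_1^2,\sigma_2^2,\mathsf{R},1)=\max I(X;Y_1)-I(X;Y_2)$ over distributions of $X$ supported in $[-\mathsf{R},\mathsf{R}]$; a secrecy-capacity-achieving input is a maximizer. $f_{Y}$ denotes a probability density function and $\mathrm{supp}(P_X)$ the support of the distribution of $X$. $\mathrm{N}(\mathcal{I},f)$ denotes the number of zeros of $f$ in the interval $\mathcal{I}$, counted with multiplicity. *)

theory Defs
  imports "HOL-Probability.Probability" "HOL-Library.Extended_Nat"
begin

text \<open>Scalar Gaussian wiretap channel. Noise standard deviations are sigma1, sigma2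
(variances sigma1^2, sigma2^2). All logarithms are natural (nats).\<close>

definition admissible_input :: "real \<Rightarrow> real measure \<Rightarrow> bool" where
  "admissible_input R P \<longleftrightarrow>
     prob_space P \<and> sets P = sets borel \<and> emeasure P {-R..R} = 1"

text \<open>Output density of Y = X + N with X ~ P and N ~ N(0, sigma^2) independent.\<close>
definition out_density :: "real \<Rightarrow> real measure \<Rightarrow> real \<Rightarrow> real" where
  "out_density \<sigma> P y = (\<integral>x. normal_density x \<sigma> y \<partial>P)"

definition mutual_info :: "real \<Rightarrow> real measure \<Rightarrow> real" where
  "mutual_info \<sigma> P =
     (\<integral>x. (\<integral>y. normal_density x \<sigma> y * ln (normal_density x \<sigma> y / out_density \<sigma> P y) \<partial>lborel) \<partial>P)"

definition secrecy_rate :: "real \<Rightarrow> real \<Rightarrow> real measure \<Rightarrow> real" where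
  "secrecy_rate \<sigma>1 \<sigma>2 P = mutual_info \<sigma>1 P - mutual_info \<sigma>2 P"

definition secrecy_capacity :: "real \<Rightarrow> real \<Rightarrow> real \<Rightarrow> real" where
  "secrecy_capacity \<sigma>1 \<sigma>2 R = (SUP P \<in> {P. admissible_input R P}. secrecy_rate \<sigma>1 \<sigma>2 P)"

definition capacity_achieving :: "real \<Rightarrow> real \<Rightarrow> real \<Rightarrow> real measure \<Rightarrow> bool" where
  "capacity_achieving \<sigma>1 \<sigma>2 R P \<longleftrightarrow> admissible_input R P \<and>
     (\<forall>Q. admissible_input R Q \<longrightarrow> secrecy_rate \<sigma>1 \<sigma>2 Q \<le> secrecy_rate \<sigma>1 \<sigma>2 P)"

definition dist_support :: "real measure \<Rightarrow> real set" where
  "dist_support P = {x. \<forall>e>0. emeasure P (ball x e) > 0}"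

definition g_fun :: "real \<Rightarrow> real \<Rightarrow> real measure \<Rightarrow> real \<Rightarrow> real" where
  "g_fun \<sigma>1 \<sigma>2 P y =
     (\<integral>z. normal_density 0 (sqrt (\<sigma>2\<^sup>2 - \<sigma>1\<^sup>2)) z *
           ln (out_density \<sigma>2 P (y + z) / out_density \<sigma>1 P y) \<partial>lborel)"

definition zero_mult :: "(real \<Rightarrow> real) \<Rightarrow> real \<Rightarrow> enat" where
  "zero_mult f x = (if \<exists>n. (deriv ^^ n) f x \<noteq> 0
                    then enat (LEAST n. (deriv ^^ n) f x \<noteq> 0) else \<infinity>)"

definition num_zeros :: "real set \<Rightarrow> (real \<Rightarrow> real) \<Rightarrow> enat" where
  "num_zeros I f = (if finite {x\<in>I. f x = 0}
                    then (\<Sum>x\<in>{x\<in>I. f x = 0}. zero_mult f x) else \<infinity>)"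

definition kappa1 :: "real \<Rightarrow> real \<Rightarrow> real \<Rightarrow> real" where
  "kappa1 \<sigma>1 \<sigma>2 R = ln (\<sigma>2 / \<sigma>1) - secrecy_capacity \<sigma>1 \<sigma>2 R"

definition L_bound :: "real \<Rightarrow> real \<Rightarrow> real \<Rightarrow> real" where
  "L_bound \<sigma>1 \<sigma>2 R = R * ((\<sigma>2 + \<sigma>1) / (\<sigma>2 - \<sigma>1)) +
     sqrt (((\<sigma>2\<^sup>2 - \<sigma>1\<^sup>2) / \<sigma>2\<^sup>2 + 2 * secrecy_capacity \<sigma>1 \<sigma>2 R)
           / (1 / \<sigma>1\<^sup>2 - 1 / \<sigma>2\<^sup>2))"

definition rho_const :: "real \<Rightarrow> real \<Rightarrow> real" where
  "rho_const \<sigma>1 \<sigma>2 = (2 * exp 1 + 1)\<^sup>2 * ((\<sigma>2 + \<sigma>1) / (\<sigma>2 - \<sigma>1))\<^sup>2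
                      + ((\<sigma>2 + \<sigma>1) / (\<sigma>2 - \<sigma>1) + 1)\<^sup>2"

definition zero_count :: "real \<Rightarrow> real \<Rightarrow> real \<Rightarrow> real measure \<Rightarrow> enat" where
  "zero_count \<sigma>1 \<sigma>2 R P =
     num_zeros {- L_bound \<sigma>1 \<sigma>2 R .. L_bound \<sigma>1 \<sigma>2 R} (\<lambda>y. g_fun \<sigma>1 \<sigma>2 P y + kappa1 \<sigma>1 \<sigma>2 R)"

end

theory Submission
  imports Defs "HOL-Complex_Analysis.Complex_Analysis" "HOL-Real_Asymp.Real_Asymp"
begin

text \<open>Moving a little mass of an optimal input to a point x of [-R, R] does not increase the rate; hence the
Gaussian average around x, with variance \<open>\<sigma>1\<^sup>2\<close>, of g plus the constant \<open>\<kappa>\<close> is at most 0, with equality on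
the support. Up to a nonvanishing factor this average is a Laplace transform, and by Rolle's theorem
a Laplace transform has no more zeros than its weight has sign changes. Jensen's inequality makes
g plus the constant positive outside [-L, L].

For the number of zeros, g' times the exponential moment of the input is an entire function, and a
Schwarz-type lemma bounds its zeros in a disc by its growth. The growth contains the factor
\<open>exp (v\<^sup>2 / (2 (\<sigma>2\<^sup>2 - \<sigma>1\<^sup>2)))\<close> in the imaginary part v, which would be too much on a disc containing [-L, L]
when \<open>\<sigma>1\<close> and \<open>\<sigma>2\<close> are close. However, optimality at the boundary points R and -R forces the input to
have enough mass near them for g' to have no zeros outside [-2R, 2R] when R is large, and on a disc
of radius proportional to R, with a factor independent of \<open>\<sigma>1\<close> and \<open>\<sigma>2\<close>, the growth is below
the stated constant. No logarithmic term is then needed.\<close>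

section \<open>Laplace transforms and variation diminution\<close>

text \<open>The function g has no entire extension: it contains \<open>ln (mg \<sigma>1)\<close>,
  which is singular at the complex zeros of \<open>cmg \<sigma>1\<close>. Its other logarithm stands
  under a Gaussian average, where the complex variable can be put into the kernel instead of the
  logarithm; so this term is entire, and the modulus of the complex kernel is what costs the
  exponential factor in v. Hence zeros are counted for g', and Rolle's theorem returns to g at the
  price of one zero. Write c = (\<sigma>2 + \<sigma>1) / (\<sigma>2 - \<sigma>1). As \<sigma>1
  approaches \<sigma>2, the quotient \<sigma>1^2 / (\<sigma>2^2 - \<sigma>1^2) is of order c, so a
  disc of radius about c R yields c^3 R^2 / \<sigma>1^2, while the target is of order c^2 and a
  radius proportional to R yields only order c. The crude lower bound
  \<open>\<tau> * y - R / \<sigma>2\<^sup>2 - R / \<sigma>1\<^sup>2\<close> on g' becomes positive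
  only at distance of order c R. It improves once the logarithm of the second moment function is
  known to have almost its maximal slope past the boundary. The mass of the input near R may be
  tiny, but it cancels when two values of that logarithm are subtracted.\<close>

lemma norm_exp_minus_linear_le:
  fixes z :: complex
  assumes "norm z \<le> r"
  shows "norm (exp z - 1 - z) \<le> norm z ^ 2 * exp r"
proof -
  have "norm (exp z - 1 - z) \<le> exp \<bar>Re z\<bar> * norm z ^ 2"
    using Taylor_exp[of z 1] by (simp add: algebra_simps numeral_2_eq_2)
  also have "\<dots> \<le> exp r * norm z ^ 2"
    using abs_Re_le_cmod[of z] assms by (intro mult_right_mono) auto
  finally show ?thesis by (simp add: mult.commute)
qed

lemma exp_abs_le: "exp (c * \<bar>y\<bar>) \<le> exp (c * y) + exp (-c * y)" for c y :: real
  by (cases "0 \<le> y") (auto simp: abs_if intro: add_increasing add_increasing2)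

lemma abs_le_exp_abs: "\<bar>y\<bar> \<le> exp \<bar>y\<bar>" for y :: real
  using exp_ge_add_one_self[of "\<bar>y\<bar>"] by linarith

lemma square_le_exp_abs: "y\<^sup>2 \<le> 2 * exp \<bar>y\<bar>" for y :: real
  using exp_lower_Taylor_quadratic[of "\<bar>y\<bar>"] by (simp add: algebra_simps)

text \<open>All real exponents at once, so that the transform converges on the whole plane. The
  measure is left general because both Lebesgue measure with a Gaussian-damped weight and the input
  distribution are used.\<close>

definition exp_integrable :: "real measure \<Rightarrow> (real \<Rightarrow> real) \<Rightarrow> bool" where
  "exp_integrable M w \<longleftrightarrow> (\<forall>s. integrable M (\<lambda>y. w y * exp (s * y)))"

lemma exp_integrableD: "exp_integrable M w \<Longrightarrow> integrable M (\<lambda>y. w y * exp (s * y))"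
  by (simp add: exp_integrable_def)

text \<open>Replacing |y| by y or -y costs two shifts of the exponent s, and both shifted integrands
  are integrable by assumption.\<close>

lemma exp_integrable_abs:
  assumes M: "sets M = sets borel" and w: "exp_integrable M w"
  shows "integrable M (\<lambda>y. \<bar>w y\<bar> * exp (c * \<bar>y\<bar>) * exp (s * y))"
proof -
  have [measurable]: "w \<in> borel_measurable M"
    using exp_integrableD[OF w, of 0] by simp
  have [measurable]: "(\<lambda>y. y) \<in> borel_measurable M"
    using M by (simp add: measurable_ident_sets)
  have "integrable M (\<lambda>y. \<bar>w y * exp ((s + c) * y)\<bar> + \<bar>w y * exp ((s - c) * y)\<bar>)"
    by (intro Bochner_Integration.integrable_add integrable_abs exp_integrableD[OF w])
  then show ?thesis
  proof (rule Bochner_Integration.integrable_bound)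
    show "AE y in M. norm (\<bar>w y\<bar> * exp (c * \<bar>y\<bar>) * exp (s * y))
      \<le> norm (\<bar>w y * exp ((s + c) * y)\<bar> + \<bar>w y * exp ((s - c) * y)\<bar>)"
    proof (intro AE_I2)
      fix y
      have "\<bar>w y\<bar> * exp (c * \<bar>y\<bar>) * exp (s * y) \<le> \<bar>w y\<bar> * (exp (c * y) + exp (-c * y)) * exp (s * y)"
        by (intro mult_right_mono mult_left_mono exp_abs_le) auto
      also have "\<dots> = \<bar>w y * exp ((s + c) * y)\<bar> + \<bar>w y * exp ((s - c) * y)\<bar>"
        by (simp add: abs_mult algebra_simps exp_add exp_diff exp_minus)
          (simp add: field_simps flip: exp_add)
      finally show "norm (\<bar>w y\<bar> * exp (c * \<bar>y\<bar>) * exp (s * y))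
        \<le> norm (\<bar>w y * exp ((s + c) * y)\<bar> + \<bar>w y * exp ((s - c) * y)\<bar>)" by simp
    qed
  qed measurable
qed

text \<open>This absorbs the linear factors that differentiating a transform brings down.\<close>

lemma exp_integrable_bound:
  assumes M: "sets M = sets borel" and w: "exp_integrable M w"
    and v: "v \<in> borel_measurable M" and le: "\<And>y. \<bar>v y\<bar> \<le> C * exp \<bar>y\<bar> * \<bar>w y\<bar>"
  shows "exp_integrable M v"
  unfolding exp_integrable_def
proof
  fix s
  note [measurable] = v
  have [measurable]: "(\<lambda>y. y) \<in> borel_measurable M"
    using M by (simp add: measurable_ident_sets)
  have "integrable M (\<lambda>y. C * (\<bar>w y\<bar> * exp (1 * \<bar>y\<bar>) * exp (s * y)))"
    by (intro integrable_mult_right exp_integrable_abs M w)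
  then show "integrable M (\<lambda>y. v y * exp (s * y))"
  proof (rule Bochner_Integration.integrable_bound)
    show "AE y in M. norm (v y * exp (s * y)) \<le> norm (C * (\<bar>w y\<bar> * exp (1 * \<bar>y\<bar>) * exp (s * y)))"
    proof (intro AE_I2)
      fix y
      have "norm (v y * exp (s * y)) \<le> (C * exp \<bar>y\<bar> * \<bar>w y\<bar>) * exp (s * y)"
        using mult_right_mono[OF le[of y], of "exp (s * y)"] by (simp add: abs_mult)
      also have "\<dots> \<le> norm (C * (\<bar>w y\<bar> * exp (1 * \<bar>y\<bar>) * exp (s * y)))"
        by (simp add: mult_ac)
      finally show "norm (v y * exp (s * y)) \<le> norm (C * (\<bar>w y\<bar> * exp (1 * \<bar>y\<bar>) * exp (s * y)))" .
    qed
  qed measurable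
qed

lemma exp_integrable_times_linear:
  assumes M: "sets M = sets borel" and w: "exp_integrable M w"
  shows "exp_integrable M (\<lambda>y. (y - a) * w y)"
proof (rule exp_integrable_bound[OF M w])
  have [measurable]: "w \<in> borel_measurable M" "(\<lambda>y. y) \<in> borel_measurable M"
    using exp_integrableD[OF w, of 0] M by (simp_all add: measurable_ident_sets)
  show "(\<lambda>y. (y - a) * w y) \<in> borel_measurable M" by measurable
  fix y :: real
  have "\<bar>y - a\<bar> \<le> \<bar>y\<bar> + \<bar>a\<bar>" by linarith
  also have "\<dots> \<le> (1 + \<bar>a\<bar>) * exp \<bar>y\<bar>"
    using abs_le_exp_abs[of y] one_le_exp_iff[of "\<bar>y\<bar>"] mult_left_mono[of 1 "exp \<bar>y\<bar>" "\<bar>a\<bar>"]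
    by (simp add: algebra_simps)
  finally have "\<bar>y - a\<bar> * \<bar>w y\<bar> \<le> ((1 + \<bar>a\<bar>) * exp \<bar>y\<bar>) * \<bar>w y\<bar>"
    by (rule mult_right_mono) simp
  then show "\<bar>(y - a) * w y\<bar> \<le> (1 + \<bar>a\<bar>) * exp \<bar>y\<bar> * \<bar>w y\<bar>" by (simp add: abs_mult)
qed

definition laplace :: "real measure \<Rightarrow> (real \<Rightarrow> real) \<Rightarrow> complex \<Rightarrow> complex" where
  "laplace M w \<zeta> = (\<integral>y. of_real (w y) * exp (\<zeta> * of_real y) \<partial>M)"

lemma laplace_integrable:
  assumes M: "sets M = sets borel" and w: "exp_integrable M w"
  shows "integrable M (\<lambda>y. complex_of_real (w y) * exp (\<zeta> * of_real y))"
proof (rule Bochner_Integration.integrable_bound[OF exp_integrableD[OF w, of "Re \<zeta>"]])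
  have [measurable]: "w \<in> borel_measurable M" "(\<lambda>y. y) \<in> borel_measurable M"
    using exp_integrableD[OF w, of 0] M by (simp_all add: measurable_ident_sets)
  show "(\<lambda>y. complex_of_real (w y) * exp (\<zeta> * of_real y)) \<in> borel_measurable M"
    by measurable
qed (simp add: norm_mult)

lemma laplace_of_real:
  "laplace M w (of_real x) = of_real (\<integral>y. w y * exp (x * y) \<partial>M)"
proof -
  have "laplace M w (of_real x) = (\<integral>y. complex_of_real (w y * exp (x * y)) \<partial>M)"
    unfolding laplace_def
    by (intro Bochner_Integration.integral_cong refl) (simp flip: exp_of_real)
  then show ?thesis by (simp del: of_real_mult)
qed

lemma norm_laplace_le:
  assumes M: "sets M = sets borel" and w: "exp_integrable M w"
  shows "norm (laplace M w \<zeta>) \<le> (\<integral>y. \<bar>w y\<bar> * exp (Re \<zeta> * y) \<partial>M)"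
proof -
  have "norm (laplace M w \<zeta>) \<le> (\<integral>y. norm (complex_of_real (w y) * exp (\<zeta> * of_real y)) \<partial>M)"
    unfolding laplace_def by (rule integral_norm_bound)
  then show ?thesis by (simp add: norm_mult)
qed

text \<open>The Taylor remainder of the exponential is quadratic in h with an integrable majorant
  for |h| at most 1, so the difference quotient misses the derivative by at most
  \<open>norm h * K\<close>.\<close>

lemma laplace_has_field_derivative:
  assumes M: "sets M = sets borel" and w: "exp_integrable M w"
  shows "(laplace M w has_field_derivative laplace M (\<lambda>y. y * w y) \<zeta>) (at \<zeta>)"
proof -
  have [measurable]: "w \<in> borel_measurable M" "(\<lambda>y. y) \<in> borel_measurable M"
    using exp_integrableD[OF w, of 0] M by (simp_all add: measurable_ident_sets)
  have yw: "exp_integrable M (\<lambda>y. y * w y)"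
    using exp_integrable_times_linear[OF M w, of 0] by simp
  \<comment> \<open>The factor 2 and the rate 2 come from \<open>y\<^sup>2 * exp \<bar>y\<bar> \<le>
    2 * exp (2 * \<bar>y\<bar>)\<close>.\<close>
  define K where "K = (\<integral>y. 2 * (\<bar>w y\<bar> * exp (2 * \<bar>y\<bar>) * exp (Re \<zeta> * y)) \<partial>M)"
  have quad: "norm (laplace M w (\<zeta> + h) - laplace M w \<zeta> - h * laplace M (\<lambda>y. y * w y) \<zeta>) \<le> norm h ^ 2 * K"
    if "norm h \<le> 1" for h
  proof -
    have "laplace M w (\<zeta> + h) - laplace M w \<zeta> - h * laplace M (\<lambda>y. y * w y) \<zeta>
      = (\<integral>y. of_real (w y) * exp (\<zeta> * of_real y) * (exp (h * of_real y) - 1 - h * of_real y) \<partial>M)"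
    proof -
      note i = laplace_integrable[OF M w, of "\<zeta> + h"] laplace_integrable[OF M w, of \<zeta>]
        integrable_mult_right[OF laplace_integrable[OF M yw, of \<zeta>], of h]
      have "laplace M w (\<zeta> + h) - laplace M w \<zeta> - h * laplace M (\<lambda>y. y * w y) \<zeta>
       = (\<integral>y. of_real (w y) * exp ((\<zeta> + h) * of_real y) - of_real (w y) * exp (\<zeta> * of_real y)
            - h * (of_real (y * w y) * exp (\<zeta> * of_real y)) \<partial>M)"
        unfolding laplace_def using i by (simp del: of_real_mult)
      also have "\<dots> = (\<integral>y. of_real (w y) * exp (\<zeta> * of_real y) * (exp (h * of_real y) - 1 - h * of_real y) \<partial>M)"
        by (intro Bochner_Integration.integral_cong refl) (simp add: algebra_simps exp_add)
      finally show ?thesis .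
    qed
    also have "norm \<dots> \<le> (\<integral>y. norm h ^ 2 * (2 * (\<bar>w y\<bar> * exp (2 * \<bar>y\<bar>) * exp (Re \<zeta> * y))) \<partial>M)"
    proof (rule Bochner_Integration.integral_norm_bound_integral)
      show "integrable M (\<lambda>y. norm h ^ 2 * (2 * (\<bar>w y\<bar> * exp (2 * \<bar>y\<bar>) * exp (Re \<zeta> * y))))"
        by (intro integrable_mult_right exp_integrable_abs[OF M w])
      have "integrable M (\<lambda>y. of_real (w y) * exp ((\<zeta> + h) * of_real y) - of_real (w y) * exp (\<zeta> * of_real y)
            - h * (of_real (y * w y) * exp (\<zeta> * of_real y)))"
        by (intro Bochner_Integration.integrable_diff integrable_mult_right laplace_integrable[OF M w] laplace_integrable[OF M yw])
      moreover have "(\<lambda>y. of_real (w y) * exp ((\<zeta> + h) * of_real y) - of_real (w y) * exp (\<zeta> * of_real y)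
            - h * (of_real (y * w y) * exp (\<zeta> * of_real y)))
          = (\<lambda>y. of_real (w y) * exp (\<zeta> * of_real y) * (exp (h * of_real y) - 1 - h * of_real y))"
        by (rule ext) (simp add: algebra_simps exp_add)
      ultimately show "integrable M (\<lambda>y. of_real (w y) * exp (\<zeta> * of_real y) * (exp (h * of_real y) - 1 - h * of_real y))"
        by simp
      fix y
      have "norm (h * of_real y) \<le> \<bar>y\<bar>"
        using that mult_right_mono[of "norm h" 1 "\<bar>y\<bar>"] by (simp add: norm_mult)
      from norm_exp_minus_linear_le[OF this]
      have "norm (exp (h * of_real y) - 1 - h * of_real y) \<le> norm h ^ 2 * (y\<^sup>2 * exp \<bar>y\<bar>)"
        by (simp add: norm_mult power_mult_distrib mult_ac)
      also have "\<dots> \<le> norm h ^ 2 * ((2 * exp \<bar>y\<bar>) * exp \<bar>y\<bar>)"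
        by (intro mult_left_mono mult_right_mono square_le_exp_abs) auto
      finally have e: "norm (exp (h * of_real y) - 1 - h * of_real y) \<le> norm h ^ 2 * (2 * exp (2 * \<bar>y\<bar>))"
        by (simp add: mult.assoc mult_exp_exp)
      have "norm (of_real (w y) * exp (\<zeta> * of_real y) * (exp (h * of_real y) - 1 - h * of_real y))
         = \<bar>w y\<bar> * exp (Re \<zeta> * y) * norm (exp (h * of_real y) - 1 - h * of_real y)"
        by (simp add: norm_mult)
      also have "\<dots> \<le> \<bar>w y\<bar> * exp (Re \<zeta> * y) * (norm h ^ 2 * (2 * exp (2 * \<bar>y\<bar>)))"
        by (intro mult_left_mono e) auto
      finally show "norm (of_real (w y) * exp (\<zeta> * of_real y) * (exp (h * of_real y) - 1 - h * of_real y))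
         \<le> norm h ^ 2 * (2 * (\<bar>w y\<bar> * exp (2 * \<bar>y\<bar>) * exp (Re \<zeta> * y)))"
        by (simp add: mult_ac)
    qed
    also have "\<dots> = norm h ^ 2 * K" unfolding K_def by simp
    finally show ?thesis .
  qed
  show ?thesis
    unfolding DERIV_def
  proof (rule LIM_zero_cancel, rule tendsto_0_le[where K = 1])
    show "((\<lambda>h::complex. norm h * K) \<longlongrightarrow> 0) (at 0)"
      by (auto intro!: tendsto_eq_intros)
    have "\<forall>\<^sub>F h in at (0::complex). norm h \<le> 1 \<and> h \<noteq> 0"
      unfolding eventually_at by (rule exI[of _ 1]) auto
    then show "\<forall>\<^sub>F h in at 0. norm ((laplace M w (\<zeta> + h) - laplace M w \<zeta>) / h - laplace M (\<lambda>y. y * w y) \<zeta>)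
        \<le> norm (norm h * K) * 1"
    proof eventually_elim
      fix h :: complex assume h: "norm h \<le> 1 \<and> h \<noteq> 0"
      then have "norm ((laplace M w (\<zeta> + h) - laplace M w \<zeta>) / h - laplace M (\<lambda>y. y * w y) \<zeta>)
        = norm (laplace M w (\<zeta> + h) - laplace M w \<zeta> - h * laplace M (\<lambda>y. y * w y) \<zeta>) / norm h"
        by (simp add: field_simps flip: norm_divide)
      also have "\<dots> \<le> (norm h ^ 2 * K) / norm h"
        using quad h by (intro divide_right_mono) auto
      also have "\<dots> \<le> norm (norm h * K) * 1"
        using h by (simp add: power2_eq_square abs_mult mult_left_mono)
      finally show "norm ((laplace M w (\<zeta> + h) - laplace M w \<zeta>) / h - laplace M (\<lambda>y. y * w y) \<zeta>)
        \<le> norm (norm h * K) * 1" .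
    qed
  qed
qed

lemma laplace_holomorphic:
  assumes "sets M = sets borel" "exp_integrable M w"
  shows "laplace M w holomorphic_on A"
  using laplace_has_field_derivative[OF assms]
  by (meson field_differentiable_at_within field_differentiable_def holomorphic_onI)

section \<open>Restriction to the real line and Rolle counting\<close>

lemma has_real_derivative_of_holomorphic:
  assumes "(H has_field_derivative H') (at (of_real x))"
  shows "((\<lambda>y. Re (H (of_real y))) has_real_derivative Re H') (at x)"
proof -
  have "((\<lambda>y. H (of_real y)) has_vector_derivative H') (at x)"
    using has_vector_derivative_real_field[OF assms] by simp
  then have "((\<lambda>y. Re (H (of_real y))) has_vector_derivative Re H') (at x)"
    by (rule bounded_linear.has_vector_derivative[OF bounded_linear_Re])
  then show ?thesis by (simp add: has_real_derivative_iff_has_vector_derivative)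
qed

lemma laplace_real_derivative:
  assumes M: "sets M = sets borel" and w: "exp_integrable M w"
  shows "((\<lambda>x. \<integral>y. w y * exp (x * y) \<partial>M) has_real_derivative (\<integral>y. y * w y * exp (x * y) \<partial>M)) (at x)"
  using has_real_derivative_of_holomorphic[OF laplace_has_field_derivative[OF M w, of "of_real x"]]
  by (simp add: laplace_of_real)

text \<open>The new points avoid \<open>S\<close>, so that they can later be added to the critical
  points that multiple zeros in \<open>S\<close> already supply, and they stay between its extremes,
  hence in the same interval.\<close>

lemma rolle_zeros_between:
  fixes h h' :: "real \<Rightarrow> real"
  assumes der: "\<And>x. (h has_real_derivative h' x) (at x)"
    and S: "finite S" "S \<noteq> {}" "\<And>x. x \<in> S \<Longrightarrow> h x = 0"
  shows "\<exists>W. finite W \<and> Suc (card W) = card S \<and> W \<inter> S = {} \<and>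
           (\<forall>x\<in>W. h' x = 0 \<and> Min S < x \<and> x < Max S)"
  using S
proof (induction S rule: finite_linorder_max_induct)
  case empty
  then show ?case by simp
next
  case (insert b A)
  show ?case
  proof (cases "A = {}")
    case True
    then show ?thesis by (intro exI[of _ "{}"]) auto
  next
    case False
    then obtain W where W: "finite W" "Suc (card W) = card A" "W \<inter> A = {}"
      "\<forall>x\<in>W. h' x = 0 \<and> Min A < x \<and> x < Max A"
      using insert by auto
    define a where "a = Max A"
    have a: "a \<in> A" "a < b" using False insert by (auto simp: a_def)
    have "\<exists>z. a < z \<and> z < b \<and> h' z = 0"
    proof -
      have "\<exists>z>a. z < b \<and> (\<lambda>v. h' z * v) = (\<lambda>v. 0)"
      proof (rule Rolle_deriv[where f = h])
        show "continuous_on {a..b} h"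
          using der by (intro DERIV_continuous_on) (auto intro: has_field_derivative_at_within)
        show "h a = h b" using a insert.prems by simp
      qed (use a der in \<open>auto simp: has_field_derivative_def\<close>)
      then show ?thesis by (metis mult.right_neutral)
    qed
    then obtain z where z: "a < z" "z < b" "h' z = 0" by blast
    have zW: "z \<notin> W" using W z by (auto simp: a_def)
    have zA: "z \<notin> A" using z insert.hyps by (auto simp: a_def) (metis Max_ge insert.hyps(1) not_less)
    have mm: "Min (insert b A) = Min A" "Max (insert b A) = b"
      using False insert.hyps(1) a Min_le[of A a] by (auto simp: min_def max_def a_def[symmetric])
    have "Min A \<le> a" using a insert.hyps by simp
    then have "\<forall>x\<in>insert z W. h' x = 0 \<and> Min (insert b A) < x \<and> x < Max (insert b A)"
      unfolding mm using W(4) z a by (auto simp: a_def[symmetric])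
    moreover have "b \<notin> W" using W(4) a by (auto simp: a_def[symmetric])
    moreover have "b \<notin> A" using insert.hyps by auto
    ultimately show ?thesis
      using W(1-3) zW zA z insert.hyps by (intro exI[of _ "insert z W"]) auto
  qed
qed

lemma rolle_card:
  fixes h h' :: "real \<Rightarrow> real"
  assumes der: "\<And>x. (h has_real_derivative h' x) (at x)"
    and fin: "finite {x. h' x = 0}" and card: "card {x. h' x = 0} \<le> n"
  shows "finite {x. h x = 0} \<and> card {x. h x = 0} \<le> Suc n"
proof -
  have *: "card S \<le> Suc n" if S: "finite S" "S \<subseteq> {x. h x = 0}" for S
  proof (cases "S = {}")
    case False
    obtain W where W: "finite W" "Suc (card W) = card S" "\<forall>x\<in>W. h' x = 0"
      using rolle_zeros_between[OF der S(1) False] S(2) by blast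
    have "card W \<le> card {x. h' x = 0}" using W fin by (intro card_mono) auto
    then show ?thesis using W card by simp
  qed simp
  have "finite {x. h x = 0}"
  proof (rule ccontr)
    assume "infinite {x. h x = 0}"
    then obtain S where "S \<subseteq> {x. h x = 0}" "finite S" "card S = Suc (Suc n)"
      using infinite_arbitrarily_large by blast
    then show False using *[of S] by simp
  qed
  then show ?thesis using * by auto
qed

text \<open>For a in Y, the factor exp (-a x) does not change the zeros of the transform, and the product has as
derivative exp (-a x) times the transform of the weight multiplied by y - a, which loses the sign change at a.\<close>

lemma laplace_zeros_card_le:
  assumes "finite Y" "exp_integrable lborel w"
    and "\<And>y. 0 \<le> w y * (\<Prod>a\<in>Y. y - a)" "\<not> (AE y in lborel. w y = 0)"
  shows "finite {x. (\<integral>y. w y * exp (x * y) \<partial>lborel) = 0} \<and>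
         card {x. (\<integral>y. w y * exp (x * y) \<partial>lborel) = 0} \<le> card Y"
  using assms
proof (induction Y arbitrary: w rule: finite_induct)
  case empty
  have "(\<integral>y. w y * exp (x * y) \<partial>lborel) \<noteq> 0" for x
  proof
    assume "(\<integral>y. w y * exp (x * y) \<partial>lborel) = 0"
    then have "AE y in lborel. w y * exp (x * y) = 0"
      using empty by (subst (asm) integral_nonneg_eq_0_iff_AE) (auto intro: exp_integrableD)
    then show False using empty by simp
  qed
  then show ?case by simp
next
  case (insert a Y)
  define L where "L x = (\<integral>y. w y * exp (x * y) \<partial>lborel)" for x
  define L' where "L' x = (\<integral>y. ((y - a) * w y) * exp (x * y) \<partial>lborel)" for x
  have yw: "exp_integrable lborel (\<lambda>y. y * w y)"
    using exp_integrable_times_linear[OF _ insert.prems(1), of 0] by simp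
  have L': "L' x = (\<integral>y. y * w y * exp (x * y) \<partial>lborel) - a * L x" for x
  proof -
    have "L' x = (\<integral>y. y * w y * exp (x * y) - a * (w y * exp (x * y)) \<partial>lborel)"
      unfolding L'_def by (intro Bochner_Integration.integral_cong) (auto simp: algebra_simps)
    also have "\<dots> = (\<integral>y. y * w y * exp (x * y) \<partial>lborel) - a * L x"
      using exp_integrableD[OF yw, of x] exp_integrableD[OF insert.prems(1), of x] by (simp add: L_def)
    finally show ?thesis .
  qed
  have fin: "finite {x. L' x = 0} \<and> card {x. L' x = 0} \<le> card Y"
    unfolding L'_def
  proof (rule insert.IH)
    show "exp_integrable lborel (\<lambda>y. (y - a) * w y)"
      by (rule exp_integrable_times_linear) (use insert.prems in auto)
    show "0 \<le> (y - a) * w y * (\<Prod>b\<in>Y. y - b)" for y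
      using insert.prems(2)[of y] insert.hyps by (simp add: mult_ac)
    show "\<not> (AE y in lborel. (y - a) * w y = 0)"
    proof
      assume "AE y in lborel. (y - a) * w y = 0"
      moreover have "AE y in lborel. y \<noteq> a" by (rule AE_lborel_singleton)
      ultimately have "AE y in lborel. w y = 0" by eventually_elim auto
      with insert.prems show False by simp
    qed
  qed
  have "((\<lambda>x. exp (- a * x) * L x) has_real_derivative exp (- a * x) * L' x) (at x)" for x
    unfolding L' using laplace_real_derivative[OF _ insert.prems(1), of x] unfolding L_def[symmetric]
    by (auto intro!: derivative_eq_intros simp: algebra_simps)
  from rolle_card[OF this, of "card Y"] fin
  have "finite {x. L x = 0} \<and> card {x. L x = 0} \<le> Suc (card Y)" by simp
  then show ?case using insert.hyps by (simp add: L_def)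
qed

section \<open>Counting zeros with multiplicity\<close>

text \<open>\<open>S\<close> collects the points where the sign really flips. The polynomial with
  simple roots exactly there flips at the same places, so it agrees in sign with \<open>s\<close> up
  to one global sign.\<close>

lemma finite_sign_changes:
  fixes s :: "real \<Rightarrow> real"
  assumes "finite Z" "\<And>y. y \<notin> Z \<Longrightarrow> s y = 1 \<or> s y = -1"
    and "\<And>x y. x < y \<Longrightarrow> {x..y} \<inter> Z = {} \<Longrightarrow> s x = s y"
  shows "\<exists>S\<subseteq>Z. \<exists>\<epsilon>. (\<epsilon> = 1 \<or> \<epsilon> = -1) \<and> (\<forall>y. y \<notin> Z \<longrightarrow> 0 < \<epsilon> * s y * (\<Prod>a\<in>S. y - a))"
  using assms
proof (induction Z arbitrary: s rule: finite_linorder_max_induct)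
  case empty
  have "s y = s 0" for y
    by (metis Int_empty_right empty(2) linorder_neqE_linordered_idom)
  then show ?case using empty(1)[of 0] by (intro exI[of _ "{}"] conjI exI[of _ "s 0"]) auto
next
  case (insert b A)
  \<comment> \<open>A sample point between \<open>b\<close> and the points of \<open>A\<close>; it
    carries the sign just to the left of \<open>b\<close>.\<close>
  define m where "m = (if A = {} then b - 1 else (Max A + b) / 2)"
  have m: "m < b" "\<And>a. a \<in> A \<Longrightarrow> a < m"
  proof -
    show "m < b" using insert.hyps by (auto simp: m_def)
    fix a assume a: "a \<in> A"
    then have "a \<le> Max A" "Max A < b" using insert.hyps(1,2) a Max_in[of A] Max_ge[of A a] by blast+
    then show "a < m" using a by (auto simp: m_def)
  qed
  \<comment> \<open>The sign left of \<open>b\<close> is continued to the right, which removes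
    \<open>b\<close> as a possible sign change.\<close>
  define s' where "s' y = (if y < b then s y else s m)" for y
  have mA: "m \<notin> insert b A" using m by force
  have "\<exists>S\<subseteq>A. \<exists>\<epsilon>. (\<epsilon> = 1 \<or> \<epsilon> = -1) \<and> (\<forall>y. y \<notin> A \<longrightarrow> 0 < \<epsilon> * s' y * (\<Prod>a\<in>S. y - a))"
  proof (rule insert.IH)
    show "s' y = 1 \<or> s' y = -1" if "y \<notin> A" for y
      using that insert.prems(1)[of y] insert.prems(1)[of m] mA by (auto simp: s'_def)
    fix x y :: real assume xy: "x < y" "{x..y} \<inter> A = {}"
    consider "y < b" | "b \<le> x" | "x < b" "b \<le> y" by linarith
    then show "s' x = s' y"
    proof cases
      case 1
      then show ?thesis using insert.prems(2)[of x y] xy by (auto simp: s'_def)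
    next
      case 3
      have "s x = s m"
      proof (cases x m rule: linorder_cases)
        case less
        have "{x..m} \<inter> insert b A = {}" using xy 3 m by force
        then show ?thesis using insert.prems(2) less by blast
      next
        case greater
        have "{m..x} \<inter> insert b A = {}" using xy 3 m by force
        then show ?thesis using insert.prems(2)[of m x] greater by simp
      qed simp
      then show ?thesis using 3 by (simp add: s'_def)
    qed (use xy in \<open>auto simp: s'_def\<close>)
  qed
  then obtain S \<epsilon> where S: "S \<subseteq> A" "\<epsilon> = 1 \<or> \<epsilon> = -1"
    and pos: "\<And>y. y \<notin> A \<Longrightarrow> 0 < \<epsilon> * s' y * (\<Prod>a\<in>S. y - a)" by blast
  have right: "s y = s (b + 1)" if "b < y" for y
  proof -
    have "a \<le> b" if "a \<in> insert b A" for a using that insert.hyps by force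
    then have "{y..b + 1} \<inter> insert b A = {}" "{b + 1..y} \<inter> insert b A = {}"
      using \<open>b < y\<close> by force+
    then show ?thesis
      by (metis insert.prems(2) linorder_neqE_linordered_idom)
  qed
  have bA: "b \<notin> A" "b + 1 \<notin> insert b A" using insert.hyps by force+
  have finS: "finite S" "b \<notin> S" using S insert.hyps by (auto intro: finite_subset)
  show ?case
  proof (cases "s (b + 1) = s m")
    case True
    have "0 < \<epsilon> * s y * (\<Prod>a\<in>S. y - a)" if "y \<notin> insert b A" for y
      using pos[of y] that right[of y] True by (auto simp: s'_def split: if_splits)
    then show ?thesis using S by blast
  next
    case False
    then have flip: "s (b + 1) = - s m"
      using insert.prems(1)[OF bA(2)] insert.prems(1)[OF mA] by auto
    \<comment> \<open>The factor y - b is negative on the left of \<open>b\<close>, where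
      -\<epsilon> compensates it; on the right both the sign of \<open>s\<close> and that of
      \<epsilon> are reversed relative to the induction hypothesis.\<close>
    have "0 < - \<epsilon> * s y * (\<Prod>a\<in>insert b S. y - a)" if y: "y \<notin> insert b A" for y
    proof -
      have *: "- \<epsilon> * s y * (\<Prod>a\<in>insert b S. y - a) = (\<epsilon> * s y * (\<Prod>a\<in>S. y - a)) * (b - y)"
        using finS by (simp add: algebra_simps)
      show ?thesis
      proof (cases "y < b")
        case True
        then have "0 < \<epsilon> * s y * (\<Prod>a\<in>S. y - a)" using pos[of y] y by (simp add: s'_def)
        then show ?thesis unfolding * by (rule mult_pos_pos) (use True in simp)
      next
        case False
        then have "b < y" using y by auto
        then have "\<epsilon> * s y * (\<Prod>a\<in>S. y - a) < 0"
          using pos[of y] y right[of y] flip by (simp add: s'_def)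
        then show ?thesis unfolding * using \<open>b < y\<close> by (intro mult_neg_neg) auto
      qed
    qed
    moreover have "insert b S \<subseteq> insert b A" using S by auto
    ultimately show ?thesis using S(2) by (intro exI[of _ "insert b S"]) auto
  qed
qed

text \<open>By the intermediate value theorem \<open>sgn q\<close> is constant between consecutive
  zeros, so the combinatorial lemma applies to it; zeros without a sign change stay outside
  \<open>S\<close>.\<close>

lemma continuous_sign_changes:
  fixes q :: "real \<Rightarrow> real"
  assumes fin: "finite {y. q y = 0}" and cont: "continuous_on UNIV q"
  obtains S \<epsilon> where "S \<subseteq> {y. q y = 0}" "\<epsilon> \<noteq> 0" "\<And>y. 0 \<le> \<epsilon> * q y * (\<Prod>a\<in>S. y - a)"
proof -
  have "\<exists>S\<subseteq>{y. q y = 0}. \<exists>\<epsilon>. (\<epsilon> = 1 \<or> \<epsilon> = -1) \<and>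
    (\<forall>y. y \<notin> {y. q y = 0} \<longrightarrow> 0 < \<epsilon> * sgn (q y) * (\<Prod>a\<in>S. y - a))"
  proof (rule finite_sign_changes[OF fin])
    fix x y :: real assume xy: "x < y" "{x..y} \<inter> {y. q y = 0} = {}"
    then have nz: "q t \<noteq> 0" if "x \<le> t" "t \<le> y" for t using that by auto
    have c: "continuous_on {x..y} q" using cont continuous_on_subset by blast
    show "sgn (q x) = sgn (q y)"
    proof (rule ccontr)
      assume "sgn (q x) \<noteq> sgn (q y)"
      then have "q x < 0 \<and> 0 < q y \<or> 0 < q x \<and> q y < 0"
        using nz[of x] nz[of y] xy by (auto simp: sgn_if split: if_splits)
      then obtain t where "x \<le> t" "t \<le> y" "q t = 0"
        using IVT'[of q x 0 y] IVT2'[of q y 0 x] c xy by (metis less_imp_le)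
      with nz show False by blast
    qed
  qed (auto simp: sgn_if)
  then obtain S \<epsilon> where S: "S \<subseteq> {y. q y = 0}" "\<epsilon> = 1 \<or> \<epsilon> = -1"
    and pos: "\<And>y. q y \<noteq> 0 \<Longrightarrow> 0 < \<epsilon> * sgn (q y) * (\<Prod>a\<in>S. y - a)" by auto
  have "0 \<le> \<epsilon> * q y * (\<Prod>a\<in>S. y - a)" for y
  proof (cases "q y = 0")
    case False
    have "0 \<le> \<bar>q y\<bar> * (\<epsilon> * sgn (q y) * (\<Prod>a\<in>S. y - a))"
      using pos[OF False] by (intro mult_nonneg_nonneg[OF abs_ge_zero]) simp
    also have "\<dots> = \<epsilon> * (\<bar>q y\<bar> * sgn (q y)) * (\<Prod>a\<in>S. y - a)" by (simp add: mult_ac)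
    also have "\<bar>q y\<bar> * sgn (q y) = q y" by (simp add: abs_mult_sgn)
    finally show ?thesis .
  qed simp
  with S that[of S \<epsilon>] show ?thesis by auto
qed

text \<open>Splitting off one linear factor at a time, the modulus at the centre is multiplied by at least
  \<open>1 / \<rho>\<close> and the maximum on the circle by at most \<open>1 / (\<theta> \<rho>)\<close>.\<close>

lemma holomorphic_zeros_bound:
  fixes F :: "complex \<Rightarrow> complex" and n :: "real \<Rightarrow> nat"
  assumes "finite S" "0 < \<rho>" "0 < \<theta>" "\<And>s. s \<in> S \<Longrightarrow> norm (of_real s - p) \<le> \<rho>"
    and "F holomorphic_on UNIV" "F p \<noteq> 0"
    and "\<And>z. norm (z - p) = (\<theta> + 1) * \<rho> \<Longrightarrow> norm (F z) \<le> M"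
    and "\<And>s. s \<in> S \<Longrightarrow> \<exists>K. \<forall>\<^sub>F x in at s. norm (F (of_real x)) \<le> K * \<bar>x - s\<bar> ^ n s"
  shows "norm (F p) * \<theta> ^ (\<Sum>s\<in>S. n s) \<le> M"
  using assms(5-)
proof (induction "\<Sum>s\<in>S. n s" arbitrary: F n M)
  case 0
  have "norm (F p) \<le> M"
  proof (rule maximum_modulus_frontier[where f = F and \<xi> = p and S = "cball p ((\<theta> + 1) * \<rho>)"])
    show "F holomorphic_on (interior (cball p ((\<theta> + 1) * \<rho>)))"
      by (rule holomorphic_on_subset[OF "0.prems"(1)]) simp
    show "continuous_on (closure (cball p ((\<theta> + 1) * \<rho>))) F"
      using holomorphic_on_imp_continuous_on[OF "0.prems"(1)] continuous_on_subset by blast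
    fix z assume "z \<in> frontier (cball p ((\<theta> + 1) * \<rho>))"
    then show "norm (F z) \<le> M"
      using "0.prems"(3)[of z] by (simp add: dist_norm norm_minus_commute)
  qed (use assms in auto)
  with 0 show ?case by simp
next
  case (Suc k)
  have "\<exists>s\<in>S. n s \<noteq> 0"
  proof (rule ccontr)
    assume "\<not> ?thesis"
    with Suc(2) show False by simp
  qed
  then obtain s where s: "s \<in> S" "n s \<noteq> 0" by blast
  define n' where "n' = n(s := n s - 1)"
  have "sum n S = n s + sum n (S - {s})" "sum n' S = n' s + sum n' (S - {s})"
    using assms(1) s by (simp_all add: sum.remove)
  moreover have "sum n' (S - {s}) = sum n (S - {s})"
    by (intro sum.cong) (auto simp: n'_def)
  ultimately have k: "k = sum n' S" using Suc(2) s by (simp add: n'_def)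
  have contF: "continuous (at (of_real s)) (\<lambda>z. F z)"
    using holomorphic_on_imp_continuous_on[OF Suc.prems(1)]
    by (simp add: continuous_on_eq_continuous_at)
  \<comment> \<open>Multiplicity is encoded as a decay rate along the real line; a positive rate and
    continuity give a zero.\<close>
  have Fs: "F (of_real s) = 0"
  proof -
    obtain K where K: "\<forall>\<^sub>F x in at s. norm (F (of_real x)) \<le> K * \<bar>x - s\<bar> ^ n s"
      using Suc.prems(4) s by blast
    have "((\<lambda>x. F (of_real x)) \<longlongrightarrow> 0) (at s)"
    proof (rule Lim_null_comparison[OF K])
      show "((\<lambda>x. K * \<bar>x - s\<bar> ^ n s) \<longlongrightarrow> 0) (at s)"
        using s by (auto intro!: tendsto_eq_intros)
    qed
    moreover have "((\<lambda>x. F (of_real x)) \<longlongrightarrow> F (of_real s)) (at s)"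
      using contF by (intro isCont_tendsto_compose[of _ F]) (auto intro!: tendsto_intros)
    ultimately show ?thesis using LIM_unique by blast
  qed
  \<comment> \<open>The singularity at \<open>s\<close> is removable, so the quotient is again
    entire and its assumed order at \<open>s\<close> is one less.\<close>
  define G where "G z = (if z = of_real s then deriv F (of_real s) else F z / (z - of_real s))" for z
  have G: "G holomorphic_on UNIV"
    using pole_lemma[OF Suc.prems(1), of "of_real s"] unfolding Fs G_def[abs_def] diff_zero by simp
  have ps: "p \<noteq> of_real s" using Fs Suc.prems(2) by auto
  have "norm (G p) * \<theta> ^ sum n' S \<le> M / (\<theta> * \<rho>)"
  proof (rule Suc.hyps(1)[OF k G])
    show "G p \<noteq> 0" using ps Suc.prems(2) by (simp add: G_def)
    fix z assume z: "norm (z - p) = (\<theta> + 1) * \<rho>"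
    have "norm (z - p) \<le> norm (z - of_real s) + norm (of_real s - p)"
      using norm_triangle_ineq[of "z - of_real s" "of_real s - p"] by simp
    then have d: "\<theta> * \<rho> \<le> norm (z - of_real s)"
      using z assms(4)[OF s(1)] by (simp add: algebra_simps)
    moreover have "0 < \<theta> * \<rho>" using assms(2,3) by simp
    ultimately have "z \<noteq> of_real s" by auto
    then have "norm (G z) = norm (F z) / norm (z - of_real s)" by (simp add: G_def norm_divide)
    also have "\<dots> \<le> M / (\<theta> * \<rho>)"
      using d \<open>0 < \<theta> * \<rho>\<close> Suc.prems(3)[OF z] norm_ge_zero[of "F z"] by (intro frac_le) linarith+
    finally show "norm (G z) \<le> M / (\<theta> * \<rho>)" .
  next
    fix t assume t: "t \<in> S"
    obtain K where K: "\<forall>\<^sub>F x in at t. norm (F (of_real x)) \<le> K * \<bar>x - t\<bar> ^ n t"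
      using Suc.prems(4) t by blast
    show "\<exists>K. \<forall>\<^sub>F x in at t. norm (G (of_real x)) \<le> K * \<bar>x - t\<bar> ^ n' t"
    proof (cases "t = s")
      case True
      have "\<forall>\<^sub>F x in at t. x \<noteq> t" by (simp add: eventually_at_filter)
      with K have "\<forall>\<^sub>F x in at t. norm (G (of_real x)) \<le> K * \<bar>x - t\<bar> ^ n' t"
      proof eventually_elim
        case (elim x)
        have "norm (G (of_real x)) = norm (F (of_real x)) / \<bar>x - s\<bar>"
          using elim True by (simp add: G_def norm_divide flip: of_real_diff)
        also have "\<dots> \<le> (K * \<bar>x - s\<bar> ^ n s) / \<bar>x - s\<bar>"
          using elim True by (intro divide_right_mono) auto
        also have "\<dots> = K * \<bar>x - t\<bar> ^ n' t"
          using elim True s by (cases "n s") (auto simp: n'_def)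
        finally show ?case .
      qed
      then show ?thesis by blast
    next
      case False
      \<comment> \<open>Near another point \<open>t\<close> the divisor stays above |t - s| / 2, so
        the decay rate there is preserved with a larger constant.\<close>
      have "((\<lambda>x. \<bar>x - s\<bar>) \<longlongrightarrow> \<bar>t - s\<bar>) (at t)" by (intro tendsto_intros)
      then have "\<forall>\<^sub>F x in at t. \<bar>t - s\<bar> / 2 < \<bar>x - s\<bar>"
        using False by (intro order_tendstoD) auto
      with K have "\<forall>\<^sub>F x in at t. norm (G (of_real x)) \<le> (K / (\<bar>t - s\<bar> / 2)) * \<bar>x - t\<bar> ^ n' t"
      proof eventually_elim
        case (elim x)
        then have "norm (G (of_real x)) = norm (F (of_real x)) / \<bar>x - s\<bar>"
          by (auto simp: G_def norm_divide simp flip: of_real_diff)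
        also have "\<dots> \<le> (K * \<bar>x - t\<bar> ^ n t) / (\<bar>t - s\<bar> / 2)"
          using elim False by (intro frac_le order_trans[OF norm_ge_zero elim(1)]) auto
        also have "\<dots> = (K / (\<bar>t - s\<bar> / 2)) * \<bar>x - t\<bar> ^ n' t"
          using False by (simp add: n'_def)
        finally show ?case .
      qed
      then show ?thesis by blast
    qed
  qed
  moreover have "norm (F p) / \<rho> \<le> norm (G p)"
  proof -
    have "norm (p - of_real s) \<le> \<rho>" "0 < norm (p - of_real s)"
      using assms(4)[OF s(1)] ps by (simp_all add: norm_minus_commute)
    then show ?thesis using ps assms(2) by (simp add: G_def norm_divide frac_le)
  qed
  then have "norm (F p) / \<rho> * \<theta> ^ k \<le> norm (G p) * \<theta> ^ k"
    using assms(3) by (intro mult_right_mono) auto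
  ultimately have "norm (F p) / \<rho> * \<theta> ^ k \<le> M / (\<theta> * \<rho>)"
    unfolding k by linarith
  then have "norm (F p) * \<theta> ^ Suc k \<le> M"
    using assms(2,3) by (simp add: field_simps)
  then show ?case using Suc(2) by simp
qed

text \<open>\<open>zero_mult\<close> iterates the total operator \<open>deriv\<close>, which carries
  information only where derivatives exist. A holomorphic extension to a neighbourhood of the real
  line provides them in every order.\<close>

lemma higher_deriv_of_real_part:
  assumes H: "H holomorphic_on U" "open U" "\<And>x. of_real x \<in> U"
    and f: "\<And>x. f x = Re (H (of_real x))"
  shows "(deriv ^^ n) f = (\<lambda>x. Re ((deriv ^^ n) H (of_real x)))"
    and "((deriv ^^ n) f has_real_derivative (deriv ^^ Suc n) f x) (at x)"
proof -
  have step: "((\<lambda>x. Re ((deriv ^^ n) H (of_real x))) has_real_derivative Re ((deriv ^^ Suc n) H (of_real x))) (at x)" for n x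
    using has_real_derivative_of_holomorphic[OF holomorphic_derivI[OF holomorphic_higher_deriv[OF H(1,2), of n] H(2) H(3)[of x]]]
    by simp
  have eq: "(deriv ^^ n) f = (\<lambda>x. Re ((deriv ^^ n) H (of_real x)))" for n
  proof (induction n)
    case 0
    show ?case by (rule ext) (simp add: f)
  next
    case (Suc n)
    show ?case
      using DERIV_imp_deriv[OF step[of n]] by (auto simp: Suc)
  qed
  show "(deriv ^^ n) f = (\<lambda>x. Re ((deriv ^^ n) H (of_real x)))" by (rule eq)
  show "((deriv ^^ n) f has_real_derivative (deriv ^^ Suc n) f x) (at x)"
    unfolding eq by (rule step)
qed

text \<open>Translates multiplicity from vanishing derivatives into the decay rate used by
  \<open>holomorphic_zeros_bound\<close>, by Taylor's formula with a bounded remainder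
  coefficient.\<close>

lemma vanishing_order_bound:
  fixes u :: "real \<Rightarrow> real"
  assumes smooth: "\<And>k x. ((deriv ^^ k) u has_real_derivative (deriv ^^ Suc k) u x) (at x)"
    and zero: "\<And>j. j < n \<Longrightarrow> (deriv ^^ j) u s = 0"
  shows "\<exists>K. \<forall>\<^sub>F x in at s. \<bar>u x\<bar> \<le> K * \<bar>x - s\<bar> ^ n"
proof -
  have cont: "isCont ((deriv ^^ n) u) s" using smooth DERIV_isCont by blast
  define K where "K = \<bar>(deriv ^^ n) u s\<bar> + 1"
  have "\<forall>\<^sub>F x in at s. \<bar>(deriv ^^ n) u x\<bar> < K"
    using cont unfolding isCont_def K_def by (intro order_tendstoD(2)[OF tendsto_rabs]) auto
  then obtain \<delta> where \<delta>: "0 < \<delta>" "\<And>x. x \<noteq> s \<Longrightarrow> \<bar>x - s\<bar> < \<delta> \<Longrightarrow> \<bar>(deriv ^^ n) u x\<bar> < K"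
    unfolding eventually_at by (auto simp: dist_real_def)
  have "\<bar>u x\<bar> \<le> K * \<bar>x - s\<bar> ^ n" if x: "x \<noteq> s" "\<bar>x - s\<bar> < \<delta>" for x
  proof (cases "n = 0")
    case True
    then show ?thesis using \<delta>(2)[OF x] by simp
  next
    case False
    have "\<exists>t. (if x < s then x < t \<and> t < s else s < t \<and> t < x) \<and>
      u x = (\<Sum>m<n. ((deriv ^^ m) u s / fact m) * (x - s) ^ m) + ((deriv ^^ n) u t / fact n) * (x - s) ^ n"
      by (rule Taylor[where a = "min x s" and b = "max x s" and diff = "\<lambda>m. (deriv ^^ m) u"])
        (use False smooth x in auto)
    then obtain t where t: "if x < s then x < t \<and> t < s else s < t \<and> t < x"
      "u x = ((deriv ^^ n) u t / fact n) * (x - s) ^ n"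
      using zero by auto
    have "t \<noteq> s" "\<bar>t - s\<bar> < \<delta>" using t(1) x by (auto split: if_splits)
    then have "\<bar>(deriv ^^ n) u t\<bar> < K" by (rule \<delta>(2))
    then have "\<bar>(deriv ^^ n) u t\<bar> / fact n \<le> K / 1"
      by (intro frac_le) (auto simp: fact_ge_1)
    then have "\<bar>(deriv ^^ n) u t\<bar> / fact n * \<bar>x - s\<bar> ^ n \<le> K * \<bar>x - s\<bar> ^ n"
      by (intro mult_right_mono) auto
    then show ?thesis by (simp add: t(2) abs_mult power_abs)
  qed
  then show ?thesis
    using \<delta>(1) unfolding eventually_at dist_real_def by blast
qed

lemma sum_enat: "(\<Sum>x\<in>A. enat (f x)) = enat (\<Sum>x\<in>A. f x)"
  by (induction A rule: infinite_finite_induct) (auto simp: zero_enat_def)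

text \<open>A zero of order m of \<open>q\<close> is a zero of order m - 1 of its derivative, and
  Rolle's theorem supplies one more critical point between consecutive zeros, so the derivative has
  at least the total multiplicity minus one. The ratio e + 1 of the radii makes each of these zeros
  cost exactly one unit of the logarithm.\<close>

lemma num_zeros_bound:
  fixes q h :: "real \<Rightarrow> real" and F :: "complex \<Rightarrow> complex" and p :: real
  assumes smooth: "\<And>k x. ((deriv ^^ k) q has_real_derivative (deriv ^^ Suc k) q x) (at x)"
    and F: "F holomorphic_on UNIV" "\<And>x. F (of_real x) = of_real (deriv q x * h x)"
    and h: "\<And>x. isCont h x"
    and p: "F (of_real p) \<noteq> 0"
    and loc: "\<And>x. x \<in> {a..b} \<Longrightarrow> deriv q x = 0 \<Longrightarrow> \<bar>x - p\<bar> \<le> \<rho>"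
    and \<rho>: "0 < \<rho>"
    and M: "\<And>z. norm (z - of_real p) = (exp 1 + 1) * \<rho> \<Longrightarrow> norm (F z) \<le> M"
  shows "\<exists>n. num_zeros {a..b} q = enat n \<and> real n \<le> 1 + ln (M / norm (F (of_real p)))"
proof -
  define B where "B = ln (M / norm (F (of_real p)))"
  have smooth': "((deriv ^^ k) (deriv q) has_real_derivative (deriv ^^ Suc k) (deriv q) x) (at x)" for k x
    using smooth[of "Suc k" x] by (simp add: funpow_swap1)
  have q': "(q has_real_derivative deriv q x) (at x)" for x
    using smooth[of 0 x] by simp
  have order: "\<exists>K. \<forall>\<^sub>F x in at s. norm (F (of_real x)) \<le> K * \<bar>x - s\<bar> ^ n"
    if z: "\<And>j. j < n \<Longrightarrow> (deriv ^^ Suc j) q s = 0" for s n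
  proof -
    obtain K where K: "\<forall>\<^sub>F x in at s. \<bar>deriv q x\<bar> \<le> K * \<bar>x - s\<bar> ^ n"
      using vanishing_order_bound[OF smooth', of n s] z by (auto simp: funpow_swap1)
    have "\<forall>\<^sub>F x in at s. \<bar>h x\<bar> < \<bar>h s\<bar> + 1"
      using h[of s] unfolding isCont_def by (intro order_tendstoD(2)[OF tendsto_rabs]) auto
    with K have "\<forall>\<^sub>F x in at s. norm (F (of_real x)) \<le> (K * (\<bar>h s\<bar> + 1)) * \<bar>x - s\<bar> ^ n"
    proof eventually_elim
      case (elim x)
      have "norm (F (of_real x)) = \<bar>deriv q x\<bar> * \<bar>h x\<bar>"
        unfolding F norm_of_real by (rule abs_mult)
      also have "\<dots> \<le> (K * \<bar>x - s\<bar> ^ n) * (\<bar>h s\<bar> + 1)"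
        using elim by (intro mult_mono order_trans[OF abs_ge_zero elim(1)]) auto
      finally show ?case by (simp add: mult_ac)
    qed
    then show ?thesis by blast
  qed
  \<comment> \<open>\<open>m s\<close> is only a lower bound for the multiplicity and
    \<open>S\<close> only a finite set of zeros; this freedom lets the same estimate exclude
    infinitely many zeros and zeros of infinite order.\<close>
  have key: "real (\<Sum>s\<in>S. m s) \<le> 1 + B"
    if S: "finite S" "S \<noteq> {}" "S \<subseteq> {x \<in> {a..b}. q x = 0}"
      and m: "\<And>s. s \<in> S \<Longrightarrow> m s \<noteq> 0" "\<And>s j. s \<in> S \<Longrightarrow> j < m s \<Longrightarrow> (deriv ^^ j) q s = 0" for S and m :: "real \<Rightarrow> nat"
  proof -
    obtain W where W: "finite W" "Suc (card W) = card S" "W \<inter> S = {}"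
      "\<forall>x\<in>W. deriv q x = 0 \<and> Min S < x \<and> x < Max S"
      using rolle_zeros_between[OF q' S(1,2)] S(3) by blast
    define n where "n s = (if s \<in> W then 1 else m s - 1)" for s
    have n: "sum n (W \<union> S) = sum m S - 1"
    proof -
      have "sum n (W \<union> S) = sum n W + sum n S" using W S by (simp add: sum.union_disjoint)
      moreover have "sum n W = card W" by (simp add: n_def)
      moreover have "sum n S = (\<Sum>s\<in>S. m s - 1)" using W by (intro sum.cong) (auto simp: n_def)
      moreover have "(\<Sum>s\<in>S. m s - 1) + card S = sum m S"
      proof -
        have "(\<Sum>s\<in>S. m s - 1) + card S = (\<Sum>s\<in>S. m s - 1 + 1)" unfolding sum.distrib by simp
        also have "\<dots> = sum m S" using m(1) by (intro sum.cong) auto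
        finally show ?thesis .
      qed
      ultimately show ?thesis using W(2) by simp
    qed
    \<comment> \<open>Points with \<open>n s = 0\<close> are simple zeros of \<open>q\<close>. They
      need not be critical and may lie outside the disc, since \<open>loc\<close> speaks of critical
      points only.\<close>
    define T where "T = {s \<in> W \<union> S. n s \<noteq> 0}"
    have nT: "sum n T = sum m S - 1"
      unfolding n[symmetric] T_def using W S by (intro sum.mono_neutral_left) auto
    have "norm (F (of_real p)) * exp 1 ^ sum n T \<le> M"
    proof (rule holomorphic_zeros_bound[OF _ \<rho> _ _ F(1) p M])
      show "finite T" using W S by (simp add: T_def)
      fix s assume s: "s \<in> T"
      have z: "(deriv ^^ Suc j) q s = 0" if "j < n s" for j
      proof (cases "s \<in> W")
        case True
        then show ?thesis using that W by (auto simp: n_def)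
      next
        case False
        then have "s \<in> S" "Suc j < m s" using that s by (auto simp: n_def T_def)
        then show ?thesis by (rule m(2))
      qed
      show "\<exists>K. \<forall>\<^sub>F x in at s. norm (F (of_real x)) \<le> K * \<bar>x - s\<bar> ^ n s"
        by (rule order[OF z])
      have "deriv q s = 0" using z[of 0] s by (auto simp: T_def)
      moreover have "s \<in> {a..b}"
      proof (cases "s \<in> W")
        case True
        have "Min S \<in> {a..b}" "Max S \<in> {a..b}" using S Min_in Max_in by blast+
        then show ?thesis using W(4) True by fastforce
      next
        case False
        then show ?thesis using s S by (auto simp: T_def)
      qed
      ultimately have "\<bar>s - p\<bar> \<le> \<rho>" using loc by blast
      then show "norm (of_real s - complex_of_real p) \<le> \<rho>" by (simp flip: of_real_diff)
    qed auto
    then have "exp (real (sum n T)) \<le> M / norm (F (of_real p))"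
      using p by (simp add: field_simps exp_of_nat_mult[of "sum n T" 1, simplified])
    then have "real (sum n T) \<le> B"
      unfolding B_def by (rule ln_ge_iff[THEN iffD2, rotated]) (meson exp_gt_zero less_le_trans \<open>exp (real (sum n T)) \<le> M / norm (F (of_real p))\<close>)
    then show ?thesis using nT by linarith
  qed
  define Z where "Z = {x \<in> {a..b}. q x = 0}"
  have finZ: "finite Z"
  proof (rule ccontr)
    assume "infinite Z"
    then obtain S where S: "S \<subseteq> Z" "finite S" "card S = nat \<lceil>\<bar>B\<bar>\<rceil> + 2"
      using infinite_arbitrarily_large by blast
    then have "real (\<Sum>s\<in>S. 1) \<le> 1 + B"
      by (intro key) (auto simp: Z_def)
    then show False using S(3) by simp linarith
  qed
  \<comment> \<open>If all derivatives vanished at \<open>s\<close>, every value of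
    \<open>m s\<close> would be admissible, and one exceeding the bound is a contradiction.\<close>
  have fin_mult: "\<exists>n. (deriv ^^ n) q s \<noteq> 0" if s: "s \<in> Z" for s
  proof (rule ccontr)
    assume "\<not> ?thesis"
    then have "real (\<Sum>s\<in>{s}. nat \<lceil>\<bar>B\<bar>\<rceil> + 2) \<le> 1 + B"
      using s by (intro key) (auto simp: Z_def)
    then show False by simp linarith
  qed
  define m where "m s = (LEAST n. (deriv ^^ n) q s \<noteq> 0)" for s
  have "num_zeros {a..b} q = (\<Sum>s\<in>Z. enat (m s))"
    using finZ fin_mult unfolding num_zeros_def zero_mult_def Z_def m_def by (auto intro!: sum.cong)
  then have nz: "num_zeros {a..b} q = enat (sum m Z)" by (simp add: sum_enat)
  \<comment> \<open>Covers the case of no zeros, which \<open>key\<close> excludes: with an empty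
    set of zeros the disc lemma reduces to the maximum principle.\<close>
  have "0 \<le> B"
  proof -
    have "norm (F (of_real p)) * exp 1 ^ (\<Sum>s\<in>({} :: real set). 0) \<le> M"
      by (rule holomorphic_zeros_bound[OF _ \<rho> _ _ F(1) p M]) auto
    then have "1 \<le> M / norm (F (of_real p))" using p by simp
    then show ?thesis by (simp add: B_def)
  qed
  have "real (sum m Z) \<le> 1 + B"
  proof (cases "Z = {}")
    case False
    show ?thesis
    proof (rule key[OF finZ False])
      fix s assume s: "s \<in> Z"
      show "(deriv ^^ j) q s = 0" if "j < m s" for j
        using not_less_Least that unfolding m_def by blast
      have "(deriv ^^ m s) q s \<noteq> 0" unfolding m_def using fin_mult[OF s] by (rule LeastI_ex)
      then show "m s \<noteq> 0" using s by (cases "m s") (auto simp: Z_def)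
    qed (simp add: Z_def)
  qed (use \<open>0 \<le> B\<close> in auto)
  with nz show ?thesis unfolding B_def by blast
qed

lemma card_zeros_le_num_zeros:
  assumes "num_zeros I q = enat n"
  shows "finite {x \<in> I. q x = 0}" "card {x \<in> I. q x = 0} \<le> n"
proof -
  show fin: "finite {x \<in> I. q x = 0}"
    using assms by (auto simp: num_zeros_def split: if_splits)
  have "1 \<le> zero_mult q x" if "q x = 0" for x
  proof (cases "\<exists>n. (deriv ^^ n) q x \<noteq> 0")
    case True
    then have "(deriv ^^ (LEAST n. (deriv ^^ n) q x \<noteq> 0)) q x \<noteq> 0" by (rule LeastI_ex)
    then have "(LEAST n. (deriv ^^ n) q x \<noteq> 0) \<noteq> 0" using that by (metis funpow_0)
    then show ?thesis using True by (simp add: zero_mult_def one_enat_def)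
  qed (auto simp: zero_mult_def)
  then have "(\<Sum>x\<in>{x \<in> I. q x = 0}. enat 1) \<le> (\<Sum>x\<in>{x \<in> I. q x = 0}. zero_mult q x)"
    by (intro sum_mono) (auto simp: one_enat_def)
  then have "enat (card {x \<in> I. q x = 0}) \<le> enat n"
    using assms fin unfolding sum_enat by (simp add: num_zeros_def)
  then show "card {x \<in> I. q x = 0} \<le> n" by simp
qed

section \<open>Gaussian averages\<close>

lemma normal_density_commute: "normal_density x \<sigma> y = normal_density y \<sigma> x"
  by (simp add: normal_density_def power2_commute)

lemma normal_density_shift: "normal_density x \<sigma> (x + z) = normal_density 0 \<sigma> z"
  by (simp add: normal_density_def)

text \<open>Expanding the square turns a Gaussian average over y into a Laplace transform at x /
  \<sigma>^2. The next lemma exchanges the roles, for averages over the input.\<close>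

lemma normal_density_eq_exp_linear:
  assumes "0 < \<sigma>"
  shows "normal_density x \<sigma> y
    = exp (- x\<^sup>2 / (2 * \<sigma>\<^sup>2)) / sqrt (2 * pi * \<sigma>\<^sup>2) * (exp (- y\<^sup>2 / (2 * \<sigma>\<^sup>2)) * exp (x / \<sigma>\<^sup>2 * y))"
proof -
  have "- (y - x)\<^sup>2 / (2 * \<sigma>\<^sup>2) = - x\<^sup>2 / (2 * \<sigma>\<^sup>2) + (- y\<^sup>2 / (2 * \<sigma>\<^sup>2) + x / \<sigma>\<^sup>2 * y)"
    using assms by (simp add: field_simps power2_eq_square)
  then show ?thesis
    unfolding normal_density_def by (simp only: exp_add) simp
qed

lemma normal_density_eq_tilt:
  assumes "0 < \<sigma>"
  shows "normal_density x \<sigma> y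
    = exp (- y\<^sup>2 / (2 * \<sigma>\<^sup>2)) / sqrt (2 * pi * \<sigma>\<^sup>2) * (exp (- x\<^sup>2 / (2 * \<sigma>\<^sup>2)) * exp (y / \<sigma>\<^sup>2 * x))"
  by (subst normal_density_commute) (rule normal_density_eq_exp_linear[OF assms])

section \<open>Second moments and functions of quadratic growth\<close>

lemma
  assumes \<sigma>: "0 < \<sigma>"
  shows integrable_normal_square: "integrable lborel (\<lambda>y. normal_density \<mu> \<sigma> y * y\<^sup>2)"
    and integral_normal_square: "(\<integral>y. normal_density \<mu> \<sigma> y * y\<^sup>2 \<partial>lborel) = \<sigma>\<^sup>2 + \<mu>\<^sup>2"
proof -
  have eq: "normal_density \<mu> \<sigma> y * y\<^sup>2 = normal_density \<mu> \<sigma> y * (y - \<mu>) ^ (2 * 1)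
      + (2 * \<mu>) * (normal_density \<mu> \<sigma> y * y) - \<mu>\<^sup>2 * normal_density \<mu> \<sigma> y" for y
    by (simp add: power2_eq_square algebra_simps)
  note i = integrable_normal_moment[OF \<sigma>, of \<mu> "2 * 1"] integrable_normal_moment_nz_1[OF \<sigma>, of \<mu>]
    integrable_normal_density[OF \<sigma>, of \<mu>]
  show "integrable lborel (\<lambda>y. normal_density \<mu> \<sigma> y * y\<^sup>2)"
    unfolding eq using i by (intro Bochner_Integration.integrable_diff Bochner_Integration.integrable_add integrable_mult_right)
  have "(\<integral>y. normal_density \<mu> \<sigma> y * y\<^sup>2 \<partial>lborel)
      = (\<integral>y. normal_density \<mu> \<sigma> y * (y - \<mu>) ^ (2 * 1) \<partial>lborel)
      + (2 * \<mu>) * (\<integral>y. normal_density \<mu> \<sigma> y * y \<partial>lborel) - \<mu>\<^sup>2 * (\<integral>y. normal_density \<mu> \<sigma> y \<partial>lborel)"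
    unfolding eq using i by (subst Bochner_Integration.integral_diff Bochner_Integration.integral_add; simp)+
  also have "\<dots> = \<sigma>\<^sup>2 + \<mu>\<^sup>2"
    using integral_normal_moment_even[OF \<sigma>, of \<mu> 1] \<sigma>
    by (simp add: integral_normal_moment_nz_1 power2_eq_square)
  finally show "(\<integral>y. normal_density \<mu> \<sigma> y * y\<^sup>2 \<partial>lborel) = \<sigma>\<^sup>2 + \<mu>\<^sup>2" .
qed

text \<open>One class settles the integrability questions: it contains the logarithms of output
  densities and g, is closed under linear combinations and shifts, and has finite Gaussian averages
  that are again controlled quadratically in the mean.\<close>

definition quad_growth :: "(real \<Rightarrow> real) \<Rightarrow> bool" where
  "quad_growth h \<longleftrightarrow> h \<in> borel_measurable borel \<and> (\<exists>a b. \<forall>y. \<bar>h y\<bar> \<le> a + b * y\<^sup>2)"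

lemma quad_growthI: "h \<in> borel_measurable borel \<Longrightarrow> (\<And>y. \<bar>h y\<bar> \<le> a + b * y\<^sup>2) \<Longrightarrow> quad_growth h"
  unfolding quad_growth_def by blast

lemma quad_growth_measurable [measurable_dest]: "quad_growth h \<Longrightarrow> h \<in> borel_measurable borel"
  unfolding quad_growth_def by blast

lemma quad_growth_bound:
  assumes "quad_growth h"
  shows "\<exists>a\<ge>0. \<exists>b\<ge>0. \<forall>y. \<bar>h y\<bar> \<le> a + b * y\<^sup>2"
proof -
  obtain a b where ab: "\<And>y. \<bar>h y\<bar> \<le> a + b * y\<^sup>2" using assms unfolding quad_growth_def by blast
  have "\<bar>h y\<bar> \<le> \<bar>a\<bar> + \<bar>b\<bar> * y\<^sup>2" for y
    by (rule order_trans[OF ab[of y]]) (intro add_mono mult_right_mono; simp)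
  then show ?thesis by (intro exI[of _ "\<bar>a\<bar>"] conjI exI[of _ "\<bar>b\<bar>"] allI) auto
qed

lemma quad_growth_const [simp]: "quad_growth (\<lambda>_. c)"
  by (rule quad_growthI[of _ "\<bar>c\<bar>" 0]) auto

lemma quad_growth_square [simp]: "quad_growth (\<lambda>y. y\<^sup>2)"
  by (rule quad_growthI[of _ 0 1]) auto

lemma quad_growth_add:
  assumes "quad_growth f" "quad_growth g"
  shows "quad_growth (\<lambda>y. f y + g y)"
proof -
  obtain a b c d where "\<And>y. \<bar>f y\<bar> \<le> a + b * y\<^sup>2" "\<And>y. \<bar>g y\<bar> \<le> c + d * y\<^sup>2"
    using assms unfolding quad_growth_def by blast
  then have "\<bar>f y + g y\<bar> \<le> (a + c) + (b + d) * y\<^sup>2" for y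
    using abs_triangle_ineq[of "f y" "g y"] by (smt (verit) distrib_right)
  then show ?thesis using assms by (intro quad_growthI) (auto dest: quad_growth_measurable)
qed

lemma quad_growth_cmult:
  assumes "quad_growth f"
  shows "quad_growth (\<lambda>y. c * f y)"
proof -
  obtain a b where "\<And>y. \<bar>f y\<bar> \<le> a + b * y\<^sup>2"
    using assms unfolding quad_growth_def by blast
  then have "\<bar>c * f y\<bar> \<le> \<bar>c\<bar> * a + (\<bar>c\<bar> * b) * y\<^sup>2" for y
    using mult_left_mono[of "\<bar>f y\<bar>" "a + b * y\<^sup>2" "\<bar>c\<bar>"] by (simp add: abs_mult algebra_simps)
  then show ?thesis using assms by (intro quad_growthI) (auto dest: quad_growth_measurable)
qed

lemma quad_growth_diff:
  assumes "quad_growth f" "quad_growth g"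
  shows "quad_growth (\<lambda>y. f y - g y)"
  using quad_growth_add[OF assms(1) quad_growth_cmult[OF assms(2), of "-1"]] by simp

lemma quad_growth_abs:
  assumes "quad_growth f" shows "quad_growth (\<lambda>y. \<bar>f y\<bar>)"
  using assms unfolding quad_growth_def by auto

lemma quad_growth_shift:
  assumes "quad_growth f" shows "quad_growth (\<lambda>z. f (c + z))"
proof -
  obtain a b where "0 \<le> a" and ab: "0 \<le> b" "\<And>y. \<bar>f y\<bar> \<le> a + b * y\<^sup>2"
    using quad_growth_bound[OF assms] by blast
  have "\<bar>f (c + z)\<bar> \<le> (a + 2 * b * c\<^sup>2) + 2 * b * z\<^sup>2" for z
  proof -
    have "0 \<le> (c - z)\<^sup>2" by simp
    then have "(c + z)\<^sup>2 \<le> 2 * c\<^sup>2 + 2 * z\<^sup>2" by (simp add: power2_eq_square algebra_simps)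
    from mult_left_mono[OF this ab(1)] ab(2)[of "c + z"] show ?thesis by (simp add: algebra_simps)
  qed
  then show ?thesis using assms by (intro quad_growthI) (auto dest: quad_growth_measurable)
qed

lemma quad_growth_reflect:
  assumes "quad_growth f" shows "quad_growth (\<lambda>z. f (- z))"
proof -
  obtain a b where ab: "0 \<le> a" "0 \<le> b" "\<And>y. \<bar>f y\<bar> \<le> a + b * y\<^sup>2" using quad_growth_bound[OF assms] by blast
  have "\<bar>f (- z)\<bar> \<le> a + b * z\<^sup>2" for z using ab(3)[of "- z"] by simp
  then show ?thesis
    using assms by (intro quad_growthI) (auto dest: quad_growth_measurable)
qed

lemma integrable_normal_quad_growth:
  assumes \<sigma>: "0 < \<sigma>" and h: "quad_growth h"
  shows "integrable lborel (\<lambda>y. normal_density \<mu> \<sigma> y * h y)"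
proof -
  obtain a b where "0 \<le> a" "0 \<le> b" and ab: "\<And>y. \<bar>h y\<bar> \<le> a + b * y\<^sup>2" using quad_growth_bound[OF h] by blast
  have "integrable lborel (\<lambda>y. a * normal_density \<mu> \<sigma> y + b * (normal_density \<mu> \<sigma> y * y\<^sup>2))"
    using \<sigma> by (intro Bochner_Integration.integrable_add integrable_mult_right integrable_normal_density integrable_normal_square)
  then show ?thesis
  proof (rule Bochner_Integration.integrable_bound)
    show "AE y in lborel. norm (normal_density \<mu> \<sigma> y * h y)
        \<le> norm (a * normal_density \<mu> \<sigma> y + b * (normal_density \<mu> \<sigma> y * y\<^sup>2))"
    proof (intro AE_I2)
      fix y
      have "norm (normal_density \<mu> \<sigma> y * h y) \<le> normal_density \<mu> \<sigma> y * (a + b * y\<^sup>2)"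
        by (simp add: abs_mult mult_left_mono ab)
      also have "\<dots> \<le> norm (a * normal_density \<mu> \<sigma> y + b * (normal_density \<mu> \<sigma> y * y\<^sup>2))"
        by (simp add: algebra_simps)
      finally show "norm (normal_density \<mu> \<sigma> y * h y)
        \<le> norm (a * normal_density \<mu> \<sigma> y + b * (normal_density \<mu> \<sigma> y * y\<^sup>2))" .
    qed
  qed (use h in measurable)
qed

lemma integral_normal_quad_le:
  assumes \<sigma>: "0 < \<sigma>" and h: "quad_growth h" and le: "\<And>y. h y \<le> a + b * y\<^sup>2"
  shows "(\<integral>y. normal_density \<mu> \<sigma> y * h y \<partial>lborel) \<le> a + b * (\<sigma>\<^sup>2 + \<mu>\<^sup>2)"
proof -
  have "(\<integral>y. normal_density \<mu> \<sigma> y * h y \<partial>lborel)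
      \<le> (\<integral>y. a * normal_density \<mu> \<sigma> y + b * (normal_density \<mu> \<sigma> y * y\<^sup>2) \<partial>lborel)"
  proof (rule integral_mono)
    show "integrable lborel (\<lambda>y. a * normal_density \<mu> \<sigma> y + b * (normal_density \<mu> \<sigma> y * y\<^sup>2))"
      using \<sigma> by (intro Bochner_Integration.integrable_add integrable_mult_right integrable_normal_density integrable_normal_square)
    fix y
    have "normal_density \<mu> \<sigma> y * h y \<le> normal_density \<mu> \<sigma> y * (a + b * y\<^sup>2)"
      by (intro mult_left_mono le) simp
    then show "normal_density \<mu> \<sigma> y * h y \<le> a * normal_density \<mu> \<sigma> y + b * (normal_density \<mu> \<sigma> y * y\<^sup>2)"
      by (simp add: algebra_simps)
  qed (rule integrable_normal_quad_growth[OF \<sigma> h])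
  also have "\<dots> = a + b * (\<sigma>\<^sup>2 + \<mu>\<^sup>2)"
    using \<sigma> by (simp add: integrable_normal_square integral_normal_square)
  finally show ?thesis .
qed

lemma integral_normal_quad_abs_le:
  assumes \<sigma>: "0 < \<sigma>" and h: "quad_growth h" and le: "\<And>y. \<bar>h y\<bar> \<le> a + b * y\<^sup>2"
  shows "\<bar>\<integral>y. normal_density \<mu> \<sigma> y * h y \<partial>lborel\<bar> \<le> a + b * (\<sigma>\<^sup>2 + \<mu>\<^sup>2)"
proof -
  have "(\<integral>y. normal_density \<mu> \<sigma> y * h y \<partial>lborel) \<le> a + b * (\<sigma>\<^sup>2 + \<mu>\<^sup>2)"
    using le abs_le_D1 by (intro integral_normal_quad_le \<sigma> h) blast
  moreover have "(\<integral>y. normal_density \<mu> \<sigma> y * (-1 * h y) \<partial>lborel) \<le> a + b * (\<sigma>\<^sup>2 + \<mu>\<^sup>2)"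
    using le abs_le_D2 by (intro integral_normal_quad_le \<sigma> quad_growth_cmult h) force
  ultimately show ?thesis by simp
qed

section \<open>Symmetries of Gaussian averages and their entire extensions\<close>

lemma integral_normal_translate:
  "(\<integral>z. normal_density 0 \<sigma> z * h (y + z) \<partial>lborel) = (\<integral>t. normal_density y \<sigma> t * h t \<partial>lborel)"
  for h :: "real \<Rightarrow> real"
  using lborel_integral_real_affine[of 1 "\<lambda>t. normal_density y \<sigma> t * h t" y]
  by (simp add: normal_density_shift)

lemma integral_normal_reflect:
  "(\<integral>z. normal_density 0 \<sigma> z * h (y - z) \<partial>lborel) = (\<integral>z. normal_density 0 \<sigma> z * h (y + z) \<partial>lborel)"
  for h :: "real \<Rightarrow> real"
  using lborel_integral_real_affine[of "-1" "\<lambda>z. normal_density 0 \<sigma> z * h (y - z)" 0]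
  by (simp add: normal_density_def)

lemma integral_lborel_reflect: "(\<integral>y. h (- y) \<partial>lborel) = (\<integral>y. h y \<partial>lborel)"
  for h :: "real \<Rightarrow> real"
  using lborel_integral_real_affine[of "-1" h 0] by simp

text \<open>Tilting a centred Gaussian by \<open>exp (s * y)\<close> gives, up to a constant, the
  Gaussian with mean \<open>s * \<sigma>\<^sup>2\<close>.\<close>

lemma exp_integrable_gauss:
  assumes \<sigma>: "0 < \<sigma>" and h: "quad_growth h"
  shows "exp_integrable lborel (\<lambda>y. exp (- y\<^sup>2 / (2 * \<sigma>\<^sup>2)) * h y)"
  unfolding exp_integrable_def
proof
  fix s
  define c where "c = exp (- (s * \<sigma>\<^sup>2)\<^sup>2 / (2 * \<sigma>\<^sup>2)) / sqrt (2 * pi * \<sigma>\<^sup>2)"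
  have c: "c \<noteq> 0" using \<sigma> by (simp add: c_def)
  have "exp (- y\<^sup>2 / (2 * \<sigma>\<^sup>2)) * h y * exp (s * y) = 1 / c * (normal_density (s * \<sigma>\<^sup>2) \<sigma> y * h y)" for y
    unfolding normal_density_eq_exp_linear[OF \<sigma>] c_def[symmetric] using c \<sigma> by simp
  then show "integrable lborel (\<lambda>y. exp (- y\<^sup>2 / (2 * \<sigma>\<^sup>2)) * h y * exp (s * y))"
    using integrable_mult_right[OF integrable_normal_quad_growth[OF \<sigma> h, of "s * \<sigma>\<^sup>2"], of "1 / c"] by simp
qed

text \<open>The Gaussian average of \<open>h\<close> as an entire function of the mean. The complex
  variable enters through the kernel alone, so \<open>h\<close> may be a logarithm that does not
  extend to the plane.\<close>

definition gauss_transform :: "real \<Rightarrow> (real \<Rightarrow> real) \<Rightarrow> complex \<Rightarrow> complex" where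
  "gauss_transform \<sigma> h \<zeta> = exp (- \<zeta>\<^sup>2 / of_real (2 * \<sigma>\<^sup>2)) / of_real (sqrt (2 * pi * \<sigma>\<^sup>2)) *
     laplace lborel (\<lambda>y. exp (- y\<^sup>2 / (2 * \<sigma>\<^sup>2)) * h y) (\<zeta> / of_real (\<sigma>\<^sup>2))"

lemma gauss_transform_of_real:
  assumes "0 < \<sigma>"
  shows "gauss_transform \<sigma> h (of_real x) = of_real (\<integral>y. normal_density x \<sigma> y * h y \<partial>lborel)"
proof -
  have "(\<integral>y. normal_density x \<sigma> y * h y \<partial>lborel)
     = exp (- x\<^sup>2 / (2 * \<sigma>\<^sup>2)) / sqrt (2 * pi * \<sigma>\<^sup>2) * (\<integral>y. exp (- y\<^sup>2 / (2 * \<sigma>\<^sup>2)) * h y * exp (x / \<sigma>\<^sup>2 * y) \<partial>lborel)"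
    unfolding normal_density_eq_exp_linear[OF assms] by (subst integral_mult_right_zero[symmetric]) (simp add: mult_ac)
  moreover have "laplace lborel (\<lambda>y. exp (- y\<^sup>2 / (2 * \<sigma>\<^sup>2)) * h y) (of_real x / of_real (\<sigma>\<^sup>2))
      = of_real (\<integral>y. exp (- y\<^sup>2 / (2 * \<sigma>\<^sup>2)) * h y * exp (x / \<sigma>\<^sup>2 * y) \<partial>lborel)"
    by (simp only: laplace_of_real flip: of_real_divide)
  moreover have "exp (- (of_real x)\<^sup>2 / of_real (2 * \<sigma>\<^sup>2)) = complex_of_real (exp (- x\<^sup>2 / (2 * \<sigma>\<^sup>2)))"
    by (simp flip: exp_of_real)
  ultimately show ?thesis
    unfolding gauss_transform_def by (simp only: of_real_mult of_real_divide)
qed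

lemma gauss_transform_holomorphic:
  assumes "0 < \<sigma>" "quad_growth h"
  shows "gauss_transform \<sigma> h holomorphic_on A"
  unfolding gauss_transform_def[abs_def]
  by (intro holomorphic_intros holomorphic_on_compose_gen[OF _ laplace_holomorphic[of _ _ UNIV], unfolded o_def] exp_integrable_gauss assms)
    (use assms in auto)

text \<open>At a complex mean the modulus of the kernel is the kernel at the real part, times an
  exponential of the squared imaginary part. This is the source of the factor in v.\<close>

lemma gauss_transform_bound:
  assumes \<sigma>: "0 < \<sigma>" and h: "quad_growth h"
  shows "norm (gauss_transform \<sigma> h \<zeta>)
    \<le> exp ((Im \<zeta>)\<^sup>2 / (2 * \<sigma>\<^sup>2)) * (\<integral>y. normal_density (Re \<zeta>) \<sigma> y * \<bar>h y\<bar> \<partial>lborel)"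
proof -
  define w where "w y = exp (- y\<^sup>2 / (2 * \<sigma>\<^sup>2)) * h y" for y
  define I where "I = (\<integral>y. exp (- y\<^sup>2 / (2 * \<sigma>\<^sup>2)) * \<bar>h y\<bar> * exp (Re \<zeta> / \<sigma>\<^sup>2 * y) \<partial>lborel)"
  have "norm (laplace lborel w (\<zeta> / of_real (\<sigma>\<^sup>2))) \<le> (\<integral>y. \<bar>w y\<bar> * exp (Re (\<zeta> / of_real (\<sigma>\<^sup>2)) * y) \<partial>lborel)"
    unfolding w_def by (intro norm_laplace_le exp_integrable_gauss \<sigma> h) simp
  also have "\<dots> = I"
    unfolding w_def I_def Re_divide_of_real by (simp add: abs_mult)
  finally have L: "norm (laplace lborel w (\<zeta> / of_real (\<sigma>\<^sup>2))) \<le> I" .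
  have "(\<integral>y. normal_density (Re \<zeta>) \<sigma> y * \<bar>h y\<bar> \<partial>lborel)
     = exp (- (Re \<zeta>)\<^sup>2 / (2 * \<sigma>\<^sup>2)) / sqrt (2 * pi * \<sigma>\<^sup>2) * I"
    unfolding normal_density_eq_exp_linear[OF \<sigma>] I_def
    by (subst integral_mult_right_zero[symmetric]) (simp add: mult_ac)
  then have I: "exp ((Im \<zeta>)\<^sup>2 / (2 * \<sigma>\<^sup>2)) * (\<integral>y. normal_density (Re \<zeta>) \<sigma> y * \<bar>h y\<bar> \<partial>lborel)
     = exp ((Im \<zeta>)\<^sup>2 / (2 * \<sigma>\<^sup>2)) * exp (- (Re \<zeta>)\<^sup>2 / (2 * \<sigma>\<^sup>2)) / sqrt (2 * pi * \<sigma>\<^sup>2) * I" by simp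
  have "Re (- \<zeta>\<^sup>2 / of_real (2 * \<sigma>\<^sup>2)) = (Im \<zeta>)\<^sup>2 / (2 * \<sigma>\<^sup>2) + - (Re \<zeta>)\<^sup>2 / (2 * \<sigma>\<^sup>2)"
    unfolding Re_divide_of_real by (simp add: power2_eq_square diff_divide_distrib)
  then have "norm (exp (- \<zeta>\<^sup>2 / of_real (2 * \<sigma>\<^sup>2)) / of_real (sqrt (2 * pi * \<sigma>\<^sup>2)))
      = exp ((Im \<zeta>)\<^sup>2 / (2 * \<sigma>\<^sup>2)) * exp (- (Re \<zeta>)\<^sup>2 / (2 * \<sigma>\<^sup>2)) / sqrt (2 * pi * \<sigma>\<^sup>2)"
    unfolding norm_divide norm_exp_eq_Re norm_of_real exp_add[symmetric] by simp
  moreover have "0 \<le> exp ((Im \<zeta>)\<^sup>2 / (2 * \<sigma>\<^sup>2)) * exp (- (Re \<zeta>)\<^sup>2 / (2 * \<sigma>\<^sup>2)) / sqrt (2 * pi * \<sigma>\<^sup>2)" by simp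
  ultimately show ?thesis
    unfolding gauss_transform_def I norm_mult using L[unfolded w_def[abs_def]] by (simp only: mult_left_mono)
qed

section \<open>Outputs of amplitude-constrained inputs\<close>

locale bounded_input =
  fixes R :: real and P :: "real measure"
  assumes admissible: "admissible_input R P"
begin

sublocale prob_space P
  using admissible by (simp add: admissible_input_def)

lemma sets_P [measurable_cong]: "sets P = sets borel"
  using admissible by (simp add: admissible_input_def)

lemma space_P [simp]: "space P = UNIV"
  using sets_eq_imp_space_eq[OF sets_P] by simp

lemma AE_abs_le: "AE x in P. \<bar>x\<bar> \<le> R"
proof -
  have "prob {-R..R} = 1"
    using admissible by (simp add: admissible_input_def emeasure_eq_measure)
  then have "AE x in P. x \<in> {-R..R}"
    by (subst AE_in_set_eq_1) (auto simp: sets_P)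
  then show ?thesis by eventually_elim auto
qed

lemma R_nonneg: "0 \<le> R"
proof (rule ccontr)
  assume "\<not> 0 \<le> R"
  then have "{-R..R} = {}" by auto
  then show False using admissible by (simp add: admissible_input_def)
qed

lemma integrable_bounded:
  fixes f :: "real \<Rightarrow> real"
  assumes "f \<in> borel_measurable borel" "\<And>x. \<bar>x\<bar> \<le> R \<Longrightarrow> \<bar>f x\<bar> \<le> C"
  shows "integrable P f"
proof (rule integrable_const_bound[where B = C])
  show "AE x in P. norm (f x) \<le> C"
    using AE_abs_le by eventually_elim (use assms in auto)
qed (use assms in measurable)

lemma exp_integrable_bounded:
  assumes [measurable]: "f \<in> borel_measurable borel" and f: "\<And>x. \<bar>x\<bar> \<le> R \<Longrightarrow> \<bar>f x\<bar> \<le> C"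
  shows "exp_integrable P f"
  unfolding exp_integrable_def
proof
  fix s
  show "integrable P (\<lambda>x. f x * exp (s * x))"
  proof (rule integrable_bounded[where C = "C * exp (\<bar>s\<bar> * R)"])
    fix x assume x: "\<bar>x\<bar> \<le> R"
    have "s * x \<le> \<bar>s * x\<bar>" by simp
    also have "\<dots> \<le> \<bar>s\<bar> * R" using x by (simp add: abs_mult mult_left_mono)
    finally have "\<bar>f x\<bar> * exp (s * x) \<le> C * exp (\<bar>s\<bar> * R)"
      using f[OF x] by (intro mult_mono) auto
    then show "\<bar>f x * exp (s * x)\<bar> \<le> C * exp (\<bar>s\<bar> * R)" by (simp add: abs_mult)
  qed measurable
qed

text \<open>Up to explicit Gaussian factors, \<open>mg \<sigma>\<close> is the output density; unlike the latter its logarithm has slopes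
bounded by \<open>R / \<sigma>\<^sup>2\<close> and its entire extension \<open>cmg \<sigma>\<close> grows only in the real direction.\<close>

definition mg :: "real \<Rightarrow> real \<Rightarrow> real" where
  "mg \<sigma> t = (\<integral>x. exp (- x\<^sup>2 / (2 * \<sigma>\<^sup>2)) * exp (t / \<sigma>\<^sup>2 * x) \<partial>P)"

abbreviation lmg :: "real \<Rightarrow> real \<Rightarrow> real" where "lmg \<sigma> t \<equiv> ln (mg \<sigma> t)"

definition cmg :: "real \<Rightarrow> complex \<Rightarrow> complex" where
  "cmg \<sigma> \<zeta> = laplace P (\<lambda>x. exp (- x\<^sup>2 / (2 * \<sigma>\<^sup>2))) (\<zeta> / of_real (\<sigma>\<^sup>2))"

lemma exp_integrable_tilt: "exp_integrable P (\<lambda>x. exp (- x\<^sup>2 / (2 * \<sigma>\<^sup>2)))"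
  by (rule exp_integrable_bounded[where C = 1]) auto

lemma mg_integrable: "integrable P (\<lambda>x. exp (- x\<^sup>2 / (2 * \<sigma>\<^sup>2)) * exp (t / \<sigma>\<^sup>2 * x))"
  using exp_integrableD[OF exp_integrable_tilt] .

lemma cmg_of_real: "cmg \<sigma> (of_real t) = of_real (mg \<sigma> t)"
  unfolding cmg_def mg_def by (simp only: laplace_of_real flip: of_real_divide)

lemma cmg_holomorphic: "0 < \<sigma> \<Longrightarrow> cmg \<sigma> holomorphic_on A"
  unfolding cmg_def[abs_def]
  by (intro holomorphic_intros holomorphic_on_compose_gen[OF _ laplace_holomorphic[of _ _ UNIV], unfolded o_def]
      exp_integrable_tilt sets_P) auto

lemma norm_cmg_le:
  assumes "0 < \<sigma>"
  shows "norm (cmg \<sigma> \<zeta>) \<le> exp (\<bar>Re \<zeta>\<bar> * R / \<sigma>\<^sup>2)"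
proof -
  have "norm (cmg \<sigma> \<zeta>) \<le> (\<integral>x. \<bar>exp (- x\<^sup>2 / (2 * \<sigma>\<^sup>2))\<bar> * exp (Re (\<zeta> / of_real (\<sigma>\<^sup>2)) * x) \<partial>P)"
    unfolding cmg_def by (intro norm_laplace_le exp_integrable_tilt sets_P)
  also have "\<dots> = mg \<sigma> (Re \<zeta>)" unfolding mg_def Re_divide_of_real by simp
  also have "\<dots> \<le> exp (\<bar>Re \<zeta>\<bar> * R / \<sigma>\<^sup>2)"
    unfolding mg_def
  proof (rule integral_le_const[OF mg_integrable])
    show "AE x in P. exp (- x\<^sup>2 / (2 * \<sigma>\<^sup>2)) * exp (Re \<zeta> / \<sigma>\<^sup>2 * x) \<le> exp (\<bar>Re \<zeta>\<bar> * R / \<sigma>\<^sup>2)"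
      using AE_abs_le
    proof eventually_elim
      fix x assume "\<bar>x\<bar> \<le> R"
      then have "\<bar>Re \<zeta> * x\<bar> \<le> \<bar>Re \<zeta>\<bar> * R"
        unfolding abs_mult by (intro mult_left_mono) auto
      then have "Re \<zeta> * x \<le> \<bar>Re \<zeta>\<bar> * R" by linarith
      then have "Re \<zeta> / \<sigma>\<^sup>2 * x \<le> \<bar>Re \<zeta>\<bar> * R / \<sigma>\<^sup>2"
        using divide_right_mono[of "Re \<zeta> * x" "\<bar>Re \<zeta>\<bar> * R" "\<sigma>\<^sup>2"] by simp
      moreover have "- x\<^sup>2 / (2 * \<sigma>\<^sup>2) \<le> 0" by simp
      ultimately have "- x\<^sup>2 / (2 * \<sigma>\<^sup>2) + Re \<zeta> / \<sigma>\<^sup>2 * x \<le> \<bar>Re \<zeta>\<bar> * R / \<sigma>\<^sup>2"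
        by linarith
      then show "exp (- x\<^sup>2 / (2 * \<sigma>\<^sup>2)) * exp (Re \<zeta> / \<sigma>\<^sup>2 * x) \<le> exp (\<bar>Re \<zeta>\<bar> * R / \<sigma>\<^sup>2)"
        by (simp flip: exp_add)
    qed
  qed
  finally show ?thesis .
qed

lemma mg_pos: "0 < mg \<sigma> t"
proof -
  have "exp (- R\<^sup>2 / (2 * \<sigma>\<^sup>2)) * exp (- \<bar>t / \<sigma>\<^sup>2\<bar> * R) \<le> mg \<sigma> t"
    unfolding mg_def
  proof (rule integral_ge_const[OF mg_integrable])
    show "AE x in P. exp (- R\<^sup>2 / (2 * \<sigma>\<^sup>2)) * exp (- \<bar>t / \<sigma>\<^sup>2\<bar> * R) \<le> exp (- x\<^sup>2 / (2 * \<sigma>\<^sup>2)) * exp (t / \<sigma>\<^sup>2 * x)"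
      using AE_abs_le
    proof eventually_elim
      fix x assume x: "\<bar>x\<bar> \<le> R"
      have "\<bar>t / \<sigma>\<^sup>2 * x\<bar> \<le> \<bar>t / \<sigma>\<^sup>2\<bar> * R" unfolding abs_mult using x by (intro mult_left_mono) auto
      then have "- \<bar>t / \<sigma>\<^sup>2\<bar> * R \<le> t / \<sigma>\<^sup>2 * x" by linarith
      moreover have "x\<^sup>2 \<le> R\<^sup>2" using x by (simp add: abs_le_square_iff[symmetric])
      then have "- R\<^sup>2 / (2 * \<sigma>\<^sup>2) \<le> - x\<^sup>2 / (2 * \<sigma>\<^sup>2)" by (intro divide_right_mono) auto
      ultimately show "exp (- R\<^sup>2 / (2 * \<sigma>\<^sup>2)) * exp (- \<bar>t / \<sigma>\<^sup>2\<bar> * R) \<le> exp (- x\<^sup>2 / (2 * \<sigma>\<^sup>2)) * exp (t / \<sigma>\<^sup>2 * x)"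
        by (intro mult_mono) auto
    qed
  qed
  then show ?thesis by (meson exp_gt_zero mult_pos_pos less_le_trans)
qed

text \<open>On the support the two integrands differ by a factor of at most \<open>exp c\<close>. In
  other words, the slope of \<open>lmg\<close> is the conditional mean of the input given the
  output, divided by \<sigma>^2.\<close>

lemma lmg_increment:
  assumes \<sigma>: "0 < \<sigma>" and st: "s \<le> t"
  shows "\<bar>lmg \<sigma> t - lmg \<sigma> s\<bar> \<le> R / \<sigma>\<^sup>2 * (t - s)"
proof -
  define c where "c = R / \<sigma>\<^sup>2 * (t - s)"
  have c: "\<bar>t / \<sigma>\<^sup>2 * x - s / \<sigma>\<^sup>2 * x\<bar> \<le> c" if "\<bar>x\<bar> \<le> R" for x
  proof -
    have "\<bar>t / \<sigma>\<^sup>2 * x - s / \<sigma>\<^sup>2 * x\<bar> = \<bar>x\<bar> / \<sigma>\<^sup>2 * (t - s)"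
      using st by (simp add: abs_mult flip: left_diff_distrib diff_divide_distrib)
    also have "\<dots> \<le> c" unfolding c_def using that st by (intro mult_right_mono divide_right_mono) auto
    finally show ?thesis .
  qed
  have "mg \<sigma> t \<le> exp c * mg \<sigma> s"
    unfolding mg_def integral_mult_right_zero[symmetric]
  proof (rule integral_mono_AE[OF mg_integrable integrable_mult_right[OF mg_integrable]])
    show "AE x in P. exp (- x\<^sup>2 / (2 * \<sigma>\<^sup>2)) * exp (t / \<sigma>\<^sup>2 * x) \<le> exp c * (exp (- x\<^sup>2 / (2 * \<sigma>\<^sup>2)) * exp (s / \<sigma>\<^sup>2 * x))"
      using AE_abs_le
    proof eventually_elim
      case (elim x)
      show ?case using c[OF elim] unfolding exp_add[symmetric] by simp
    qed
  qed
  then have "lmg \<sigma> t \<le> ln (exp c * mg \<sigma> s)" using mg_pos[of \<sigma> t] mg_pos[of \<sigma> s] by (subst ln_le_cancel_iff) auto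
  moreover have "mg \<sigma> s \<le> exp c * mg \<sigma> t"
    unfolding mg_def integral_mult_right_zero[symmetric]
  proof (rule integral_mono_AE[OF mg_integrable integrable_mult_right[OF mg_integrable]])
    show "AE x in P. exp (- x\<^sup>2 / (2 * \<sigma>\<^sup>2)) * exp (s / \<sigma>\<^sup>2 * x) \<le> exp c * (exp (- x\<^sup>2 / (2 * \<sigma>\<^sup>2)) * exp (t / \<sigma>\<^sup>2 * x))"
      using AE_abs_le
    proof eventually_elim
      case (elim x)
      show ?case using c[OF elim] unfolding exp_add[symmetric] by simp
    qed
  qed
  then have "lmg \<sigma> s \<le> ln (exp c * mg \<sigma> t)" using mg_pos[of \<sigma> t] mg_pos[of \<sigma> s] by (subst ln_le_cancel_iff) auto
  ultimately show ?thesis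
    using mg_pos[of \<sigma> t] mg_pos[of \<sigma> s] unfolding c_def[symmetric] by (simp add: ln_mult)
qed

text \<open>For y outside the input range the nearest admissible input is an endpoint, and the
  Gaussian centred there dominates the whole mixture.\<close>

lemma lmg_upper:
  assumes \<sigma>: "0 < \<sigma>" and y: "R \<le> \<bar>y\<bar>"
  shows "lmg \<sigma> y \<le> (R * \<bar>y\<bar> - R\<^sup>2 / 2) / \<sigma>\<^sup>2"
proof -
  have "mg \<sigma> y \<le> exp ((R * \<bar>y\<bar> - R\<^sup>2 / 2) / \<sigma>\<^sup>2)"
    unfolding mg_def
  proof (rule integral_le_const[OF mg_integrable])
    show "AE x in P. exp (- x\<^sup>2 / (2 * \<sigma>\<^sup>2)) * exp (y / \<sigma>\<^sup>2 * x) \<le> exp ((R * \<bar>y\<bar> - R\<^sup>2 / 2) / \<sigma>\<^sup>2)"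
      using AE_abs_le
    proof eventually_elim
      fix x assume x: "\<bar>x\<bar> \<le> R"
      have "0 \<le> (R - \<bar>x\<bar>) * (2 * \<bar>y\<bar> - R - \<bar>x\<bar>)" using x y by (intro mult_nonneg_nonneg) auto
      then have "\<bar>y\<bar> * \<bar>x\<bar> - x\<^sup>2 / 2 \<le> R * \<bar>y\<bar> - R\<^sup>2 / 2"
        by (simp add: algebra_simps power2_eq_square)
      moreover have "y * x \<le> \<bar>y\<bar> * \<bar>x\<bar>" by (metis abs_ge_self abs_mult)
      ultimately have "(y * x - x\<^sup>2 / 2) / \<sigma>\<^sup>2 \<le> (R * \<bar>y\<bar> - R\<^sup>2 / 2) / \<sigma>\<^sup>2"
        by (intro divide_right_mono) auto
      moreover have "(y * x - x\<^sup>2 / 2) / \<sigma>\<^sup>2 = - x\<^sup>2 / (2 * \<sigma>\<^sup>2) + y / \<sigma>\<^sup>2 * x"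
        using \<sigma> by (simp add: field_simps)
      ultimately show "exp (- x\<^sup>2 / (2 * \<sigma>\<^sup>2)) * exp (y / \<sigma>\<^sup>2 * x) \<le> exp ((R * \<bar>y\<bar> - R\<^sup>2 / 2) / \<sigma>\<^sup>2)"
        by (simp flip: exp_add)
    qed
  qed
  then show ?thesis using ln_le_cancel_iff[of "mg \<sigma> y" "exp ((R * \<bar>y\<bar> - R\<^sup>2 / 2) / \<sigma>\<^sup>2)"] mg_pos[of \<sigma> y]
    by simp
qed

text \<open>Jensen's inequality at the mean \<open>m\<close> of the input. The same \<open>m\<close>
  serves all t, so the bound is affine in t and survives Gaussian averaging.\<close>

lemma lmg_lower:
  assumes \<sigma>: "0 < \<sigma>"
  shows "\<exists>m. \<bar>m\<bar> \<le> R \<and> (\<forall>t. (t * m - R\<^sup>2 / 2) / \<sigma>\<^sup>2 \<le> lmg \<sigma> t)"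
proof -
  have i: "integrable P (\<lambda>x. x)" by (rule integrable_bounded[where C = R]) auto
  define m where "m = (\<integral>x. x \<partial>P)"
  have "m \<le> R" unfolding m_def using AE_abs_le by (intro integral_le_const i) (auto elim: eventually_mono)
  moreover have "-R \<le> m" unfolding m_def using AE_abs_le by (intro integral_ge_const i) (auto elim: eventually_mono)
  moreover have "(t * m - R\<^sup>2 / 2) / \<sigma>\<^sup>2 \<le> lmg \<sigma> t" for t
  proof -
    define c where "c = (t * m - R\<^sup>2 / 2) / \<sigma>\<^sup>2"
    have "(\<integral>x. exp c * (1 + t / \<sigma>\<^sup>2 * (x - m)) \<partial>P) \<le> mg \<sigma> t"
      unfolding mg_def
    proof (rule integral_mono_AE[OF _ mg_integrable])
      show "integrable P (\<lambda>x. exp c * (1 + t / \<sigma>\<^sup>2 * (x - m)))"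
        using i by (intro integrable_mult_right Bochner_Integration.integrable_add Bochner_Integration.integrable_diff) auto
      show "AE x in P. exp c * (1 + t / \<sigma>\<^sup>2 * (x - m)) \<le> exp (- x\<^sup>2 / (2 * \<sigma>\<^sup>2)) * exp (t / \<sigma>\<^sup>2 * x)"
        using AE_abs_le
      proof eventually_elim
        fix x assume x: "\<bar>x\<bar> \<le> R"
        have "exp c * (1 + t / \<sigma>\<^sup>2 * (x - m)) \<le> exp c * exp (t / \<sigma>\<^sup>2 * (x - m))"
          by (intro mult_left_mono exp_ge_add_one_self) auto
        also have "\<dots> = exp (- R\<^sup>2 / (2 * \<sigma>\<^sup>2)) * exp (t / \<sigma>\<^sup>2 * x)"
          using \<sigma> unfolding exp_add[symmetric] c_def by (simp add: field_simps)
        also have "\<dots> \<le> exp (- x\<^sup>2 / (2 * \<sigma>\<^sup>2)) * exp (t / \<sigma>\<^sup>2 * x)"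
        proof -
          have "x\<^sup>2 \<le> R\<^sup>2" using x by (simp add: abs_le_square_iff[symmetric])
          then have "- R\<^sup>2 / (2 * \<sigma>\<^sup>2) \<le> - x\<^sup>2 / (2 * \<sigma>\<^sup>2)" by (intro divide_right_mono) auto
          then show ?thesis by (intro mult_right_mono) auto
        qed
        finally show "exp c * (1 + t / \<sigma>\<^sup>2 * (x - m)) \<le> exp (- x\<^sup>2 / (2 * \<sigma>\<^sup>2)) * exp (t / \<sigma>\<^sup>2 * x)" .
      qed
    qed
    moreover have "(\<integral>x. exp c * (1 + t / \<sigma>\<^sup>2 * (x - m)) \<partial>P) = exp c"
    proof -
      have "(\<integral>x. exp c * (1 + t / \<sigma>\<^sup>2 * (x - m)) \<partial>P) = exp c * (1 + t / \<sigma>\<^sup>2 * ((\<integral>x. x \<partial>P) - m))"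
        using i prob_space by simp
      then show ?thesis by (simp add: m_def)
    qed
    ultimately have "exp c \<le> mg \<sigma> t" by simp
    then show ?thesis using mg_pos[of \<sigma> t] unfolding c_def[symmetric] by (simp add: ln_ge_iff)
  qed
  ultimately show ?thesis by (intro exI[of _ m]) auto
qed

lemma lmg_abs_le:
  assumes \<sigma>: "0 < \<sigma>"
  shows "\<bar>lmg \<sigma> t\<bar> \<le> R / \<sigma>\<^sup>2 * \<bar>t\<bar> + R\<^sup>2 / (2 * \<sigma>\<^sup>2)"
proof -
  have "mg \<sigma> 0 \<le> 1" unfolding mg_def
    by (rule integral_le_const[OF mg_integrable]) auto
  then have "lmg \<sigma> 0 \<le> 0" using mg_pos[of \<sigma> 0] by simp
  moreover have "- (R\<^sup>2 / (2 * \<sigma>\<^sup>2)) \<le> lmg \<sigma> 0" using lmg_lower[OF \<sigma>] by (auto dest!: spec[of _ 0])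
  moreover have "\<bar>lmg \<sigma> t - lmg \<sigma> 0\<bar> \<le> R / \<sigma>\<^sup>2 * \<bar>t\<bar>"
    using lmg_increment[OF \<sigma>, of 0 t] lmg_increment[OF \<sigma>, of t 0] by (cases "0 \<le> t") (auto simp: abs_minus_commute)
  ultimately show ?thesis by linarith
qed

text \<open>A form of Hoelder's inequality: both integrands are normalised to mass one, and
  convexity of the exponential is applied pointwise.\<close>

lemma lmg_convex:
  assumes \<sigma>: "0 < \<sigma>"
  shows "convex_on UNIV (lmg \<sigma>)"
proof (rule convex_onI)
  fix l s t :: real assume l: "0 < l" "l < 1"
  define e where "e r x = exp (- x\<^sup>2 / (2 * \<sigma>\<^sup>2)) * exp (r / \<sigma>\<^sup>2 * x)" for r x
  have e_int: "integrable P (e r)" and e_mg: "(\<integral>x. e r x \<partial>P) = mg \<sigma> r" for r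
    unfolding e_def[abs_def] mg_def using mg_integrable by auto
  define u where "u = (1 - l) * s + l * t"
  have "(\<integral>x. e u x / exp ((1 - l) * lmg \<sigma> s + l * lmg \<sigma> t) \<partial>P)
     \<le> (\<integral>x. (1 - l) * (e s x / mg \<sigma> s) + l * (e t x / mg \<sigma> t) \<partial>P)"
  proof (rule integral_mono)
    show "integrable P (\<lambda>x. e u x / exp ((1 - l) * lmg \<sigma> s + l * lmg \<sigma> t))"
      "integrable P (\<lambda>x. (1 - l) * (e s x / mg \<sigma> s) + l * (e t x / mg \<sigma> t))"
      using e_int by auto
    fix x
    define a where "a r = - x\<^sup>2 / (2 * \<sigma>\<^sup>2) + r / \<sigma>\<^sup>2 * x - lmg \<sigma> r" for r
    have ea: "e r x / mg \<sigma> r = exp (a r)" for r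
      using mg_pos[of \<sigma> r] by (simp add: e_def a_def exp_add exp_diff exp_minus field_simps)
    have "e u x / exp ((1 - l) * lmg \<sigma> s + l * lmg \<sigma> t) = exp ((1 - l) * a s + l * a t)"
    proof -
      have "- x\<^sup>2 / (2 * \<sigma>\<^sup>2) + u / \<sigma>\<^sup>2 * x - ((1 - l) * lmg \<sigma> s + l * lmg \<sigma> t) = (1 - l) * a s + l * a t"
        using \<sigma> by (simp add: u_def a_def field_simps)
      then show ?thesis unfolding e_def by (metis exp_add exp_diff)
    qed
    also have "\<dots> \<le> (1 - l) * exp (a s) + l * exp (a t)"
      using convex_onD[OF exp_convex, of l "a s" "a t"] l by simp
    finally show "e u x / exp ((1 - l) * lmg \<sigma> s + l * lmg \<sigma> t)
       \<le> (1 - l) * (e s x / mg \<sigma> s) + l * (e t x / mg \<sigma> t)" by (simp add: ea)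
  qed
  also have "\<dots> = 1"
    using e_int mg_pos[of \<sigma> s] mg_pos[of \<sigma> t] by (simp add: e_mg)
  finally have "mg \<sigma> u \<le> exp ((1 - l) * lmg \<sigma> s + l * lmg \<sigma> t)"
    by (simp add: e_mg)
  then show "lmg \<sigma> ((1 - l) *\<^sub>R s + l *\<^sub>R t) \<le> (1 - l) * lmg \<sigma> s + l * lmg \<sigma> t"
    using ln_le_cancel_iff[of "mg \<sigma> u" "exp ((1 - l) * lmg \<sigma> s + l * lmg \<sigma> t)"] mg_pos[of \<sigma> u]
    by (simp add: u_def)
qed simp

lemma continuous_mg:
  assumes "0 < \<sigma>" shows "continuous_on UNIV (mg \<sigma>)"
proof -
  have "continuous_on UNIV (\<lambda>t. Re (cmg \<sigma> (of_real t)))"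
    by (rule continuous_on_Re, rule continuous_on_compose2[OF
        holomorphic_on_imp_continuous_on[OF cmg_holomorphic[OF assms, of UNIV]]])
      (auto intro: continuous_on_of_real)
  then show ?thesis by (simp add: cmg_of_real)
qed

lemma continuous_lmg:
  assumes "0 < \<sigma>" shows "continuous_on UNIV (lmg \<sigma>)"
  using continuous_mg[OF assms] mg_pos by (intro continuous_intros) (auto simp: less_le)

lemma lmg_quad_growth:
  assumes \<sigma>: "0 < \<sigma>" shows "quad_growth (lmg \<sigma>)"
proof (rule quad_growthI)
  show "lmg \<sigma> \<in> borel_measurable borel"
    by (rule borel_measurable_continuous_onI[OF continuous_lmg[OF \<sigma>]])
  fix t :: real
  have "0 \<le> (\<bar>t\<bar> - 1)\<^sup>2" by simp
  then have "\<bar>t\<bar> \<le> 1 + t\<^sup>2" unfolding power2_diff using abs_ge_zero[of t] by simp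
  then have "R / \<sigma>\<^sup>2 * \<bar>t\<bar> \<le> R / \<sigma>\<^sup>2 * (1 + t\<^sup>2)" using R_nonneg by (intro mult_left_mono) auto
  then show "\<bar>lmg \<sigma> t\<bar> \<le> (R / \<sigma>\<^sup>2 + R\<^sup>2 / (2 * \<sigma>\<^sup>2)) + R / \<sigma>\<^sup>2 * t\<^sup>2"
    using lmg_abs_le[OF \<sigma>, of t] by (simp add: algebra_simps add_divide_distrib)
qed

section \<open>From the moment function to the output density\<close>

lemma out_density_eq:
  assumes \<sigma>: "0 < \<sigma>"
  shows "out_density \<sigma> P y = exp (- y\<^sup>2 / (2 * \<sigma>\<^sup>2)) / sqrt (2 * pi * \<sigma>\<^sup>2) * mg \<sigma> y"
  unfolding out_density_def mg_def normal_density_eq_tilt[OF \<sigma>] by (rule integral_mult_right_zero)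

lemma out_density_pos: "0 < \<sigma> \<Longrightarrow> 0 < out_density \<sigma> P y"
  using mg_pos[of \<sigma> y] by (simp add: out_density_eq)

lemma ln_out_density:
  assumes \<sigma>: "0 < \<sigma>"
  shows "ln (out_density \<sigma> P y) = lmg \<sigma> y - y\<^sup>2 / (2 * \<sigma>\<^sup>2) - ln (sqrt (2 * pi * \<sigma>\<^sup>2))"
  using \<sigma> mg_pos[of \<sigma> y] unfolding out_density_eq[OF \<sigma>]
  by (subst ln_mult ln_div; simp)+

lemma ln_out_density_quad_growth:
  assumes \<sigma>: "0 < \<sigma>" shows "quad_growth (\<lambda>y. ln (out_density \<sigma> P y))"
proof -
  have "quad_growth (\<lambda>y. lmg \<sigma> y - 1 / (2 * \<sigma>\<^sup>2) * y\<^sup>2 - ln (sqrt (2 * pi * \<sigma>\<^sup>2)))"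
    by (intro quad_growth_diff quad_growth_cmult lmg_quad_growth[OF \<sigma>]) auto
  then show ?thesis by (simp add: ln_out_density[OF \<sigma>])
qed

lemma out_density_measurable:
  assumes \<sigma>: "0 < \<sigma>" shows "out_density \<sigma> P \<in> borel_measurable borel"
  using borel_measurable_continuous_onI[OF continuous_mg[OF \<sigma>]]
  unfolding out_density_eq[OF \<sigma>, abs_def] by measurable

lemma out_density_le:
  assumes \<sigma>: "0 < \<sigma>" shows "out_density \<sigma> P y \<le> 1 / sqrt (2 * pi * \<sigma>\<^sup>2)"
  unfolding out_density_def
proof (rule integral_le_const)
  show "integrable P (\<lambda>x. normal_density x \<sigma> y)"
    unfolding normal_density_eq_tilt[OF \<sigma>]
    by (intro integrable_mult_right mg_integrable)
qed (auto simp: normal_density_def divide_right_mono)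

text \<open>Second moments of the Gaussians centred in [-R, R] are uniformly bounded, which gives
  the absolute integrability that exchanging the order requires.\<close>

lemma integrable_out_density_and_fubini:
  assumes \<sigma>: "0 < \<sigma>" and h: "quad_growth h"
  shows "integrable lborel (\<lambda>y. out_density \<sigma> P y * h y)"
    and "integrable P (\<lambda>x. \<integral>y. normal_density x \<sigma> y * h y \<partial>lborel)"
    and "(\<integral>x. (\<integral>y. normal_density x \<sigma> y * h y \<partial>lborel) \<partial>P) = (\<integral>y. out_density \<sigma> P y * h y \<partial>lborel)"
proof -
  interpret L: pair_sigma_finite P lborel
    by (intro pair_sigma_finite.intro) (unfold_locales)
  have [measurable]: "h \<in> borel_measurable borel" using h by (rule quad_growth_measurable)
  have [measurable]: "(\<lambda>(x, y). normal_density x \<sigma> y * h y) \<in> borel_measurable (P \<Otimes>\<^sub>M lborel)"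
    unfolding normal_density_def by measurable
  obtain a b where ab: "0 \<le> a" "0 \<le> b" "\<And>y. \<bar>h y\<bar> \<le> a + b * y\<^sup>2"
    using quad_growth_bound[OF h] by blast
  have "integrable (P \<Otimes>\<^sub>M lborel) (\<lambda>(x, y). normal_density x \<sigma> y * h y)"
  proof (rule L.Fubini_integrable)
    show "AE x in P. integrable lborel (\<lambda>y. (\<lambda>(x, y). normal_density x \<sigma> y * h y) (x, y))"
      using integrable_normal_quad_growth[OF \<sigma> h] by simp
    show "integrable P (\<lambda>x. \<integral>y. norm ((\<lambda>(x, y). normal_density x \<sigma> y * h y) (x, y)) \<partial>lborel)"
    proof (rule integrable_const_bound[where B = "a + b * (\<sigma>\<^sup>2 + R\<^sup>2)"])
      show "AE x in P. norm (\<integral>y. norm ((\<lambda>(x, y). normal_density x \<sigma> y * h y) (x, y)) \<partial>lborel) \<le> a + b * (\<sigma>\<^sup>2 + R\<^sup>2)"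
        using AE_abs_le
      proof eventually_elim
        fix x assume x: "\<bar>x\<bar> \<le> R"
        have "(\<integral>y. normal_density x \<sigma> y * \<bar>h y\<bar> \<partial>lborel) \<le> a + b * (\<sigma>\<^sup>2 + x\<^sup>2)"
          using ab by (intro integral_normal_quad_le \<sigma> quad_growth_abs h)
        also have "\<dots> \<le> a + b * (\<sigma>\<^sup>2 + R\<^sup>2)"
          using x ab by (intro add_mono mult_left_mono) (auto simp: abs_le_square_iff[symmetric])
        finally show "norm (\<integral>y. norm ((\<lambda>(x, y). normal_density x \<sigma> y * h y) (x, y)) \<partial>lborel) \<le> a + b * (\<sigma>\<^sup>2 + R\<^sup>2)"
          by (simp add: abs_mult integral_nonneg)
      qed
    qed measurable
  qed measurable
  note L.integrable_fst'[OF this] L.integrable_snd[OF this] L.Fubini_integral[OF this]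
  then show "integrable lborel (\<lambda>y. out_density \<sigma> P y * h y)"
     "integrable P (\<lambda>x. \<integral>y. normal_density x \<sigma> y * h y \<partial>lborel)"
    "(\<integral>x. (\<integral>y. normal_density x \<sigma> y * h y \<partial>lborel) \<partial>P) = (\<integral>y. out_density \<sigma> P y * h y \<partial>lborel)"
    by (simp_all add: out_density_def)
qed

end

section \<open>Optimality conditions\<close>

lemma integral_normal_ln_normal:
  assumes \<sigma>: "0 < \<sigma>"
  shows "integrable lborel (\<lambda>y. normal_density x \<sigma> y * ln (normal_density x \<sigma> y))"
    and "(\<integral>y. normal_density x \<sigma> y * ln (normal_density x \<sigma> y) \<partial>lborel) = - ln (sqrt (2 * pi * \<sigma>\<^sup>2)) - 1 / 2"
proof -
  have eq: "normal_density x \<sigma> y * ln (normal_density x \<sigma> y)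
     = - 1 / (2 * \<sigma>\<^sup>2) * (normal_density x \<sigma> y * (y - x) ^ (2 * 1)) - ln (sqrt (2 * pi * \<sigma>\<^sup>2)) * normal_density x \<sigma> y" for y
  proof -
    have "ln (normal_density x \<sigma> y) = - ln (sqrt (2 * pi * \<sigma>\<^sup>2)) - (y - x)\<^sup>2 / (2 * \<sigma>\<^sup>2)"
      unfolding normal_density_def using \<sigma> by (subst ln_mult ln_div; simp)+
    then show ?thesis by (simp add: right_diff_distrib)
  qed
  note i = integrable_normal_moment[OF \<sigma>, of x "2 * 1"] integrable_normal_density[OF \<sigma>, of x]
  show "integrable lborel (\<lambda>y. normal_density x \<sigma> y * ln (normal_density x \<sigma> y))"
    unfolding eq using i by (intro Bochner_Integration.integrable_diff integrable_mult_right)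
  have "(\<integral>y. normal_density x \<sigma> y * ln (normal_density x \<sigma> y) \<partial>lborel)
     = - 1 / (2 * \<sigma>\<^sup>2) * (\<integral>y. normal_density x \<sigma> y * (y - x) ^ (2 * 1) \<partial>lborel) - ln (sqrt (2 * pi * \<sigma>\<^sup>2)) * (\<integral>y. normal_density x \<sigma> y \<partial>lborel)"
    unfolding eq using i by (subst Bochner_Integration.integral_diff; simp)
  moreover have "(\<integral>y. normal_density x \<sigma> y * (y - x) ^ (2 * 1) \<partial>lborel) = \<sigma>\<^sup>2"
    using integral_normal_moment_even[OF \<sigma>, of x 1] by simp
  ultimately show "(\<integral>y. normal_density x \<sigma> y * ln (normal_density x \<sigma> y) \<partial>lborel) = - ln (sqrt (2 * pi * \<sigma>\<^sup>2)) - 1 / 2"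
    using \<sigma> by simp
qed

text \<open>The channel is degraded: the second output is distributed as the first plus independent
  noise. Averages over the second output thus become averages over the first of a smoothed
  function.\<close>

lemma normal_density_convolution:
  assumes a: "0 < a" and b: "0 < b" and h: "quad_growth h"
  shows "(\<integral>y. normal_density x a y * (\<integral>t. normal_density y b t * h t \<partial>lborel) \<partial>lborel)
    = (\<integral>t. normal_density x (sqrt (a\<^sup>2 + b\<^sup>2)) t * h t \<partial>lborel)"
proof -
  have [measurable]: "h \<in> borel_measurable borel" using h by (rule quad_growth_measurable)
  have meas [measurable]: "(\<lambda>(y, t). normal_density x a y * (normal_density y b t * h t)) \<in> borel_measurable (lborel \<Otimes>\<^sub>M lborel)"
    unfolding normal_density_def by measurable
  obtain c e where ce: "0 \<le> c" "0 \<le> e" "\<And>y. \<bar>h y\<bar> \<le> c + e * y\<^sup>2"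
    using quad_growth_bound[OF h] by blast
  have "integrable (lborel \<Otimes>\<^sub>M lborel) (\<lambda>(y, t). normal_density x a y * (normal_density y b t * h t))"
  proof (rule lborel_pair.Fubini_integrable[OF meas])
    show "AE y in lborel. integrable lborel (\<lambda>t. (\<lambda>(y, t). normal_density x a y * (normal_density y b t * h t)) (y, t))"
      using integrable_normal_quad_growth[OF b h] by simp
    have le: "0 \<le> (\<integral>t. normal_density y b t * \<bar>h t\<bar> \<partial>lborel)"
       "(\<integral>t. normal_density y b t * \<bar>h t\<bar> \<partial>lborel) \<le> c + e * (b\<^sup>2 + y\<^sup>2)" for y
      using ce by (auto intro!: integral_nonneg integral_normal_quad_le b quad_growth_abs h)
    have [measurable]: "(\<lambda>(y, t). normal_density y b t * \<bar>h t\<bar>) \<in> borel_measurable (lborel \<Otimes>\<^sub>M lborel)"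
      unfolding normal_density_def by measurable
    have "quad_growth (\<lambda>y. \<integral>t. normal_density y b t * \<bar>h t\<bar> \<partial>lborel)"
    proof (rule quad_growthI)
      show "(\<lambda>y. \<integral>t. normal_density y b t * \<bar>h t\<bar> \<partial>lborel) \<in> borel_measurable borel"
        using lborel.borel_measurable_lebesgue_integral[of "\<lambda>y t. normal_density y b t * \<bar>h t\<bar>" lborel] by simp
      show "\<bar>\<integral>t. normal_density y b t * \<bar>h t\<bar> \<partial>lborel\<bar> \<le> (c + e * b\<^sup>2) + e * y\<^sup>2" for y
        using le[of y] by (simp add: algebra_simps)
    qed
    from integrable_normal_quad_growth[OF a this, of x]
    show "integrable lborel (\<lambda>y. \<integral>t. norm ((\<lambda>(y, t). normal_density x a y * (normal_density y b t * h t)) (y, t)) \<partial>lborel)"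
      by (simp add: abs_mult)
  qed
  from lborel_pair.Fubini_integral[OF this]
  have "(\<integral>y. normal_density x a y * (\<integral>t. normal_density y b t * h t \<partial>lborel) \<partial>lborel)
     = (\<integral>t. (\<integral>y. normal_density x a y * normal_density y b t \<partial>lborel) * h t \<partial>lborel)"
    unfolding case_prod_conv integral_mult_right_zero unfolding mult.assoc[symmetric] by simp
  moreover have "(\<integral>y. normal_density x a y * normal_density y b t \<partial>lborel) = normal_density x (sqrt (a\<^sup>2 + b\<^sup>2)) t" for t
  proof -
    have "(\<integral>\<^sup>+y. ennreal (normal_density x a y * normal_density y b t) \<partial>lborel)
       = (\<integral>\<^sup>+y. ennreal (normal_density 0 b ((t - x) - y) * normal_density 0 a y) \<partial>lborel)"
    proof (subst nn_integral_real_affine[where c = 1 and t = x])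
      show "(\<lambda>y. ennreal (normal_density x a y * normal_density y b t)) \<in> borel_measurable borel"
        unfolding normal_density_def by measurable
    qed (auto simp: normal_density_def diff_diff_eq mult_ac)
    also have "\<dots> = ennreal (normal_density 0 (sqrt (b\<^sup>2 + a\<^sup>2)) (t - x))"
      using conv_normal_density_zero_mean[OF b a] by (simp add: fun_eq_iff)
    also have "normal_density 0 (sqrt (b\<^sup>2 + a\<^sup>2)) (t - x) = normal_density x (sqrt (a\<^sup>2 + b\<^sup>2)) t"
      by (simp add: normal_density_def add.commute)
    finally show ?thesis by (intro integral_eq_nn_integral[THEN trans]) (simp_all add: normal_density_def)
  qed
  ultimately show ?thesis by simp
qed

section \<open>Entropies and their variation\<close>

context bounded_input
begin

text \<open>Taken without the customary minus sign; its average over the input is therefore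
  \<open>neg_entropy\<close>.\<close>

definition cross_entropy :: "real \<Rightarrow> real \<Rightarrow> real" where
  "cross_entropy \<sigma> x = (\<integral>y. normal_density x \<sigma> y * ln (out_density \<sigma> P y) \<partial>lborel)"

definition neg_entropy :: "real \<Rightarrow> real" where
  "neg_entropy \<sigma> = (\<integral>y. out_density \<sigma> P y * ln (out_density \<sigma> P y) \<partial>lborel)"

lemma integral_cross_entropy:
  assumes "0 < \<sigma>"
  shows "integrable P (cross_entropy \<sigma>)" "(\<integral>x. cross_entropy \<sigma> x \<partial>P) = neg_entropy \<sigma>"
  using integrable_out_density_and_fubini(2,3)[OF assms ln_out_density_quad_growth[OF assms]]
  by (simp_all add: cross_entropy_def[abs_def] neg_entropy_def)

lemma mutual_info_eq:
  assumes \<sigma>: "0 < \<sigma>"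
  shows "mutual_info \<sigma> P = - ln (sqrt (2 * pi * \<sigma>\<^sup>2)) - 1 / 2 - neg_entropy \<sigma>"
proof -
  have "(\<integral>y. normal_density x \<sigma> y * ln (normal_density x \<sigma> y / out_density \<sigma> P y) \<partial>lborel)
     = - ln (sqrt (2 * pi * \<sigma>\<^sup>2)) - 1 / 2 - cross_entropy \<sigma> x" for x
  proof -
    have "(\<integral>y. normal_density x \<sigma> y * ln (normal_density x \<sigma> y / out_density \<sigma> P y) \<partial>lborel)
      = (\<integral>y. normal_density x \<sigma> y * ln (normal_density x \<sigma> y) - normal_density x \<sigma> y * ln (out_density \<sigma> P y) \<partial>lborel)"
    proof (intro Bochner_Integration.integral_cong refl)
      fix y
      show "normal_density x \<sigma> y * ln (normal_density x \<sigma> y / out_density \<sigma> P y)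
         = normal_density x \<sigma> y * ln (normal_density x \<sigma> y) - normal_density x \<sigma> y * ln (out_density \<sigma> P y)"
        using normal_density_pos[OF \<sigma>, of x y] out_density_pos[OF \<sigma>, of y] by (simp add: ln_div algebra_simps)
    qed
    then show ?thesis
      using integral_normal_ln_normal[OF \<sigma>, of x] integrable_normal_quad_growth[OF \<sigma> ln_out_density_quad_growth[OF \<sigma>], of x]
      by (simp add: cross_entropy_def)
  qed
  then show ?thesis
    unfolding mutual_info_def using integral_cross_entropy[OF \<sigma>] prob_space by simp
qed

text \<open>The mixture of the input with a point mass, realised as the law of a value selected by
  an independent Bernoulli coin.\<close>

lemma mixture_exists:
  assumes l: "0 \<le> l" "l \<le> 1" and x0: "\<bar>x0\<bar> \<le> R"
  shows "\<exists>Q. admissible_input R Q \<and>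
    (\<forall>\<sigma> y. 0 < \<sigma> \<longrightarrow> out_density \<sigma> Q y = (1 - l) * out_density \<sigma> P y + l * normal_density x0 \<sigma> y)"
proof -
  define M where "M = measure_pmf (bernoulli_pmf l)"
  interpret M: prob_space M unfolding M_def by (rule measure_pmf.prob_space_axioms)
  interpret PM: pair_prob_space P M ..
  have [measurable_cong]: "sets M = sets (count_space UNIV)" by (simp add: M_def)
  define T where "T = (\<lambda>(x, b). if b then x0 else x :: real)"
  have T [measurable]: "T \<in> measurable (P \<Otimes>\<^sub>M M) borel"
    unfolding T_def by measurable
  define Q where "Q = distr (P \<Otimes>\<^sub>M M) borel T"
  have "prob_space Q" unfolding Q_def by (rule PM.prob_space_distr[OF T])
  moreover have "sets Q = sets borel" by (simp add: Q_def)
  moreover have "emeasure Q {-R..R} = 1"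
  proof -
    have "emeasure Q {-R..R} = (\<integral>\<^sup>+z. indicator {-R..R} z \<partial>Q)" by (simp add: Q_def)
    also have "\<dots> = (\<integral>\<^sup>+p. indicator {-R..R} (T p) \<partial>(P \<Otimes>\<^sub>M M))"
      unfolding Q_def by (subst nn_integral_distr) auto
    also have "\<dots> = (\<integral>\<^sup>+x. \<integral>\<^sup>+b. indicator {-R..R} (T (x, b)) \<partial>M \<partial>P)"
      by (subst M.nn_integral_fst[symmetric]) auto
    also have "\<dots> = (\<integral>\<^sup>+x. 1 \<partial>P)"
    proof (rule nn_integral_cong_AE)
      show "AE x in P. (\<integral>\<^sup>+b. indicator {-R..R} (T (x, b)) \<partial>M) = 1"
        using AE_abs_le
      proof eventually_elim
        fix x assume "\<bar>x\<bar> \<le> R"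
        then have "(\<integral>\<^sup>+b. indicator {-R..R} (T (x, b)) \<partial>M) = (\<integral>\<^sup>+b. 1 \<partial>M)"
          using x0 by (intro nn_integral_cong) (auto simp: T_def abs_le_iff)
        then show "(\<integral>\<^sup>+b. indicator {-R..R} (T (x, b)) \<partial>M) = 1" by (simp add: M.emeasure_space_1)
      qed
    qed
    also have "\<dots> = 1" using emeasure_space_1 by simp
    finally show ?thesis .
  qed
  moreover have "out_density \<sigma> Q y = (1 - l) * out_density \<sigma> P y + l * normal_density x0 \<sigma> y" if \<sigma>: "0 < \<sigma>" for \<sigma> y
  proof -
    have [measurable]: "(\<lambda>x. normal_density x \<sigma> y) \<in> borel_measurable borel"
      unfolding normal_density_def by measurable
    have bound: "norm (normal_density x \<sigma> y) \<le> 1 / sqrt (2 * pi * \<sigma>\<^sup>2)" for x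
      by (auto simp: normal_density_def divide_right_mono)
    have int: "integrable P (\<lambda>x. normal_density x \<sigma> y)"
      by (rule integrable_bounded[OF _ bound[unfolded real_norm_def]]) measurable
    have "integrable (P \<Otimes>\<^sub>M M) (\<lambda>p. normal_density (T p) \<sigma> y)"
      by (rule PM.integrable_const_bound[OF AE_I2[OF bound]]) measurable
    note PM.integral_fst'[OF this]
    moreover have "out_density \<sigma> Q y = (\<integral>p. normal_density (T p) \<sigma> y \<partial>(P \<Otimes>\<^sub>M M))"
      unfolding out_density_def Q_def by (rule integral_distr) measurable
    moreover have "(\<integral>b. normal_density (T (x, b)) \<sigma> y \<partial>M) = l * normal_density x0 \<sigma> y + (1 - l) * normal_density x \<sigma> y" for x
      unfolding M_def using l by (simp add: T_def)
    ultimately show ?thesis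
      using int prob_space by (simp add: out_density_def)
  qed
  ultimately show ?thesis unfolding admissible_input_def by blast
qed

text \<open>The ratio of the two densities grows at most exponentially in |y|, which Gaussian tails
  absorb. The integral is the second-order cost of moving mass to x.\<close>

lemma integrable_chi_square:
  assumes \<sigma>: "0 < \<sigma>"
  shows "integrable lborel (\<lambda>y. (normal_density x \<sigma> y - out_density \<sigma> P y)\<^sup>2 / out_density \<sigma> P y)"
proof -
  \<comment> \<open>The Gaussian centred at x contributes the rate |x| / \<sigma>^2 and the
    Lipschitz bound on \<open>lmg\<close> the rate R / \<sigma>^2.\<close>
  define c where "c = (\<bar>x\<bar> + R) / \<sigma>\<^sup>2"
  define K where "K = exp (R\<^sup>2 / (2 * \<sigma>\<^sup>2))"
  have ratio: "normal_density x \<sigma> y / out_density \<sigma> P y \<le> K * (exp (c * y) + exp (- c * y))" for y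
  proof -
    have "normal_density x \<sigma> y / out_density \<sigma> P y = exp (- x\<^sup>2 / (2 * \<sigma>\<^sup>2)) * exp (y / \<sigma>\<^sup>2 * x) / mg \<sigma> y"
      unfolding normal_density_eq_tilt[OF \<sigma>] out_density_eq[OF \<sigma>] using \<sigma> by simp
    also have "\<dots> = exp (- x\<^sup>2 / (2 * \<sigma>\<^sup>2) + y / \<sigma>\<^sup>2 * x - lmg \<sigma> y)"
      using mg_pos[of \<sigma> y] by (simp only: exp_add exp_diff exp_ln)
    also have "\<dots> \<le> exp (R\<^sup>2 / (2 * \<sigma>\<^sup>2) + c * \<bar>y\<bar>)"
    proof -
      have "y * x \<le> \<bar>y\<bar> * \<bar>x\<bar>" by (metis abs_ge_self abs_mult)
      then have "y / \<sigma>\<^sup>2 * x \<le> \<bar>x\<bar> / \<sigma>\<^sup>2 * \<bar>y\<bar>"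
        using divide_right_mono[of "y * x" "\<bar>y\<bar> * \<bar>x\<bar>" "\<sigma>\<^sup>2"] by (simp add: mult_ac)
      moreover have "- x\<^sup>2 / (2 * \<sigma>\<^sup>2) \<le> 0" by simp
      moreover have "- lmg \<sigma> y \<le> R / \<sigma>\<^sup>2 * \<bar>y\<bar> + R\<^sup>2 / (2 * \<sigma>\<^sup>2)"
        using lmg_abs_le[OF \<sigma>, of y] by linarith
      moreover have "c * \<bar>y\<bar> = \<bar>x\<bar> / \<sigma>\<^sup>2 * \<bar>y\<bar> + R / \<sigma>\<^sup>2 * \<bar>y\<bar>"
        by (simp add: c_def add_divide_distrib distrib_right)
      ultimately show ?thesis unfolding exp_le_cancel_iff by linarith
    qed
    also have "\<dots> = K * exp (c * \<bar>y\<bar>)" by (simp add: K_def exp_add)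
    also have "\<dots> \<le> K * (exp (c * y) + exp (- c * y))"
      by (intro mult_left_mono exp_abs_le) (simp add: K_def)
    finally show ?thesis .
  qed
  have [measurable]: "out_density \<sigma> P \<in> borel_measurable borel" by (rule out_density_measurable[OF \<sigma>])
  have e: "integrable lborel (\<lambda>y. normal_density x \<sigma> y * exp (s * y))" for s
  proof -
    define C where "C = exp (- x\<^sup>2 / (2 * \<sigma>\<^sup>2)) / sqrt (2 * pi * \<sigma>\<^sup>2)"
    have "normal_density x \<sigma> y * exp (s * y) = C * (exp (- y\<^sup>2 / (2 * \<sigma>\<^sup>2)) * 1 * exp ((x / \<sigma>\<^sup>2 + s) * y))" for y
      unfolding normal_density_eq_exp_linear[OF \<sigma>] C_def[symmetric] by (simp add: distrib_right exp_add)
    then show ?thesis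
      using integrable_mult_right[OF exp_integrableD[OF exp_integrable_gauss[OF \<sigma> quad_growth_const[of 1]]], of C] by simp
  qed
  have "integrable lborel (\<lambda>y. (normal_density x \<sigma> y)\<^sup>2 / out_density \<sigma> P y)"
  proof (rule Bochner_Integration.integrable_bound)
    show "integrable lborel (\<lambda>y. K * (normal_density x \<sigma> y * exp (c * y) + normal_density x \<sigma> y * exp (- c * y)))"
      by (intro integrable_mult_right Bochner_Integration.integrable_add e)
    show "AE y in lborel. norm ((normal_density x \<sigma> y)\<^sup>2 / out_density \<sigma> P y)
       \<le> norm (K * (normal_density x \<sigma> y * exp (c * y) + normal_density x \<sigma> y * exp (- c * y)))"
    proof (intro AE_I2)
      fix y
      have "norm ((normal_density x \<sigma> y)\<^sup>2 / out_density \<sigma> P y)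
          = normal_density x \<sigma> y * (normal_density x \<sigma> y / out_density \<sigma> P y)"
        using out_density_pos[OF \<sigma>, of y] by (simp add: power2_eq_square)
      also have "\<dots> \<le> normal_density x \<sigma> y * (K * (exp (c * y) + exp (- c * y)))"
        by (intro mult_left_mono ratio) simp
      also have "\<dots> \<le> norm (K * (normal_density x \<sigma> y * exp (c * y) + normal_density x \<sigma> y * exp (- c * y)))"
        by (simp add: algebra_simps)
      finally show "norm ((normal_density x \<sigma> y)\<^sup>2 / out_density \<sigma> P y)
       \<le> norm (K * (normal_density x \<sigma> y * exp (c * y) + normal_density x \<sigma> y * exp (- c * y)))" .
    qed
  qed measurable
  moreover have "integrable lborel (out_density \<sigma> P)"
    using integrable_out_density_and_fubini(1)[OF \<sigma> quad_growth_const[of 1]] by simp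
  ultimately have "integrable lborel (\<lambda>y. (normal_density x \<sigma> y)\<^sup>2 / out_density \<sigma> P y - 2 * normal_density x \<sigma> y + out_density \<sigma> P y)"
    using \<sigma> by (intro Bochner_Integration.integrable_add Bochner_Integration.integrable_diff integrable_mult_right integrable_normal_density)
  moreover have "(normal_density x \<sigma> y)\<^sup>2 / out_density \<sigma> P y - 2 * normal_density x \<sigma> y + out_density \<sigma> P y
     = (normal_density x \<sigma> y - out_density \<sigma> P y)\<^sup>2 / out_density \<sigma> P y" for y
    using out_density_pos[OF \<sigma>, of y] by (simp add: field_simps power2_eq_square)
  ultimately show ?thesis by simp
qed

lemma integral_out_density:
  assumes "0 < \<sigma>"
  shows "integrable lborel (out_density \<sigma> P)" "(\<integral>y. out_density \<sigma> P y \<partial>lborel) = 1"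
  using integrable_out_density_and_fubini(1,3)[OF assms quad_growth_const[of 1]] assms prob_space by simp_all

text \<open>The integrated tangent of u ln u at the output density, in the direction of a point mass
  at x. The summand 1 of the derivative cancels because both densities have mass one.\<close>

lemma entropy_tangent:
  assumes \<sigma>: "0 < \<sigma>"
  shows "integrable lborel (\<lambda>y. out_density \<sigma> P y * ln (out_density \<sigma> P y) +
      l * ((1 + ln (out_density \<sigma> P y)) * (normal_density x \<sigma> y - out_density \<sigma> P y)))" (is "integrable _ ?f")
    and "(\<integral>y. out_density \<sigma> P y * ln (out_density \<sigma> P y) +
      l * ((1 + ln (out_density \<sigma> P y)) * (normal_density x \<sigma> y - out_density \<sigma> P y)) \<partial>lborel)
      = neg_entropy \<sigma> + l * (cross_entropy \<sigma> x - neg_entropy \<sigma>)"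
proof -
  have eq: "?f = (\<lambda>y. out_density \<sigma> P y * ln (out_density \<sigma> P y) +
      l * (normal_density x \<sigma> y + normal_density x \<sigma> y * ln (out_density \<sigma> P y)
        - out_density \<sigma> P y - out_density \<sigma> P y * ln (out_density \<sigma> P y)))"
    by (simp add: algebra_simps)
  note i = integrable_out_density_and_fubini(1)[OF \<sigma> ln_out_density_quad_growth[OF \<sigma>]]
    integrable_normal_density[OF \<sigma>, of x] integral_normal_density[OF \<sigma>, of x] integral_out_density[OF \<sigma>]
    integrable_normal_quad_growth[OF \<sigma> ln_out_density_quad_growth[OF \<sigma>], of x]
  show "integrable lborel ?f" unfolding eq using i by auto
  show "integral\<^sup>L lborel ?f = neg_entropy \<sigma> + l * (cross_entropy \<sigma> x - neg_entropy \<sigma>)"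
    unfolding eq using i by (simp add: cross_entropy_def neg_entropy_def)
qed

end

lemma mutual_info_return:
  assumes "0 < \<sigma>"
  shows "mutual_info \<sigma> (return borel x) = 0"
proof -
  interpret bounded_input "\<bar>x\<bar>" "return borel x"
    by unfold_locales (auto simp: admissible_input_def prob_space_return indicator_def)
  have "out_density \<sigma> (return borel x) y = normal_density x \<sigma> y" for y
    unfolding out_density_def by (rule integral_return) (simp_all add: normal_density_def)
  then show ?thesis
    using integral_normal_ln_normal(2)[OF assms, of x] by (simp add: mutual_info_eq[OF assms] neg_entropy_def)
qed

text \<open>The two entropies enter the rate with opposite signs: this bound serves the second
  receiver, and the next one, with its quadratic error, the first.\<close>

lemma xlnx_tangent_lower:
  fixes u f :: real
  assumes "0 < u" "0 < f"
  shows "f * ln f + (1 + ln f) * (u - f) \<le> u * ln u"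
proof -
  have "ln (f / u) \<le> f / u - 1" using assms by (intro ln_le_minus_one) simp
  then have "u * ln (f / u) \<le> u * (f / u - 1)" using assms by (intro mult_left_mono) auto
  then show ?thesis using assms by (simp add: ln_div algebra_simps)
qed

lemma xlnx_tangent_upper:
  fixes u f :: real
  assumes "0 < u" "0 < f"
  shows "u * ln u \<le> f * ln f + (1 + ln f) * (u - f) + (u - f)\<^sup>2 / f"
proof -
  have "ln (u / f) \<le> u / f - 1" using assms by (intro ln_le_minus_one) simp
  then have "u * ln (u / f) \<le> u * (u / f - 1)" using assms by (intro mult_left_mono) auto
  also have "\<dots> = (u - f) + (u - f)\<^sup>2 / f" using assms by (simp add: field_simps power2_eq_square)
  finally show ?thesis using assms by (simp add: ln_div algebra_simps)
qed

locale wiretap = bounded_input +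
  fixes \<sigma>1 \<sigma>2 :: real
  assumes \<sigma>1_pos: "0 < \<sigma>1" and \<sigma>1_less: "\<sigma>1 < \<sigma>2"
begin

lemma \<sigma>2_pos: "0 < \<sigma>2" using \<sigma>1_pos \<sigma>1_less by simp

lemma secrecy_rate_eq: "secrecy_rate \<sigma>1 \<sigma>2 P = ln (\<sigma>2 / \<sigma>1) + neg_entropy \<sigma>2 - neg_entropy \<sigma>1"
proof -
  have "ln (sqrt (2 * pi * \<sigma>2\<^sup>2)) - ln (sqrt (2 * pi * \<sigma>1\<^sup>2)) = ln (\<sigma>2 / \<sigma>1)"
    using \<sigma>1_pos \<sigma>2_pos by (simp add: real_sqrt_mult ln_mult ln_div)
  then show ?thesis
    unfolding secrecy_rate_def mutual_info_eq[OF \<sigma>1_pos] mutual_info_eq[OF \<sigma>2_pos] by simp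
qed

end

locale optimal_wiretap = wiretap +
  assumes optimal: "capacity_achieving \<sigma>1 \<sigma>2 R P"
begin

lemma secrecy_capacity_eq: "secrecy_capacity \<sigma>1 \<sigma>2 R = secrecy_rate \<sigma>1 \<sigma>2 P"
  unfolding secrecy_capacity_def
  by (rule cSup_eq_maximum) (use optimal in \<open>auto simp: capacity_achieving_def\<close>)

lemma secrecy_capacity_nonneg: "0 \<le> secrecy_capacity \<sigma>1 \<sigma>2 R"
proof -
  have "admissible_input R (return borel 0)"
    using R_nonneg by (auto simp: admissible_input_def prob_space_return)
  then have "secrecy_rate \<sigma>1 \<sigma>2 (return borel 0) \<le> secrecy_rate \<sigma>1 \<sigma>2 P"
    using optimal by (simp add: capacity_achieving_def)
  then show ?thesis
    unfolding secrecy_capacity_eq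
    by (simp add: secrecy_rate_def[of _ _ "return borel 0"] mutual_info_return \<sigma>1_pos \<sigma>2_pos)
qed

text \<open>Moving mass \<open>l\<close> to x changes the rate by at least
  \<open>l * G - l\<^sup>2 * K\<close>: a tangent from below at the second receiver, a tangent plus
  chi-square error from above at the first. Optimality forces \<open>G \<le> l * K\<close>, and l
  tends to 0.\<close>

lemma cross_entropy_difference_le:
  assumes x: "\<bar>x\<bar> \<le> R"
  shows "cross_entropy \<sigma>2 x - cross_entropy \<sigma>1 x \<le> neg_entropy \<sigma>2 - neg_entropy \<sigma>1"
proof -
  define K where "K = (\<integral>y. (normal_density x \<sigma>1 y - out_density \<sigma>1 P y)\<^sup>2 / out_density \<sigma>1 P y \<partial>lborel)"
  define G where "G = (cross_entropy \<sigma>2 x - cross_entropy \<sigma>1 x) - (neg_entropy \<sigma>2 - neg_entropy \<sigma>1)"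
  have le: "G \<le> l * K" if l: "0 < l" "l \<le> 1" for l
  proof -
    obtain Q where Q: "admissible_input R Q"
      "\<And>\<sigma> y. 0 < \<sigma> \<Longrightarrow> out_density \<sigma> Q y = (1 - l) * out_density \<sigma> P y + l * normal_density x \<sigma> y"
      using mixture_exists[of l x] l x by (meson less_imp_le)
    interpret Q: wiretap R Q \<sigma>1 \<sigma>2
      by unfold_locales (use Q \<sigma>1_pos \<sigma>1_less in auto)
    have diff: "out_density \<sigma> Q y - out_density \<sigma> P y = l * (normal_density x \<sigma> y - out_density \<sigma> P y)" if "0 < \<sigma>" for \<sigma> y
      using Q(2)[OF that] by (simp add: algebra_simps)
    have "neg_entropy \<sigma>2 + l * (cross_entropy \<sigma>2 x - neg_entropy \<sigma>2) \<le> Q.neg_entropy \<sigma>2"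
      unfolding Q.neg_entropy_def entropy_tangent(2)[OF \<sigma>2_pos, symmetric]
    proof (rule integral_mono[OF entropy_tangent(1)[OF \<sigma>2_pos]])
      show "integrable lborel (\<lambda>y. out_density \<sigma>2 Q y * ln (out_density \<sigma>2 Q y))"
        by (rule Q.integrable_out_density_and_fubini(1)[OF \<sigma>2_pos Q.ln_out_density_quad_growth[OF \<sigma>2_pos]])
      show "out_density \<sigma>2 P y * ln (out_density \<sigma>2 P y) +
        l * ((1 + ln (out_density \<sigma>2 P y)) * (normal_density x \<sigma>2 y - out_density \<sigma>2 P y))
        \<le> out_density \<sigma>2 Q y * ln (out_density \<sigma>2 Q y)" for y
        using xlnx_tangent_lower[OF Q.out_density_pos[OF \<sigma>2_pos] out_density_pos[OF \<sigma>2_pos], of y y]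
        unfolding diff[OF \<sigma>2_pos] by (simp add: mult_ac)
    qed
    moreover have "Q.neg_entropy \<sigma>1 \<le> neg_entropy \<sigma>1 + l * (cross_entropy \<sigma>1 x - neg_entropy \<sigma>1) + l\<^sup>2 * K"
    proof -
      have "Q.neg_entropy \<sigma>1 \<le> (\<integral>y. (out_density \<sigma>1 P y * ln (out_density \<sigma>1 P y) +
          l * ((1 + ln (out_density \<sigma>1 P y)) * (normal_density x \<sigma>1 y - out_density \<sigma>1 P y)))
          + l\<^sup>2 * ((normal_density x \<sigma>1 y - out_density \<sigma>1 P y)\<^sup>2 / out_density \<sigma>1 P y) \<partial>lborel)"
        unfolding Q.neg_entropy_def
      proof (rule integral_mono)
        show "integrable lborel (\<lambda>y. out_density \<sigma>1 Q y * ln (out_density \<sigma>1 Q y))"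
          by (rule Q.integrable_out_density_and_fubini(1)[OF \<sigma>1_pos Q.ln_out_density_quad_growth[OF \<sigma>1_pos]])
        show "integrable lborel (\<lambda>y. (out_density \<sigma>1 P y * ln (out_density \<sigma>1 P y) +
          l * ((1 + ln (out_density \<sigma>1 P y)) * (normal_density x \<sigma>1 y - out_density \<sigma>1 P y)))
          + l\<^sup>2 * ((normal_density x \<sigma>1 y - out_density \<sigma>1 P y)\<^sup>2 / out_density \<sigma>1 P y))"
          by (intro Bochner_Integration.integrable_add[OF entropy_tangent(1)] integrable_mult_right integrable_chi_square \<sigma>1_pos)
        show "out_density \<sigma>1 Q y * ln (out_density \<sigma>1 Q y) \<le> (out_density \<sigma>1 P y * ln (out_density \<sigma>1 P y) +
          l * ((1 + ln (out_density \<sigma>1 P y)) * (normal_density x \<sigma>1 y - out_density \<sigma>1 P y)))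
          + l\<^sup>2 * ((normal_density x \<sigma>1 y - out_density \<sigma>1 P y)\<^sup>2 / out_density \<sigma>1 P y)" for y
          using xlnx_tangent_upper[OF Q.out_density_pos[OF \<sigma>1_pos] out_density_pos[OF \<sigma>1_pos], of y y]
          unfolding diff[OF \<sigma>1_pos] by (simp add: power_mult_distrib mult_ac)
      qed
      also have "\<dots> = neg_entropy \<sigma>1 + l * (cross_entropy \<sigma>1 x - neg_entropy \<sigma>1) + l\<^sup>2 * K"
        unfolding K_def entropy_tangent(2)[OF \<sigma>1_pos, symmetric]
        by (subst Bochner_Integration.integral_add[OF entropy_tangent(1)[OF \<sigma>1_pos]
              integrable_mult_right[OF integrable_chi_square[OF \<sigma>1_pos]]])
          (simp only: integral_mult_right_zero)
      finally show ?thesis .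
    qed
    moreover have "Q.neg_entropy \<sigma>2 - Q.neg_entropy \<sigma>1 \<le> neg_entropy \<sigma>2 - neg_entropy \<sigma>1"
    proof -
      have "secrecy_rate \<sigma>1 \<sigma>2 Q \<le> secrecy_rate \<sigma>1 \<sigma>2 P"
        using optimal Q(1) by (simp add: capacity_achieving_def)
      then show ?thesis unfolding Q.secrecy_rate_eq secrecy_rate_eq by linarith
    qed
    ultimately have "l * G \<le> l * (l * K)"
      by (simp add: G_def algebra_simps power2_eq_square)
    then show ?thesis using l by simp
  qed
  have "((\<lambda>l. l * K) \<longlongrightarrow> 0 * K) (at_right 0)" by (intro tendsto_intros)
  then have "G \<le> 0 * K"
  proof (rule tendsto_lowerbound)
    have "\<forall>\<^sub>F l in at_right (0::real). l < 1" by (rule order_tendstoD[OF tendsto_ident_at]) simp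
    moreover have "\<forall>\<^sub>F l in at_right (0::real). 0 < l" by (rule eventually_at_right_less)
    ultimately show "\<forall>\<^sub>F l in at_right 0. G \<le> l * K" by eventually_elim (use le in auto)
  qed simp
  then show ?thesis by (simp add: G_def)
qed

end

section \<open>The function g and its zeros\<close>

lemma deriv_of_real_holomorphic:
  assumes H: "H holomorphic_on U" "open U" "of_real x \<in> U"
    and h: "\<And>t. H (of_real t) = of_real (h t)"
  shows "(h has_real_derivative Re (deriv H (of_real x))) (at x)"
    and "deriv H (of_real x) = of_real (Re (deriv H (of_real x)))"
proof -
  note D = holomorphic_derivI[OF H]
  show h': "(h has_real_derivative Re (deriv H (of_real x))) (at x)"
    using has_real_derivative_of_holomorphic[OF D] by (simp add: h)
  have "((\<lambda>t. H (of_real t)) has_vector_derivative deriv H (of_real x)) (at x)"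
    using has_vector_derivative_real_field[OF D] by simp
  moreover have "((\<lambda>t. H (of_real t)) has_vector_derivative of_real (Re (deriv H (of_real x)))) (at x)"
    unfolding h using h' by (intro has_vector_derivative_of_real) (simp add: has_real_derivative_iff_has_vector_derivative)
  ultimately show "deriv H (of_real x) = of_real (Re (deriv H (of_real x)))"
    by (rule vector_derivative_unique_at)
qed

lemma has_real_derivative_ge:
  fixes f :: "real \<Rightarrow> real"
  assumes f: "(f has_real_derivative D) (at x)"
    and le: "\<And>t. x < t \<Longrightarrow> c * (t - x) \<le> f t - f x"
  shows "c \<le> D"
proof (rule tendsto_lowerbound)
  show "((\<lambda>t. (f t - f x) / (t - x)) \<longlongrightarrow> D) (at_right x)"
    using f unfolding has_field_derivative_iff by (rule tendsto_within_subset) simp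
  have "\<forall>\<^sub>F t in at_right x. x < t" by (rule eventually_at_right_less)
  then show "\<forall>\<^sub>F t in at_right x. c \<le> (f t - f x) / (t - x)"
    by eventually_elim (use le in \<open>simp add: pos_le_divide_eq\<close>)
qed simp

context wiretap
begin

definition noise_sd :: real where "noise_sd = sqrt (\<sigma>2\<^sup>2 - \<sigma>1\<^sup>2)"

text \<open>The difference of the two noise precisions; half of it is the coefficient of the
  quadratic part of g.\<close>

definition \<tau> :: real where "\<tau> = 1 / \<sigma>1\<^sup>2 - 1 / \<sigma>2\<^sup>2"

lemma square_less: "\<sigma>1\<^sup>2 < \<sigma>2\<^sup>2" using \<sigma>1_pos \<sigma>1_less by (intro power_strict_mono) auto

lemma noise_sd_pos: "0 < noise_sd" and noise_sd_square: "noise_sd\<^sup>2 = \<sigma>2\<^sup>2 - \<sigma>1\<^sup>2"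
  using square_less by (simp_all add: noise_sd_def)

lemma sqrt_noise: "sqrt (\<sigma>1\<^sup>2 + noise_sd\<^sup>2) = \<sigma>2"
  using \<sigma>2_pos by (simp add: noise_sd_square)

lemma \<tau>_pos: "0 < \<tau>"
  using square_less \<sigma>1_pos by (simp add: \<tau>_def frac_less2)

definition smoothed_lmg :: "real \<Rightarrow> real" where
  "smoothed_lmg y = (\<integral>t. normal_density y noise_sd t * lmg \<sigma>2 t \<partial>lborel)"

lemma smoothed_lmg_translate: "smoothed_lmg y = (\<integral>z. normal_density 0 noise_sd z * lmg \<sigma>2 (y + z) \<partial>lborel)"
  unfolding smoothed_lmg_def by (rule integral_normal_translate[symmetric])

lemma g_fun_split:
  "g_fun \<sigma>1 \<sigma>2 P y = (\<integral>t. normal_density y noise_sd t * ln (out_density \<sigma>2 P t) \<partial>lborel) - ln (out_density \<sigma>1 P y)"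
proof -
  have "g_fun \<sigma>1 \<sigma>2 P y = (\<integral>z. normal_density 0 noise_sd z * ln (out_density \<sigma>2 P (y + z))
      - ln (out_density \<sigma>1 P y) * normal_density 0 noise_sd z \<partial>lborel)"
    unfolding g_fun_def noise_sd_def[symmetric]
  proof (intro Bochner_Integration.integral_cong refl)
    fix z
    have "ln (out_density \<sigma>2 P (y + z) / out_density \<sigma>1 P y) = ln (out_density \<sigma>2 P (y + z)) - ln (out_density \<sigma>1 P y)"
      using out_density_pos[OF \<sigma>1_pos, of y] out_density_pos[OF \<sigma>2_pos, of "y + z"] by (simp add: ln_div)
    then show "normal_density 0 noise_sd z * ln (out_density \<sigma>2 P (y + z) / out_density \<sigma>1 P y)
      = normal_density 0 noise_sd z * ln (out_density \<sigma>2 P (y + z)) - ln (out_density \<sigma>1 P y) * normal_density 0 noise_sd z"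
      by (simp only: right_diff_distrib mult.commute[of "ln (out_density \<sigma>1 P y)"])
  qed
  also have "\<dots> = (\<integral>z. normal_density 0 noise_sd z * ln (out_density \<sigma>2 P (y + z)) \<partial>lborel) - ln (out_density \<sigma>1 P y)"
    using integrable_normal_quad_growth[OF noise_sd_pos quad_growth_shift[OF ln_out_density_quad_growth[OF \<sigma>2_pos]], of 0 y]
      noise_sd_pos by simp
  finally show ?thesis
    using integral_normal_translate[of noise_sd "\<lambda>t. ln (out_density \<sigma>2 P t)" y] by simp
qed

text \<open>Separates the explicit quadratic, which comes from the Gaussian factors of the
  densities, from two terms whose slopes are bounded by R / \<sigma>2^2 and R / \<sigma>1^2.\<close>

lemma g_fun_eq:
  "g_fun \<sigma>1 \<sigma>2 P y = \<tau> / 2 * y\<^sup>2 - noise_sd\<^sup>2 / (2 * \<sigma>2\<^sup>2) - ln (\<sigma>2 / \<sigma>1) + smoothed_lmg y - lmg \<sigma>1 y"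
proof -
  define s where "s = 1 / (2 * \<sigma>2\<^sup>2)"
  define c where "c = ln (sqrt (2 * pi * \<sigma>2\<^sup>2))"
  have "(\<integral>t. normal_density y noise_sd t * ln (out_density \<sigma>2 P t) \<partial>lborel)
     = (\<integral>t. normal_density y noise_sd t * lmg \<sigma>2 t - s * (normal_density y noise_sd t * t\<^sup>2) - c * normal_density y noise_sd t \<partial>lborel)"
    unfolding ln_out_density[OF \<sigma>2_pos] s_def c_def
    by (intro Bochner_Integration.integral_cong refl) (simp add: right_diff_distrib)
  also have "\<dots> = smoothed_lmg y - s * (noise_sd\<^sup>2 + y\<^sup>2) - c"
    using integrable_normal_quad_growth[OF noise_sd_pos lmg_quad_growth[OF \<sigma>2_pos], of y]
      integrable_normal_square[OF noise_sd_pos, of y] integral_normal_square[OF noise_sd_pos, of y] noise_sd_pos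
    by (simp add: smoothed_lmg_def)
  finally have "g_fun \<sigma>1 \<sigma>2 P y = smoothed_lmg y - s * (noise_sd\<^sup>2 + y\<^sup>2) - c
     - (lmg \<sigma>1 y - y\<^sup>2 / (2 * \<sigma>1\<^sup>2) - ln (sqrt (2 * pi * \<sigma>1\<^sup>2)))"
    unfolding g_fun_split ln_out_density[OF \<sigma>1_pos] by simp
  moreover have "c - ln (sqrt (2 * pi * \<sigma>1\<^sup>2)) = ln (\<sigma>2 / \<sigma>1)"
    using \<sigma>1_pos \<sigma>2_pos by (simp add: c_def real_sqrt_mult ln_mult ln_div)
  moreover have "y\<^sup>2 / (2 * \<sigma>1\<^sup>2) - s * y\<^sup>2 = \<tau> / 2 * y\<^sup>2"
    by (simp add: \<tau>_def s_def field_simps)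
  moreover have "s * (noise_sd\<^sup>2 + y\<^sup>2) = noise_sd\<^sup>2 / (2 * \<sigma>2\<^sup>2) + s * y\<^sup>2"
    by (simp add: s_def add_divide_distrib)
  ultimately show ?thesis by linarith
qed

definition csmoothed :: "complex \<Rightarrow> complex" where
  "csmoothed = gauss_transform noise_sd (lmg \<sigma>2)"

lemma csmoothed_of_real: "csmoothed (of_real y) = of_real (smoothed_lmg y)"
  unfolding csmoothed_def smoothed_lmg_def by (rule gauss_transform_of_real[OF noise_sd_pos])

lemma csmoothed_holomorphic: "csmoothed holomorphic_on A"
  unfolding csmoothed_def by (rule gauss_transform_holomorphic[OF noise_sd_pos lmg_quad_growth[OF \<sigma>2_pos]])

lemma smoothed_lmg_derivative:
  "(smoothed_lmg has_real_derivative Re (deriv csmoothed (of_real y))) (at y)"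
  "deriv csmoothed (of_real y) = of_real (Re (deriv csmoothed (of_real y)))"
  using deriv_of_real_holomorphic[OF csmoothed_holomorphic[of UNIV] open_UNIV UNIV_I csmoothed_of_real] by auto

lemma mg_derivative:
  "(mg \<sigma>1 has_real_derivative Re (deriv (cmg \<sigma>1) (of_real y))) (at y)"
  "deriv (cmg \<sigma>1) (of_real y) = of_real (Re (deriv (cmg \<sigma>1) (of_real y)))"
  using deriv_of_real_holomorphic[OF cmg_holomorphic[OF \<sigma>1_pos, of UNIV] open_UNIV UNIV_I cmg_of_real] by auto

text \<open>The derivative of g is \<open>slope\<close>; clearing its only denominator \<open>mg \<sigma>1\<close>, which is positive on the real
line, leaves an entire function.\<close>

definition slope_numerator :: "complex \<Rightarrow> complex" where
  "slope_numerator \<zeta> = (deriv csmoothed \<zeta> + of_real \<tau> * \<zeta>) * cmg \<sigma>1 \<zeta> - deriv (cmg \<sigma>1) \<zeta>"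

definition slope :: "real \<Rightarrow> real" where
  "slope y = Re (deriv csmoothed (of_real y)) + \<tau> * y - Re (deriv (cmg \<sigma>1) (of_real y)) / mg \<sigma>1 y"

lemma slope_numerator_holomorphic: "slope_numerator holomorphic_on UNIV"
  unfolding slope_numerator_def[abs_def]
  by (intro holomorphic_intros holomorphic_deriv csmoothed_holomorphic cmg_holomorphic \<sigma>1_pos) auto

lemma slope_numerator_of_real: "slope_numerator (of_real y) = of_real (slope y * mg \<sigma>1 y)"
proof -
  have "slope_numerator (of_real y) = (of_real (Re (deriv csmoothed (of_real y))) + of_real \<tau> * of_real y) * of_real (mg \<sigma>1 y)
    - of_real (Re (deriv (cmg \<sigma>1) (of_real y)))"
    unfolding slope_numerator_def cmg_of_real using smoothed_lmg_derivative(2)[of y] mg_derivative(2)[of y] by simp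
  also have "\<dots> = of_real (slope y * mg \<sigma>1 y)"
    unfolding slope_def using mg_pos[of \<sigma>1 y] by (simp add: algebra_simps)
  finally show ?thesis .
qed

lemma lmg_derivative: "(lmg \<sigma>1 has_real_derivative Re (deriv (cmg \<sigma>1) (of_real y)) / mg \<sigma>1 y) (at y)"
  using DERIV_chain2[OF DERIV_ln_divide[OF mg_pos[of \<sigma>1 y]] mg_derivative(1)[of y]] by simp

lemma g_fun_derivative: "((\<lambda>y. g_fun \<sigma>1 \<sigma>2 P y + c) has_real_derivative slope y) (at y)"
  unfolding g_fun_eq slope_def
  by (rule derivative_eq_intros lmg_derivative smoothed_lmg_derivative(1) refl | simp)+

text \<open>The quotient of \<open>slope_numerator\<close> by \<open>cmg \<sigma>1\<close> is
  holomorphic off the zeros of the denominator, an open set containing the real line.\<close>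

lemma slope_smooth: "((deriv ^^ k) slope has_real_derivative (deriv ^^ Suc k) slope x) (at x)"
proof (rule higher_deriv_of_real_part(2))
  define U where "U = {\<zeta>. cmg \<sigma>1 \<zeta> \<noteq> 0}"
  have "open (- (cmg \<sigma>1 -` {0}))"
    using holomorphic_on_imp_continuous_on[OF cmg_holomorphic[OF \<sigma>1_pos, of UNIV]]
    by (intro open_Compl closed_vimage) auto
  then show "open U" by (simp add: U_def vimage_def Compl_eq)
  show "(\<lambda>\<zeta>. slope_numerator \<zeta> / cmg \<sigma>1 \<zeta>) holomorphic_on U"
    using holomorphic_on_subset[OF slope_numerator_holomorphic, of U]
    by (intro holomorphic_on_divide cmg_holomorphic \<sigma>1_pos) (auto simp: U_def)
  show "of_real x \<in> U" for x using mg_pos[of \<sigma>1 x] by (simp add: U_def cmg_of_real)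
  show "slope x = Re (slope_numerator (of_real x) / cmg \<sigma>1 (of_real x))" for x
    using mg_pos[of \<sigma>1 x] by (simp add: slope_numerator_of_real cmg_of_real)
qed

lemma g_fun_smooth:
  "((deriv ^^ k) (\<lambda>y. g_fun \<sigma>1 \<sigma>2 P y + c) has_real_derivative (deriv ^^ Suc k) (\<lambda>y. g_fun \<sigma>1 \<sigma>2 P y + c) x) (at x)"
proof -
  have d: "deriv (\<lambda>y. g_fun \<sigma>1 \<sigma>2 P y + c) = slope"
    using DERIV_imp_deriv[OF g_fun_derivative] by auto
  show ?thesis
  proof (cases k)
    case 0
    then show ?thesis using g_fun_derivative[of c x] by (simp add: d)
  next
    case (Suc j)
    then show ?thesis
      using slope_smooth[of j x] by (simp add: funpow_Suc_right d del: funpow.simps)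
  qed
qed

lemma slope_num_zeros_bound:
  fixes p \<rho> M c :: real
  assumes p: "slope p \<noteq> 0" and \<rho>: "0 < \<rho>"
    and loc: "\<And>x. x \<in> {a..b} \<Longrightarrow> slope x = 0 \<Longrightarrow> \<bar>x - p\<bar> \<le> \<rho>"
    and M: "\<And>z. norm (z - of_real p) = (exp 1 + 1) * \<rho> \<Longrightarrow> norm (slope_numerator z) \<le> M"
  shows "\<exists>n. num_zeros {a..b} (\<lambda>y. g_fun \<sigma>1 \<sigma>2 P y + c) = enat n \<and>
    real n \<le> 1 + ln (M / (\<bar>slope p\<bar> * mg \<sigma>1 p))"
proof -
  have d: "deriv (\<lambda>y. g_fun \<sigma>1 \<sigma>2 P y + c) = slope"
    using DERIV_imp_deriv[OF g_fun_derivative] by auto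
  have "\<exists>n. num_zeros {a..b} (\<lambda>y. g_fun \<sigma>1 \<sigma>2 P y + c) = enat n \<and>
    real n \<le> 1 + ln (M / norm (slope_numerator (of_real p)))"
  proof (rule num_zeros_bound[where h = "mg \<sigma>1" and \<rho> = \<rho>])
    show "isCont (mg \<sigma>1) x" for x
      using mg_derivative(1) by (rule DERIV_isCont)
    show "slope_numerator (of_real p) \<noteq> 0"
      using p mg_pos[of \<sigma>1 p] by (simp add: slope_numerator_of_real)
  qed (use g_fun_smooth slope_numerator_holomorphic slope_numerator_of_real loc \<rho> M in \<open>simp_all add: d\<close>)
  then show ?thesis using mg_pos[of \<sigma>1 p] by (simp add: slope_numerator_of_real abs_mult norm_mult)
qed

text \<open>A lower bound on difference quotients may fail for some shifts z by a multiple of z^2;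
  averaging turns this allowance into the noise variance. Using quotients keeps differentiation
  outside the average.\<close>

lemma smoothed_lmg_increment:
  assumes t: "y < t" and le: "\<And>z. \<kappa> - c * z\<^sup>2 \<le> (lmg \<sigma>2 (t + z) - lmg \<sigma>2 (y + z)) / (t - y)"
  shows "(\<kappa> - c * noise_sd\<^sup>2) * (t - y) \<le> smoothed_lmg t - smoothed_lmg y"
proof -
  have q: "quad_growth (\<lambda>z. lmg \<sigma>2 (t + z))" "quad_growth (\<lambda>z. lmg \<sigma>2 (y + z))"
    by (intro quad_growth_shift lmg_quad_growth \<sigma>2_pos)+
  have "- (smoothed_lmg t - smoothed_lmg y) = (\<integral>z. normal_density 0 noise_sd z * (lmg \<sigma>2 (y + z) - lmg \<sigma>2 (t + z)) \<partial>lborel)"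
    unfolding smoothed_lmg_translate right_diff_distrib
    using integrable_normal_quad_growth[OF noise_sd_pos q(1), of 0] integrable_normal_quad_growth[OF noise_sd_pos q(2), of 0]
    by simp
  also have "\<dots> \<le> - (\<kappa> * (t - y)) + (c * (t - y)) * (noise_sd\<^sup>2 + 0\<^sup>2)"
  proof (rule integral_normal_quad_le[OF noise_sd_pos quad_growth_diff[OF q(2,1)]])
    fix z
    have "(\<kappa> - c * z\<^sup>2) * (t - y) \<le> lmg \<sigma>2 (t + z) - lmg \<sigma>2 (y + z)"
      using le[of z] t by (simp add: pos_le_divide_eq)
    then show "lmg \<sigma>2 (y + z) - lmg \<sigma>2 (t + z) \<le> - (\<kappa> * (t - y)) + (c * (t - y)) * z\<^sup>2"
      by (simp add: algebra_simps)
  qed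
  finally show ?thesis by (simp add: algebra_simps)
qed

lemma slope_ge:
  assumes "\<And>t z. y < t \<Longrightarrow> \<kappa> - c * z\<^sup>2 \<le> (lmg \<sigma>2 (t + z) - lmg \<sigma>2 (y + z)) / (t - y)"
  shows "\<tau> * y + (\<kappa> - c * noise_sd\<^sup>2) - R / \<sigma>1\<^sup>2 \<le> slope y"
proof -
  have "\<kappa> - c * noise_sd\<^sup>2 \<le> Re (deriv csmoothed (of_real y))"
    by (rule has_real_derivative_ge[OF smoothed_lmg_derivative(1)])
      (use smoothed_lmg_increment assms in blast)
  moreover have "- R / \<sigma>1\<^sup>2 \<le> - (Re (deriv (cmg \<sigma>1) (of_real y)) / mg \<sigma>1 y)"
  proof (rule has_real_derivative_ge[OF DERIV_minus[OF lmg_derivative]])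
    fix t assume "y < t"
    then show "- R / \<sigma>1\<^sup>2 * (t - y) \<le> - lmg \<sigma>1 t - - lmg \<sigma>1 y"
      using lmg_increment[OF \<sigma>1_pos, of y t] by linarith
  qed
  ultimately show ?thesis by (simp add: slope_def)
qed

lemma lmg_difference_quotient:
  assumes "0 < \<sigma>" "y < t"
  shows "- R / \<sigma>\<^sup>2 \<le> (lmg \<sigma> (t + z) - lmg \<sigma> (y + z)) / (t - y)"
proof -
  have "- R / \<sigma>\<^sup>2 * (t - y) \<le> lmg \<sigma> (t + z) - lmg \<sigma> (y + z)"
    using lmg_increment[OF assms(1), of "y + z" "t + z"] assms(2) by (simp add: abs_le_iff)
  then show ?thesis using assms(2) by (simp only: pos_le_divide_eq diff_gt_0_iff_gt)
qed

text \<open>Both logarithms are charged with their extreme slopes. The result is crude, but it shows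
  that \<open>slope\<close> is not identically zero, hence finiteness of the zero count for every
  R.\<close>

lemma slope_lower: "\<tau> * y - R / \<sigma>2\<^sup>2 - R / \<sigma>1\<^sup>2 \<le> slope y"
  using slope_ge[of y "- R / \<sigma>2\<^sup>2" 0] lmg_difference_quotient[OF \<sigma>2_pos] by simp

lemma finite_num_zeros: "\<exists>n. num_zeros {a..b} (\<lambda>y. g_fun \<sigma>1 \<sigma>2 P y + c) = enat n"
proof -
  \<comment> \<open>Chosen so that the bound of \<open>slope_lower\<close> equals 1 at
    \<open>p\<close>; the radius then only has to cover the given interval, and compactness supplies
    \<open>M\<close>.\<close>
  define p where "p = (R / \<sigma>2\<^sup>2 + R / \<sigma>1\<^sup>2 + 1) / \<tau>"
  have p: "slope p \<noteq> 0" using slope_lower[of p] \<tau>_pos by (simp add: p_def)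
  define \<rho> where "\<rho> = \<bar>a\<bar> + \<bar>b\<bar> + \<bar>p\<bar> + 1"
  have "continuous_on (sphere (of_real p) ((exp 1 + 1) * \<rho>)) slope_numerator"
    using holomorphic_on_imp_continuous_on[OF slope_numerator_holomorphic] continuous_on_subset by blast
  then have "compact (slope_numerator ` sphere (of_real p) ((exp 1 + 1) * \<rho>))"
    by (intro compact_continuous_image) auto
  then obtain M where M: "\<And>z. z \<in> sphere (of_real p) ((exp 1 + 1) * \<rho>) \<Longrightarrow> norm (slope_numerator z) \<le> M"
    by (meson bounded_iff compact_imp_bounded imageI)
  have "\<exists>n. num_zeros {a..b} (\<lambda>y. g_fun \<sigma>1 \<sigma>2 P y + c) = enat n \<and>
    real n \<le> 1 + ln (M / (\<bar>slope p\<bar> * mg \<sigma>1 p))"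
    by (rule slope_num_zeros_bound[OF p, of \<rho>])
      (auto simp: \<rho>_def intro!: M simp: dist_norm norm_minus_commute)
  then show ?thesis by blast
qed

end

section \<open>The support of an optimal input\<close>

context wiretap
begin

lemma smoothed_lmg_quad_growth: "quad_growth smoothed_lmg"
proof -
  obtain a b where ab: "0 \<le> a" "0 \<le> b" "\<And>t. \<bar>lmg \<sigma>2 t\<bar> \<le> a + b * t\<^sup>2"
    using quad_growth_bound[OF lmg_quad_growth[OF \<sigma>2_pos]] by blast
  show ?thesis
  proof (rule quad_growthI)
    have "continuous_on UNIV smoothed_lmg"
      using smoothed_lmg_derivative(1) by (intro DERIV_continuous_on) (auto intro: has_field_derivative_at_within)
    then show "smoothed_lmg \<in> borel_measurable borel" by (rule borel_measurable_continuous_onI)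
    show "\<bar>smoothed_lmg y\<bar> \<le> (a + b * noise_sd\<^sup>2) + b * y\<^sup>2" for y
      using integral_normal_quad_abs_le[OF noise_sd_pos lmg_quad_growth[OF \<sigma>2_pos] ab(3), of y]
      by (simp add: smoothed_lmg_def algebra_simps)
  qed
qed

lemma g_fun_quad_growth: "quad_growth (g_fun \<sigma>1 \<sigma>2 P)"
  unfolding g_fun_eq[abs_def]
  by (intro quad_growth_add quad_growth_diff quad_growth_cmult quad_growth_square quad_growth_const
      smoothed_lmg_quad_growth lmg_quad_growth \<sigma>1_pos)

text \<open>Splitting the Gaussian of variance \<sigma>2^2 into independent parts of variances
  \<sigma>1^2 and \<sigma>2^2 - \<sigma>1^2 leaves the inner average that occurs in g.\<close>

lemma cross_entropy_difference:
  "cross_entropy \<sigma>2 x - cross_entropy \<sigma>1 x = (\<integral>y. normal_density x \<sigma>1 y * g_fun \<sigma>1 \<sigma>2 P y \<partial>lborel)"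
proof -
  define A where "A y = (\<integral>t. normal_density y noise_sd t * ln (out_density \<sigma>2 P t) \<partial>lborel)" for y
  have A: "A y = g_fun \<sigma>1 \<sigma>2 P y + ln (out_density \<sigma>1 P y)" for y
    by (simp add: g_fun_split A_def)
  have qA: "quad_growth A"
    unfolding A[abs_def] by (intro quad_growth_add g_fun_quad_growth ln_out_density_quad_growth \<sigma>1_pos)
  have "cross_entropy \<sigma>2 x = (\<integral>y. normal_density x \<sigma>1 y * A y \<partial>lborel)"
    unfolding A_def cross_entropy_def
    using normal_density_convolution[OF \<sigma>1_pos noise_sd_pos ln_out_density_quad_growth[OF \<sigma>2_pos], of x]
    by (simp add: sqrt_noise)
  moreover have "(\<integral>y. normal_density x \<sigma>1 y * g_fun \<sigma>1 \<sigma>2 P y \<partial>lborel)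
      = (\<integral>y. normal_density x \<sigma>1 y * A y - normal_density x \<sigma>1 y * ln (out_density \<sigma>1 P y) \<partial>lborel)"
    unfolding A by (simp add: distrib_left)
  ultimately show ?thesis
    using integrable_normal_quad_growth[OF \<sigma>1_pos qA, of x]
      integrable_normal_quad_growth[OF \<sigma>1_pos ln_out_density_quad_growth[OF \<sigma>1_pos], of x]
    by (simp add: cross_entropy_def)
qed

lemma neg_entropy_difference:
  "neg_entropy \<sigma>2 - neg_entropy \<sigma>1 = (\<integral>y. out_density \<sigma>1 P y * g_fun \<sigma>1 \<sigma>2 P y \<partial>lborel)"
proof -
  have "neg_entropy \<sigma>2 - neg_entropy \<sigma>1 = (\<integral>x. cross_entropy \<sigma>2 x - cross_entropy \<sigma>1 x \<partial>P)"
    using integral_cross_entropy[OF \<sigma>1_pos] integral_cross_entropy[OF \<sigma>2_pos] by simp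
  then show ?thesis
    unfolding cross_entropy_difference integrable_out_density_and_fubini(3)[OF \<sigma>1_pos g_fun_quad_growth] .
qed

text \<open>Additional noise increases entropy. By ln u \<le> u - 1 the difference is at most the
  mass of \<open>k\<close> minus the mass of the first output density, and both are one. It makes
  the constant added to g nonnegative, so at admissible points the average of g itself is at most
  0.\<close>

lemma neg_entropy_mono: "neg_entropy \<sigma>2 \<le> neg_entropy \<sigma>1"
proof -
  define k where "k y = (\<integral>t. normal_density y noise_sd t * out_density \<sigma>2 P t \<partial>lborel)" for y
  have [measurable]: "out_density \<sigma>2 P \<in> borel_measurable borel"
    by (rule out_density_measurable[OF \<sigma>2_pos])
  have nonneg: "0 \<le> out_density \<sigma>2 P t" for t using out_density_pos[OF \<sigma>2_pos, of t] by simp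
  have f2: "quad_growth (out_density \<sigma>2 P)"
    by (rule quad_growthI[where b = 0 and a = "1 / sqrt (2 * pi * \<sigma>2\<^sup>2)"])
      (use out_density_le[OF \<sigma>2_pos] nonneg in auto)
  have k_int: "integrable lborel k" "(\<integral>y. k y \<partial>lborel) = 1"
  proof -
    have [measurable]: "(\<lambda>(y, t). normal_density y noise_sd t) \<in> borel_measurable (borel \<Otimes>\<^sub>M borel)"
      unfolding normal_density_def by measurable
    have "(\<integral>\<^sup>+y. ennreal (k y) \<partial>lborel)
        = (\<integral>\<^sup>+y. \<integral>\<^sup>+t. ennreal (normal_density y noise_sd t * out_density \<sigma>2 P t) \<partial>lborel \<partial>lborel)"
      unfolding k_def using nonneg
      by (subst nn_integral_eq_integral[OF integrable_normal_quad_growth[OF noise_sd_pos f2]]) auto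
    also have "\<dots> = (\<integral>\<^sup>+t. \<integral>\<^sup>+y. ennreal (normal_density y noise_sd t * out_density \<sigma>2 P t) \<partial>lborel \<partial>lborel)"
      by (rule lborel_pair.Fubini') measurable
    also have "\<dots> = (\<integral>\<^sup>+t. ennreal (out_density \<sigma>2 P t) \<partial>lborel)"
    proof (rule nn_integral_cong)
      fix t
      have "(\<integral>\<^sup>+y. ennreal (normal_density y noise_sd t * out_density \<sigma>2 P t) \<partial>lborel)
        = ennreal (\<integral>y. normal_density t noise_sd y * out_density \<sigma>2 P t \<partial>lborel)"
        unfolding normal_density_commute[of _ noise_sd t] using nonneg noise_sd_pos
        by (intro nn_integral_eq_integral integrable_mult_left integrable_normal_density) auto
      then show "(\<integral>\<^sup>+y. ennreal (normal_density y noise_sd t * out_density \<sigma>2 P t) \<partial>lborel) = ennreal (out_density \<sigma>2 P t)"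
        using noise_sd_pos by simp
    qed
    also have "\<dots> = 1"
      using nn_integral_eq_integral[OF integral_out_density(1)[OF \<sigma>2_pos]] nonneg integral_out_density(2)[OF \<sigma>2_pos] by simp
    finally have nn: "(\<integral>\<^sup>+y. ennreal (k y) \<partial>lborel) = ennreal 1" by simp
    have [measurable]: "k \<in> borel_measurable borel"
      unfolding k_def using lborel.borel_measurable_lebesgue_integral[of "\<lambda>y t. normal_density y noise_sd t * out_density \<sigma>2 P t" lborel] by simp
    have k0: "0 \<le> k y" for y unfolding k_def using nonneg by (intro Bochner_Integration.integral_nonneg) auto
    show "integrable lborel k"
      by (rule integrableI_nn_integral_finite[OF _ _ nn]) (use k0 in auto)
    show "(\<integral>y. k y \<partial>lborel) = 1"
      using k0 nn by (intro integral_eq_nn_integral[THEN trans]) auto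
  qed
  have "neg_entropy \<sigma>2 - neg_entropy \<sigma>1 \<le> (\<integral>y. k y - out_density \<sigma>1 P y \<partial>lborel)"
    unfolding neg_entropy_difference
  proof (rule integral_mono)
    show "integrable lborel (\<lambda>y. out_density \<sigma>1 P y * g_fun \<sigma>1 \<sigma>2 P y)"
      by (rule integrable_out_density_and_fubini(1)[OF \<sigma>1_pos g_fun_quad_growth])
    show "integrable lborel (\<lambda>y. k y - out_density \<sigma>1 P y)"
      using k_int integral_out_density[OF \<sigma>1_pos] by auto
    fix y
    note pos = out_density_pos[OF \<sigma>1_pos, of y]
    have "g_fun \<sigma>1 \<sigma>2 P y = (\<integral>t. normal_density y noise_sd t * (ln (out_density \<sigma>2 P t) - ln (out_density \<sigma>1 P y)) \<partial>lborel)"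
      unfolding g_fun_split right_diff_distrib
      using integrable_normal_quad_growth[OF noise_sd_pos ln_out_density_quad_growth[OF \<sigma>2_pos], of y] noise_sd_pos by simp
    also have "\<dots> \<le> (\<integral>t. normal_density y noise_sd t * (1 / out_density \<sigma>1 P y * out_density \<sigma>2 P t - 1) \<partial>lborel)"
    proof (rule integral_mono)
      fix t
      have "ln (out_density \<sigma>2 P t / out_density \<sigma>1 P y) \<le> out_density \<sigma>2 P t / out_density \<sigma>1 P y - 1"
        using pos out_density_pos[OF \<sigma>2_pos, of t] by (intro ln_le_minus_one) auto
      then show "normal_density y noise_sd t * (ln (out_density \<sigma>2 P t) - ln (out_density \<sigma>1 P y))
         \<le> normal_density y noise_sd t * (1 / out_density \<sigma>1 P y * out_density \<sigma>2 P t - 1)"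
        using pos out_density_pos[OF \<sigma>2_pos, of t] by (intro mult_left_mono) (auto simp: ln_div)
    qed (intro integrable_normal_quad_growth noise_sd_pos quad_growth_diff quad_growth_cmult f2 quad_growth_const
        ln_out_density_quad_growth \<sigma>2_pos)+
    also have "\<dots> = (\<integral>t. 1 / out_density \<sigma>1 P y * (normal_density y noise_sd t * out_density \<sigma>2 P t) - normal_density y noise_sd t \<partial>lborel)"
      by (intro Bochner_Integration.integral_cong refl) (simp add: right_diff_distrib)
    also have "\<dots> = 1 / out_density \<sigma>1 P y * k y - 1"
      using integrable_normal_quad_growth[OF noise_sd_pos f2, of y] noise_sd_pos
      by (subst Bochner_Integration.integral_diff) (auto simp: k_def)
    finally have "out_density \<sigma>1 P y * g_fun \<sigma>1 \<sigma>2 P y \<le> out_density \<sigma>1 P y * (1 / out_density \<sigma>1 P y * k y - 1)"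
      using pos by (intro mult_left_mono) auto
    then show "out_density \<sigma>1 P y * g_fun \<sigma>1 \<sigma>2 P y \<le> k y - out_density \<sigma>1 P y"
      using pos by (simp add: algebra_simps)
  qed
  also have "\<dots> = 0" using k_int integral_out_density[OF \<sigma>1_pos] by simp
  finally show ?thesis by simp
qed

text \<open>The worst case on both sides: the first density is bounded as if all mass sat at the
  endpoint nearer to y, the smoothed logarithm of the second as if it sat at the farther
  one.\<close>

lemma g_fun_lower:
  assumes y: "R \<le> \<bar>y\<bar>"
  shows "(\<bar>y\<bar> - R)\<^sup>2 / (2 * \<sigma>1\<^sup>2) - (\<bar>y\<bar> + R)\<^sup>2 / (2 * \<sigma>2\<^sup>2) - noise_sd\<^sup>2 / (2 * \<sigma>2\<^sup>2) - ln (\<sigma>2 / \<sigma>1)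
    \<le> g_fun \<sigma>1 \<sigma>2 P y"
proof -
  obtain m where m: "\<bar>m\<bar> \<le> R" "\<And>t. (t * m - R\<^sup>2 / 2) / \<sigma>2\<^sup>2 \<le> lmg \<sigma>2 t"
    using lmg_lower[OF \<sigma>2_pos] by blast
  have "(y * m - R\<^sup>2 / 2) / \<sigma>2\<^sup>2 \<le> smoothed_lmg y"
  proof -
    have "(\<integral>t. m / \<sigma>2\<^sup>2 * (normal_density y noise_sd t * t) - R\<^sup>2 / 2 / \<sigma>2\<^sup>2 * normal_density y noise_sd t \<partial>lborel) \<le> smoothed_lmg y"
      unfolding smoothed_lmg_def
    proof (rule integral_mono)
      show "integrable lborel (\<lambda>t. m / \<sigma>2\<^sup>2 * (normal_density y noise_sd t * t) - R\<^sup>2 / 2 / \<sigma>2\<^sup>2 * normal_density y noise_sd t)"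
        by (intro Bochner_Integration.integrable_diff integrable_mult_right integrable_normal_moment_nz_1 integrable_normal_density noise_sd_pos)
      show "integrable lborel (\<lambda>t. normal_density y noise_sd t * lmg \<sigma>2 t)"
        by (rule integrable_normal_quad_growth[OF noise_sd_pos lmg_quad_growth[OF \<sigma>2_pos]])
      fix t
      have "m / \<sigma>2\<^sup>2 * (normal_density y noise_sd t * t) - R\<^sup>2 / 2 / \<sigma>2\<^sup>2 * normal_density y noise_sd t
         = normal_density y noise_sd t * ((t * m - R\<^sup>2 / 2) / \<sigma>2\<^sup>2)"
        by (simp add: diff_divide_distrib algebra_simps)
      also have "\<dots> \<le> normal_density y noise_sd t * lmg \<sigma>2 t" by (intro mult_left_mono m) simp
      finally show "m / \<sigma>2\<^sup>2 * (normal_density y noise_sd t * t) - R\<^sup>2 / 2 / \<sigma>2\<^sup>2 * normal_density y noise_sd t \<le> normal_density y noise_sd t * lmg \<sigma>2 t" .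
    qed
    moreover have "(\<integral>t. m / \<sigma>2\<^sup>2 * (normal_density y noise_sd t * t) - R\<^sup>2 / 2 / \<sigma>2\<^sup>2 * normal_density y noise_sd t \<partial>lborel)
       = (y * m - R\<^sup>2 / 2) / \<sigma>2\<^sup>2"
      using integrable_normal_moment_nz_1[OF noise_sd_pos, of y] integral_normal_moment_nz_1[OF noise_sd_pos, of y] noise_sd_pos
      by (simp add: diff_divide_distrib mult.commute)
    ultimately show ?thesis by simp
  qed
  moreover have "- (\<bar>y\<bar> * R) \<le> y * m"
  proof -
    have "\<bar>y * m\<bar> \<le> \<bar>y\<bar> * R" unfolding abs_mult using m by (intro mult_left_mono) auto
    then show ?thesis by linarith
  qed
  then have "(- (\<bar>y\<bar> * R) - R\<^sup>2 / 2) / \<sigma>2\<^sup>2 \<le> (y * m - R\<^sup>2 / 2) / \<sigma>2\<^sup>2" by (intro divide_right_mono) auto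
  moreover have "lmg \<sigma>1 y \<le> (R * \<bar>y\<bar> - R\<^sup>2 / 2) / \<sigma>1\<^sup>2" by (rule lmg_upper[OF \<sigma>1_pos y])
  moreover have "(\<bar>y\<bar> - R)\<^sup>2 / (2 * \<sigma>1\<^sup>2) - (\<bar>y\<bar> + R)\<^sup>2 / (2 * \<sigma>2\<^sup>2)
     = \<tau> / 2 * y\<^sup>2 + (- (\<bar>y\<bar> * R) - R\<^sup>2 / 2) / \<sigma>2\<^sup>2 - (R * \<bar>y\<bar> - R\<^sup>2 / 2) / \<sigma>1\<^sup>2"
  proof -
    have "(\<bar>y\<bar> - R)\<^sup>2 = y\<^sup>2 + R\<^sup>2 - 2 * \<bar>y\<bar> * R" "(\<bar>y\<bar> + R)\<^sup>2 = y\<^sup>2 + R\<^sup>2 + 2 * \<bar>y\<bar> * R"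
      by (simp_all add: power2_diff power2_sum)
    then show ?thesis by (simp add: \<tau>_def add_divide_distrib diff_divide_distrib) (simp add: field_simps)
  qed
  ultimately show ?thesis unfolding g_fun_eq by linarith
qed

end

section \<open>The shifted function \<open>gk\<close> and the support\<close>

context optimal_wiretap
begin

definition gk :: "real \<Rightarrow> real" where "gk y = g_fun \<sigma>1 \<sigma>2 P y + kappa1 \<sigma>1 \<sigma>2 R"

lemma kappa1_eq: "kappa1 \<sigma>1 \<sigma>2 R = neg_entropy \<sigma>1 - neg_entropy \<sigma>2"
  by (simp add: kappa1_def secrecy_capacity_eq secrecy_rate_eq)

lemma gk_quad_growth: "quad_growth gk"
  unfolding gk_def[abs_def] by (intro quad_growth_add g_fun_quad_growth quad_growth_const)

lemma integral_normal_gk: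
  "(\<integral>y. normal_density x \<sigma>1 y * gk y \<partial>lborel)
    = (cross_entropy \<sigma>2 x - cross_entropy \<sigma>1 x) - (neg_entropy \<sigma>2 - neg_entropy \<sigma>1)"
proof -
  have "(\<integral>y. normal_density x \<sigma>1 y * gk y \<partial>lborel)
     = (\<integral>y. normal_density x \<sigma>1 y * g_fun \<sigma>1 \<sigma>2 P y + kappa1 \<sigma>1 \<sigma>2 R * normal_density x \<sigma>1 y \<partial>lborel)"
    unfolding gk_def by (simp add: distrib_left mult.commute)
  then show ?thesis
    using integrable_normal_quad_growth[OF \<sigma>1_pos g_fun_quad_growth, of x] \<sigma>1_pos
    by (simp add: cross_entropy_difference kappa1_eq)
qed

lemma integral_normal_gk_le: "\<bar>x\<bar> \<le> R \<Longrightarrow> (\<integral>y. normal_density x \<sigma>1 y * gk y \<partial>lborel) \<le> 0"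
  unfolding integral_normal_gk using cross_entropy_difference_le[of x] by linarith

text \<open>The linear term of L is where the two squares of \<open>g_fun_lower\<close> balance.
  Beyond it by \<open>s\<close> they differ by at least \<open>\<tau> * s\<^sup>2\<close>, and the
  square root in L is the \<open>s\<close> at which this pays for the remaining constants.\<close>

lemma gk_pos_outside:
  assumes y: "L_bound \<sigma>1 \<sigma>2 R < \<bar>y\<bar>"
  shows "0 < gk y"
proof -
  define C where "C = secrecy_capacity \<sigma>1 \<sigma>2 R"
  define D where "D = \<sigma>2 - \<sigma>1"
  define N where "N = noise_sd\<^sup>2 / \<sigma>2\<^sup>2 + 2 * C"
  define s where "s = \<bar>y\<bar> - R * ((\<sigma>2 + \<sigma>1) / D)"
  have D: "0 < D" using \<sigma>1_less by (simp add: D_def)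
  have C: "0 \<le> C" unfolding C_def by (rule secrecy_capacity_nonneg)
  then have N: "0 \<le> N" by (simp add: N_def)
  have L: "L_bound \<sigma>1 \<sigma>2 R = R * ((\<sigma>2 + \<sigma>1) / D) + sqrt (N / \<tau>)"
    by (simp add: L_bound_def D_def N_def C_def \<tau>_def noise_sd_square)
  have s: "sqrt (N / \<tau>) < s" using y L by (simp add: s_def)
  have s0: "0 \<le> s" using s N \<tau>_pos by (meson divide_nonneg_pos less_eq_real_def order_trans real_sqrt_ge_zero)
  have "(sqrt (N / \<tau>))\<^sup>2 < s\<^sup>2" using s N \<tau>_pos by (intro power_strict_mono) auto
  then have Ns: "N < \<tau> * s\<^sup>2" using N \<tau>_pos by (simp add: field_simps)
  \<comment> \<open>The common value of both scaled distances at the balance point.\<close>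
  define E where "E = 2 * R / D"
  have dR: "(\<bar>y\<bar> - R) / \<sigma>1 = E + s / \<sigma>1" and sR: "(\<bar>y\<bar> + R) / \<sigma>2 = E + s / \<sigma>2"
  proof -
    have "R * ((\<sigma>2 + \<sigma>1) / D) = R + \<sigma>1 * E" "R * ((\<sigma>2 + \<sigma>1) / D) = \<sigma>2 * E - R"
      using D by (simp_all add: field_simps D_def E_def)
    then have "\<bar>y\<bar> - R = \<sigma>1 * E + s" "\<bar>y\<bar> + R = \<sigma>2 * E + s" unfolding s_def by simp_all
    then show "(\<bar>y\<bar> - R) / \<sigma>1 = E + s / \<sigma>1" "(\<bar>y\<bar> + R) / \<sigma>2 = E + s / \<sigma>2"
      using \<sigma>1_pos \<sigma>2_pos by (simp_all add: add_divide_distrib)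
  qed
  have yR: "R \<le> \<bar>y\<bar>"
  proof -
    have "0 \<le> E + s / \<sigma>1" using D R_nonneg s0 \<sigma>1_pos by (simp add: E_def)
    then show ?thesis unfolding dR[symmetric] using \<sigma>1_pos by (simp add: zero_le_divide_iff)
  qed
  have "((\<bar>y\<bar> - R) / \<sigma>1)\<^sup>2 - ((\<bar>y\<bar> + R) / \<sigma>2)\<^sup>2 = \<tau> * s\<^sup>2 + 2 * E * s * (1 / \<sigma>1 - 1 / \<sigma>2)"
    unfolding dR sR by (simp add: \<tau>_def power2_eq_square algebra_simps)
  moreover have "0 \<le> 2 * E * s * (1 / \<sigma>1 - 1 / \<sigma>2)"
    unfolding E_def using R_nonneg D s0 \<sigma>1_pos \<sigma>1_less by (intro mult_nonneg_nonneg) (auto simp: frac_le)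
  ultimately have "N < ((\<bar>y\<bar> - R) / \<sigma>1)\<^sup>2 - ((\<bar>y\<bar> + R) / \<sigma>2)\<^sup>2" using Ns by linarith
  then have "noise_sd\<^sup>2 / (2 * \<sigma>2\<^sup>2) + C < (\<bar>y\<bar> - R)\<^sup>2 / (2 * \<sigma>1\<^sup>2) - (\<bar>y\<bar> + R)\<^sup>2 / (2 * \<sigma>2\<^sup>2)"
    by (simp add: N_def power_divide field_simps)
  then show ?thesis
    using g_fun_lower[OF yR] by (simp add: gk_def kappa1_def C_def)
qed

text \<open>The average is at most 0 on the input range and has mean 0 under the input, so it
  vanishes almost everywhere; continuity extends this to every point of the support.\<close>

lemma integral_normal_gk_support:
  assumes x: "x \<in> dist_support P"
  shows "(\<integral>y. normal_density x \<sigma>1 y * gk y \<partial>lborel) = 0"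
proof -
  define \<Psi> where "\<Psi> x = (\<integral>y. normal_density x \<sigma>1 y * gk y \<partial>lborel)" for x
  have \<Psi>: "\<Psi> = (\<lambda>x. (cross_entropy \<sigma>2 x - cross_entropy \<sigma>1 x) - (neg_entropy \<sigma>2 - neg_entropy \<sigma>1))"
    unfolding \<Psi>_def integral_normal_gk ..
  have int: "integrable P \<Psi>" "(\<integral>x. \<Psi> x \<partial>P) = 0"
    unfolding \<Psi> using integral_cross_entropy[OF \<sigma>1_pos] integral_cross_entropy[OF \<sigma>2_pos] prob_space by simp_all
  have le: "AE x in P. 0 \<le> - \<Psi> x"
    using AE_abs_le by eventually_elim (use integral_normal_gk_le in \<open>simp add: \<Psi>_def\<close>)
  have "AE x in P. - \<Psi> x = 0"
    using int le by (subst integral_nonneg_eq_0_iff_AE[symmetric]) auto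
  then have AE0: "AE x in P. \<Psi> x = 0" by simp
  have cont: "continuous_on UNIV \<Psi>"
  proof -
    have "continuous_on UNIV (\<lambda>x. Re (gauss_transform \<sigma>1 gk (of_real x)))"
      by (rule continuous_on_Re, rule continuous_on_compose2[OF holomorphic_on_imp_continuous_on[OF
            gauss_transform_holomorphic[OF \<sigma>1_pos gk_quad_growth, of UNIV]]])
        (auto intro: continuous_on_of_real)
    then show ?thesis by (simp add: gauss_transform_of_real[OF \<sigma>1_pos] \<Psi>_def[abs_def])
  qed
  have "\<Psi> x = 0"
  proof (rule ccontr)
    assume "\<Psi> x \<noteq> 0"
    then have "x \<in> \<Psi> -` (- {0})" by simp
    moreover have "open (\<Psi> -` (- {0}))" using cont by (intro open_vimage) auto
    ultimately obtain e where e: "0 < e" "ball x e \<subseteq> \<Psi> -` (- {0})"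
      using openE by blast
    have "AE z in P. z \<notin> ball x e" using AE0 by eventually_elim (use e in auto)
    then have "emeasure P (ball x e) = 0"
      by (subst (asm) AE_iff_measurable[where N = "ball x e"]) (auto simp: sets_P)
    then show False using x e by (auto simp: dist_support_def)
  qed
  then show ?thesis by (simp add: \<Psi>_def)
qed

lemma zero_count_eq: "zero_count \<sigma>1 \<sigma>2 R P = num_zeros {- L_bound \<sigma>1 \<sigma>2 R..L_bound \<sigma>1 \<sigma>2 R} gk"
  unfolding zero_count_def gk_def[abs_def] ..

lemma support_card_le:
  "finite (dist_support P) \<and> enat (card (dist_support P)) \<le> zero_count \<sigma>1 \<sigma>2 R P \<and> zero_count \<sigma>1 \<sigma>2 R P < \<infinity>"
proof -
  define L where "L = L_bound \<sigma>1 \<sigma>2 R"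
  obtain n where n: "num_zeros {-L..L} gk = enat n"
    using finite_num_zeros[of "-L" L "kappa1 \<sigma>1 \<sigma>2 R"] unfolding gk_def[abs_def] by blast
  \<comment> \<open>Sign changes are counted on the whole line, so the zeros in the interval must be
    all zeros.\<close>
  have Z: "{y \<in> {-L..L}. gk y = 0} = {y. gk y = 0}"
  proof -
    have "y \<in> {-L..L}" if "gk y = 0" for y
      using gk_pos_outside[of y] that unfolding L_def by (cases "L_bound \<sigma>1 \<sigma>2 R < \<bar>y\<bar>") auto
    then show ?thesis by blast
  qed
  have fin: "finite {y. gk y = 0}" and card: "card {y. gk y = 0} \<le> n"
    using card_zeros_le_num_zeros[OF n] unfolding Z by auto
  have "continuous_on UNIV gk"
    unfolding gk_def[abs_def] using g_fun_derivative
    by (intro DERIV_continuous_on) (auto intro: has_field_derivative_at_within)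
  then obtain S \<epsilon> where S: "S \<subseteq> {y. gk y = 0}" "\<epsilon> \<noteq> 0" "\<And>y. 0 \<le> \<epsilon> * gk y * (\<Prod>a\<in>S. y - a)"
    using continuous_sign_changes[OF fin] by metis
  \<comment> \<open>Multiplication by a positive Gaussian keeps the sign pattern. The average of
    \<open>gk\<close> around x is a nonzero multiple of the transform of \<open>w\<close> at
    \<open>x / \<sigma>1\<^sup>2\<close>, so support points map injectively to its zeros.\<close>
  define w where "w y = exp (- y\<^sup>2 / (2 * \<sigma>1\<^sup>2)) * (\<epsilon> * gk y)" for y
  define c where "c x = exp (- x\<^sup>2 / (2 * \<sigma>1\<^sup>2)) / sqrt (2 * pi * \<sigma>1\<^sup>2)" for x
  have c: "c x \<noteq> 0" for x using \<sigma>1_pos by (simp add: c_def)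
  have lap: "\<epsilon> * (\<integral>y. normal_density x \<sigma>1 y * gk y \<partial>lborel) = c x * (\<integral>y. w y * exp (x / \<sigma>1\<^sup>2 * y) \<partial>lborel)" for x
    unfolding integral_mult_right_zero[symmetric] normal_density_eq_exp_linear[OF \<sigma>1_pos] c_def[symmetric] w_def
    by (intro Bochner_Integration.integral_cong refl) (simp add: mult_ac)
  define T where "T = {x. (\<integral>y. w y * exp (x * y) \<partial>lborel) = 0}"
  have T: "finite T \<and> card T \<le> card S"
    unfolding T_def
  proof (rule laplace_zeros_card_le)
    show "finite S" using S fin finite_subset by blast
    show "exp_integrable lborel w"
      unfolding w_def[abs_def] by (intro exp_integrable_gauss \<sigma>1_pos quad_growth_cmult gk_quad_growth)
    show "0 \<le> w y * (\<Prod>a\<in>S. y - a)" for y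
      using mult_nonneg_nonneg[OF _ S(3)[of y], of "exp (- y\<^sup>2 / (2 * \<sigma>1\<^sup>2))"] by (simp add: w_def mult_ac)
    show "\<not> (AE y in lborel. w y = 0)"
    proof
      assume "AE y in lborel. w y = 0"
      then have "AE y in lborel. y \<in> {y. gk y = 0}" by eventually_elim (use S in \<open>simp add: w_def\<close>)
      moreover have "AE y in lborel. y \<notin> {y. gk y = 0}"
        using fin by (intro AE_not_in) (simp add: finite_imp_null_set_lborel)
      ultimately have "AE y in (lborel :: real measure). False" by eventually_elim auto
      then have "emeasure lborel (UNIV :: real set) = 0"
        by (subst (asm) AE_iff_measurable[where N = UNIV]) auto
      then show False by simp
    qed
  qed
  have sub: "(\<lambda>x. x / \<sigma>1\<^sup>2) ` dist_support P \<subseteq> T"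
  proof
    fix u assume "u \<in> (\<lambda>x. x / \<sigma>1\<^sup>2) ` dist_support P"
    then obtain x where x: "x \<in> dist_support P" "u = x / \<sigma>1\<^sup>2" by blast
    show "u \<in> T"
      using integral_normal_gk_support[OF x(1)] lap[of x] c[of x] by (simp add: x(2) T_def)
  qed
  have inj: "inj_on (\<lambda>x. x / \<sigma>1\<^sup>2) (dist_support P)" using \<sigma>1_pos by (auto simp: inj_on_def)
  have "finite (dist_support P)" using inj_on_finite[OF inj sub] T by blast
  moreover have "card (dist_support P) \<le> n"
    using card_inj_on_le[OF inj sub] T card_mono[OF fin S(1)] card by linarith
  ultimately show ?thesis using n by (simp add: zero_count_eq L_def)
qed

end

section \<open>Localisation of the critical points of g\<close>

lemma exp_minus_one_le_half: "exp (-1) \<le> (1 / 2 :: real)"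
proof -
  have "2 \<le> exp (1 :: real)" using exp_ge_add_one_self[of 1] by simp
  then have "1 / exp (1 :: real) \<le> 1 / 2" by (intro frac_le) auto
  then show ?thesis by (simp add: exp_minus inverse_eq_divide)
qed

context bounded_input
begin

lemma mg_gauss:
  assumes \<sigma>: "0 < \<sigma>"
  shows "integrable P (\<lambda>x. exp (- (x - y)\<^sup>2 / (2 * \<sigma>\<^sup>2)))"
    and "(\<integral>x. exp (- (x - y)\<^sup>2 / (2 * \<sigma>\<^sup>2)) \<partial>P) = exp (- y\<^sup>2 / (2 * \<sigma>\<^sup>2)) * mg \<sigma> y"
proof -
  have "- (x - y)\<^sup>2 / (2 * \<sigma>\<^sup>2) = - y\<^sup>2 / (2 * \<sigma>\<^sup>2) + (- x\<^sup>2 / (2 * \<sigma>\<^sup>2) + y / \<sigma>\<^sup>2 * x)" for x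
    using \<sigma> by (simp add: field_simps power2_eq_square)
  then have eq: "exp (- (x - y)\<^sup>2 / (2 * \<sigma>\<^sup>2)) = exp (- y\<^sup>2 / (2 * \<sigma>\<^sup>2)) * (exp (- x\<^sup>2 / (2 * \<sigma>\<^sup>2)) * exp (y / \<sigma>\<^sup>2 * x))" for x
    by (simp only: exp_add)
  show "integrable P (\<lambda>x. exp (- (x - y)\<^sup>2 / (2 * \<sigma>\<^sup>2)))"
    unfolding eq by (intro integrable_mult_right mg_integrable)
  show "(\<integral>x. exp (- (x - y)\<^sup>2 / (2 * \<sigma>\<^sup>2)) \<partial>P) = exp (- y\<^sup>2 / (2 * \<sigma>\<^sup>2)) * mg \<sigma> y"
    unfolding eq mg_def by (rule integral_mult_right_zero)
qed

text \<open>Chord slopes of a convex function increase as both ends move right; the chord between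
  \<open>a\<close> and \<open>t\<close> links the two in question.\<close>

lemma lmg_slope_mono:
  assumes \<sigma>: "0 < \<sigma>" and "a < T" "T \<le> s" "s < t"
  shows "(lmg \<sigma> T - lmg \<sigma> a) / (T - a) \<le> (lmg \<sigma> t - lmg \<sigma> s) / (t - s)"
proof -
  note slope = convex_on_slope_le[OF lmg_convex[OF \<sigma>] UNIV_I UNIV_I]
  have 1: "(lmg \<sigma> T - lmg \<sigma> a) / (T - a) \<le> (lmg \<sigma> s - lmg \<sigma> a) / (s - a)"
  proof (cases "T = s")
    case False
    then have "(lmg \<sigma> a - lmg \<sigma> T) / (a - T) \<le> (lmg \<sigma> a - lmg \<sigma> s) / (a - s)"
      using assms by (intro slope(1)) auto
    then show ?thesis by (metis minus_diff_eq minus_divide_divide)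
  qed simp
  have "(lmg \<sigma> a - lmg \<sigma> s) / (a - s) \<le> (lmg \<sigma> a - lmg \<sigma> t) / (a - t)"
    "(lmg \<sigma> a - lmg \<sigma> t) / (a - t) \<le> (lmg \<sigma> s - lmg \<sigma> t) / (s - t)"
    using assms by (auto intro!: slope)
  with 1 show ?thesis by (smt (verit) minus_diff_eq minus_divide_divide)
qed

end

context wiretap
begin

text \<open>\<open>- K0\<close> is a lower bound for g, input points further than \<open>gap\<close> from R are negligible for the
first output density near R, and \<open>K1\<close>, \<open>K2\<close> are the resulting losses in the slopes. None of them depends on R
or on the input.\<close>

definition K0 :: real where "K0 = ln (\<sigma>2 / \<sigma>1) + 1 / 2"
definition gap :: real where "gap = 2 * \<sigma>1 + sqrt (2 * (2 * K0 + 1) / \<tau>)"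
definition K1 :: real where "K1 = 6 * gap + 4 * (2 * \<sigma>1\<^sup>2 + (1 + 2 * K0) * \<sigma>2\<^sup>2)"
definition K2 :: real where "K2 = K1 / \<sigma>2\<^sup>2 + 8 * noise_sd\<^sup>2 / \<sigma>2\<^sup>2"
text \<open>The sum of separate requirements on R: at least 1; at least 8 \<sigma>1, which keeps the
  window around R within R / 4 of it; at least \<open>K1\<close>; and large enough that
  \<open>\<tau> * R\<close> exceeds the slope loss \<open>K2\<close> by one.\<close>

definition large_radius :: real where "large_radius = 1 + 8 * \<sigma>1 + K1 + (K2 + 1) / \<tau>"

lemma K0_pos: "0 < K0"
  using \<sigma>1_pos \<sigma>1_less by (simp add: K0_def add_pos_pos ln_gt_zero)

lemma gap_pos: "0 < gap"
  using \<sigma>1_pos K0_pos \<tau>_pos unfolding gap_def by (intro add_pos_nonneg) auto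

lemma K1_pos: "0 < K1"
  using gap_pos K0_pos \<sigma>1_pos \<sigma>2_pos unfolding K1_def by (intro add_pos_nonneg mult_nonneg_nonneg add_nonneg_nonneg) auto

lemma K2_nonneg: "0 \<le> K2"
  using K1_pos unfolding K2_def by (intro add_nonneg_nonneg) auto

text \<open>The logarithm of the second output density over the first, both without their
  normalising constants; these constants account for the shift by ln (\<sigma>2 /
  \<sigma>1).\<close>

definition log_ratio :: "real \<Rightarrow> real" where
  "log_ratio y = lmg \<sigma>2 y - lmg \<sigma>1 y + \<tau> / 2 * y\<^sup>2"

text \<open>Jensen's inequality in symmetric form: pair z with -z and use midpoint
  convexity.\<close>

lemma smoothed_lmg_ge: "lmg \<sigma>2 y \<le> smoothed_lmg y"
proof -
  have q: "quad_growth (\<lambda>z. lmg \<sigma>2 (y + z))" "quad_growth (\<lambda>z. lmg \<sigma>2 (y - z))"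
    using quad_growth_shift[OF lmg_quad_growth[OF \<sigma>2_pos], of y]
      quad_growth_reflect[OF quad_growth_shift[OF lmg_quad_growth[OF \<sigma>2_pos], of y]] by simp_all
  note i = integrable_normal_quad_growth[OF noise_sd_pos q(1), of 0] integrable_normal_quad_growth[OF noise_sd_pos q(2), of 0]
  have "(\<integral>z. 2 * lmg \<sigma>2 y * normal_density 0 noise_sd z \<partial>lborel)
     \<le> (\<integral>z. normal_density 0 noise_sd z * lmg \<sigma>2 (y + z) + normal_density 0 noise_sd z * lmg \<sigma>2 (y - z) \<partial>lborel)"
  proof (rule integral_mono)
    show "integrable lborel (\<lambda>z. 2 * lmg \<sigma>2 y * normal_density 0 noise_sd z)"
      using noise_sd_pos by (intro integrable_mult_right integrable_normal_density)
    show "integrable lborel (\<lambda>z. normal_density 0 noise_sd z * lmg \<sigma>2 (y + z) + normal_density 0 noise_sd z * lmg \<sigma>2 (y - z))"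
      by (intro Bochner_Integration.integrable_add i)
    fix z
    have "2 * lmg \<sigma>2 y \<le> lmg \<sigma>2 (y + z) + lmg \<sigma>2 (y - z)"
      using convex_onD[OF lmg_convex[OF \<sigma>2_pos], of "1 / 2" "y - z" "y + z"] by (simp add: field_simps)
    then have "normal_density 0 noise_sd z * (2 * lmg \<sigma>2 y) \<le> normal_density 0 noise_sd z * (lmg \<sigma>2 (y + z) + lmg \<sigma>2 (y - z))"
      by (intro mult_left_mono) auto
    then show "2 * lmg \<sigma>2 y * normal_density 0 noise_sd z \<le> normal_density 0 noise_sd z * lmg \<sigma>2 (y + z) + normal_density 0 noise_sd z * lmg \<sigma>2 (y - z)"
      by (simp add: algebra_simps)
  qed
  also have "\<dots> = 2 * smoothed_lmg y"
    using i integral_normal_reflect[of noise_sd "lmg \<sigma>2" y] by (simp add: smoothed_lmg_translate)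
  finally show ?thesis using noise_sd_pos by simp
qed

lemma g_fun_ge_log_ratio: "log_ratio y - K0 \<le> g_fun \<sigma>1 \<sigma>2 P y"
proof -
  have "noise_sd\<^sup>2 / (2 * \<sigma>2\<^sup>2) \<le> 1 / 2"
    unfolding noise_sd_square using \<sigma>2_pos by (simp add: divide_le_eq)
  then show ?thesis
    using smoothed_lmg_ge[of y] by (simp add: g_fun_eq log_ratio_def K0_def)
qed

text \<open>An unnormalised Gaussian kernel increases with its variance, hence so does the mixture.
  Together with the previous lemma this gives the lower bound -\<open>K0\<close> for g.\<close>

lemma log_ratio_nonneg: "0 \<le> log_ratio y"
proof -
  have "exp (- y\<^sup>2 / (2 * \<sigma>1\<^sup>2)) * mg \<sigma>1 y \<le> exp (- y\<^sup>2 / (2 * \<sigma>2\<^sup>2)) * mg \<sigma>2 y"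
    unfolding mg_gauss(2)[OF \<sigma>1_pos, symmetric] mg_gauss(2)[OF \<sigma>2_pos, symmetric]
  proof (rule integral_mono[OF mg_gauss(1)[OF \<sigma>1_pos] mg_gauss(1)[OF \<sigma>2_pos]])
    fix x
    have "(x - y)\<^sup>2 / (2 * \<sigma>2\<^sup>2) \<le> (x - y)\<^sup>2 / (2 * \<sigma>1\<^sup>2)"
      using square_less \<sigma>1_pos \<sigma>2_pos \<sigma>1_less by (intro divide_left_mono) auto
    then show "exp (- (x - y)\<^sup>2 / (2 * \<sigma>1\<^sup>2)) \<le> exp (- (x - y)\<^sup>2 / (2 * \<sigma>2\<^sup>2))" by simp
  qed
  then have "ln (exp (- y\<^sup>2 / (2 * \<sigma>1\<^sup>2)) * mg \<sigma>1 y) \<le> ln (exp (- y\<^sup>2 / (2 * \<sigma>2\<^sup>2)) * mg \<sigma>2 y)"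
    using mg_pos by (subst ln_le_cancel_iff) auto
  then have "lmg \<sigma>1 y - y\<^sup>2 / (2 * \<sigma>1\<^sup>2) \<le> lmg \<sigma>2 y - y\<^sup>2 / (2 * \<sigma>2\<^sup>2)"
    using mg_pos[of \<sigma>1 y] mg_pos[of \<sigma>2 y] by (simp add: ln_mult)
  moreover have "y\<^sup>2 / (2 * \<sigma>1\<^sup>2) - y\<^sup>2 / (2 * \<sigma>2\<^sup>2) = \<tau> / 2 * y\<^sup>2" by (simp add: \<tau>_def field_simps)
  ultimately show ?thesis by (simp add: log_ratio_def)
qed

text \<open>A Chebyshev argument. If the ratio were large on the whole window, g would exceed
  \<open>K0\<close> there and be at least -\<open>K0\<close> elsewhere, so -g would lie below a
  parabola in z. With the window 2 \<sigma>1 that parabola reaches \<open>K0\<close> at the edge and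
  has Gaussian average -\<open>K0\<close> / 2, contrary to the hypothesis.\<close>

lemma log_ratio_small_near_boundary:
  assumes K: "(\<integral>y. normal_density R \<sigma>1 y * g_fun \<sigma>1 \<sigma>2 P y \<partial>lborel) \<le> 0"
  shows "\<exists>y. \<bar>y - R\<bar> \<le> 2 * \<sigma>1 \<and> log_ratio y \<le> 2 * K0"
proof (rule ccontr)
  assume "\<not> ?thesis"
  then have big: "2 * K0 < log_ratio y" if "\<bar>y - R\<bar> \<le> 2 * \<sigma>1" for y using that by (meson not_le)
  have "(\<integral>z. normal_density 0 \<sigma>1 z * (-1 * g_fun \<sigma>1 \<sigma>2 P (R + z)) \<partial>lborel)
     \<le> - K0 + K0 / (2 * \<sigma>1\<^sup>2) * (\<sigma>1\<^sup>2 + 0\<^sup>2)"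
  proof (rule integral_normal_quad_le[OF \<sigma>1_pos quad_growth_cmult[OF quad_growth_shift[OF g_fun_quad_growth]]])
    fix z
    show "-1 * g_fun \<sigma>1 \<sigma>2 P (R + z) \<le> - K0 + K0 / (2 * \<sigma>1\<^sup>2) * z\<^sup>2"
    proof (cases "\<bar>z\<bar> \<le> 2 * \<sigma>1")
      case True
      then have "K0 < g_fun \<sigma>1 \<sigma>2 P (R + z)" using big[of "R + z"] g_fun_ge_log_ratio[of "R + z"] by simp
      moreover have "0 \<le> K0 / (2 * \<sigma>1\<^sup>2) * z\<^sup>2" using K0_pos by simp
      ultimately show ?thesis by simp
    next
      case False
      then have "(2 * \<sigma>1)\<^sup>2 \<le> z\<^sup>2" using \<sigma>1_pos abs_le_square_iff[of "2 * \<sigma>1" z] by simp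
      then have "K0 / (2 * \<sigma>1\<^sup>2) * (2 * \<sigma>1)\<^sup>2 \<le> K0 / (2 * \<sigma>1\<^sup>2) * z\<^sup>2" using K0_pos by (intro mult_left_mono) auto
      then have "2 * K0 \<le> K0 / (2 * \<sigma>1\<^sup>2) * z\<^sup>2" using \<sigma>1_pos by (simp add: power_mult_distrib)
      moreover have "- K0 \<le> g_fun \<sigma>1 \<sigma>2 P (R + z)"
        using g_fun_ge_log_ratio[of "R + z"] log_ratio_nonneg[of "R + z"] by simp
      ultimately show ?thesis by simp
    qed
  qed
  also have "\<dots> = - K0 / 2" using \<sigma>1_pos by simp
  finally have "K0 / 2 \<le> (\<integral>z. normal_density 0 \<sigma>1 z * g_fun \<sigma>1 \<sigma>2 P (R + z) \<partial>lborel)" by simp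
  then show False using K K0_pos by (simp add: integral_normal_translate)
qed

text \<open>At such a point the part of the input away from the boundary point contributes little to the first output
  density, so both output densities are controlled by the mass of the input near the boundary.\<close>

lemma mg_le_mass_near_boundary:
  assumes y: "\<bar>y - R\<bar> \<le> 2 * \<sigma>1" "log_ratio y \<le> 2 * K0"
  shows "exp (- y\<^sup>2 / (2 * \<sigma>2\<^sup>2)) * mg \<sigma>2 y \<le> 2 * exp (2 * K0) * prob {R - gap<..}"
proof -
  define I1 where "I1 = exp (- y\<^sup>2 / (2 * \<sigma>1\<^sup>2)) * mg \<sigma>1 y"
  define I2 where "I2 = exp (- y\<^sup>2 / (2 * \<sigma>2\<^sup>2)) * mg \<sigma>2 y"
  define p where "p = prob {R - gap<..}"
  have I1: "0 < I1" using mg_pos by (simp add: I1_def)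
  have I21: "I2 \<le> exp (2 * K0) * I1"
  proof -
    have "I2 = exp (lmg \<sigma>2 y - y\<^sup>2 / (2 * \<sigma>2\<^sup>2))" "I1 = exp (lmg \<sigma>1 y - y\<^sup>2 / (2 * \<sigma>1\<^sup>2))"
      using mg_pos[of \<sigma>1 y] mg_pos[of \<sigma>2 y] by (simp_all add: I1_def I2_def exp_diff exp_minus field_simps)
    moreover have "y\<^sup>2 / (2 * \<sigma>1\<^sup>2) - y\<^sup>2 / (2 * \<sigma>2\<^sup>2) = \<tau> / 2 * y\<^sup>2" by (simp add: \<tau>_def field_simps)
    ultimately show ?thesis using y(2) by (simp add: log_ratio_def flip: exp_add)
  qed
  have "I1 \<le> (\<integral>x. exp (- (2 * K0 + 1)) * exp (- (x - y)\<^sup>2 / (2 * \<sigma>2\<^sup>2)) + indicator {R - gap<..} x \<partial>P)"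
    unfolding I1_def mg_gauss(2)[OF \<sigma>1_pos, symmetric]
  proof (rule integral_mono_AE[OF mg_gauss(1)[OF \<sigma>1_pos]])
    show "integrable P (\<lambda>x. exp (- (2 * K0 + 1)) * exp (- (x - y)\<^sup>2 / (2 * \<sigma>2\<^sup>2)) + indicator {R - gap<..} x)"
      by (intro Bochner_Integration.integrable_add integrable_mult_right mg_gauss \<sigma>2_pos integrable_real_indicator)
        (auto simp: sets_P emeasure_eq_measure)
    show "AE x in P. exp (- (x - y)\<^sup>2 / (2 * \<sigma>1\<^sup>2))
       \<le> exp (- (2 * K0 + 1)) * exp (- (x - y)\<^sup>2 / (2 * \<sigma>2\<^sup>2)) + indicator {R - gap<..} x"
    proof (intro AE_I2)
      fix x
      show "exp (- (x - y)\<^sup>2 / (2 * \<sigma>1\<^sup>2))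
       \<le> exp (- (2 * K0 + 1)) * exp (- (x - y)\<^sup>2 / (2 * \<sigma>2\<^sup>2)) + indicator {R - gap<..} x"
      proof (cases "R - gap < x")
        case True
        have "exp (- (x - y)\<^sup>2 / (2 * \<sigma>1\<^sup>2)) \<le> 1" by simp
        then show ?thesis using True by (simp add: add_increasing)
      next
        case False
        \<comment> \<open>The part of \<open>gap\<close> left after the window 2 \<sigma>1; at this
          distance the first kernel is smaller than the second by the factor
          \<open>exp (- (2 * K0 + 1))\<close>.\<close>
        define u where "u = sqrt (2 * (2 * K0 + 1) / \<tau>)"
        have "u \<le> y - x" using False y(1) unfolding gap_def u_def by linarith
        moreover have u: "0 \<le> u" "u\<^sup>2 = 2 * (2 * K0 + 1) / \<tau>" using K0_pos \<tau>_pos by (simp_all add: u_def)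
        ultimately have "u\<^sup>2 \<le> (y - x)\<^sup>2" by (intro power_mono)
        then have "u\<^sup>2 \<le> (x - y)\<^sup>2" unfolding power2_commute[of x y] .
        then have "\<tau> / 2 * u\<^sup>2 \<le> \<tau> / 2 * (x - y)\<^sup>2" using \<tau>_pos by (intro mult_left_mono) auto
        then have "2 * K0 + 1 \<le> \<tau> / 2 * (x - y)\<^sup>2" using u(2) \<tau>_pos by simp
        moreover have "\<tau> / 2 * (x - y)\<^sup>2 = (x - y)\<^sup>2 / (2 * \<sigma>1\<^sup>2) - (x - y)\<^sup>2 / (2 * \<sigma>2\<^sup>2)"
          by (simp add: \<tau>_def field_simps)
        ultimately have "- (x - y)\<^sup>2 / (2 * \<sigma>1\<^sup>2) \<le> - (2 * K0 + 1) + - (x - y)\<^sup>2 / (2 * \<sigma>2\<^sup>2)" by simp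
        then have "exp (- (x - y)\<^sup>2 / (2 * \<sigma>1\<^sup>2)) \<le> exp (- (2 * K0 + 1)) * exp (- (x - y)\<^sup>2 / (2 * \<sigma>2\<^sup>2))"
          unfolding exp_add[symmetric] exp_le_cancel_iff .
        then show ?thesis using False by simp
      qed
    qed
  qed
  also have "\<dots> = exp (- (2 * K0 + 1)) * I2 + p"
    using mg_gauss[OF \<sigma>2_pos, of y] integrable_real_indicator[of "{R - gap<..}" P]
    by (simp add: I2_def p_def sets_P emeasure_eq_measure)
  \<comment> \<open>The extra 1 in the exponent leaves \<open>exp (-1) * I1\<close>, at most half of
    the left-hand side, which is then absorbed there.\<close>
  also have "\<dots> \<le> exp (- (2 * K0 + 1)) * (exp (2 * K0) * I1) + p"
    by (intro add_right_mono mult_left_mono I21) simp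
  also have "\<dots> = exp (-1) * I1 + p" by (simp add: mult.assoc[symmetric] flip: exp_add)
  also have "\<dots> \<le> 1 / 2 * I1 + p" using I1 by (intro add_right_mono mult_right_mono exp_minus_one_le_half) simp
  finally have "I1 \<le> 2 * p" by simp
  then have "exp (2 * K0) * I1 \<le> exp (2 * K0) * (2 * p)" by (intro mult_left_mono) auto
  with I21 have "I2 \<le> exp (2 * K0) * (2 * p)" by linarith
  then show ?thesis by (simp add: I2_def p_def mult_ac)
qed

text \<open>The mass \<open>p\<close> near R, of which only positivity is known, bounds
  \<open>lmg\<close> at y from above and at T from below; ln p cancels in the difference, so no
  quantitative bound on \<open>p\<close> enters.\<close>

lemma lmg_growth_past_boundary:
  assumes y: "\<bar>y - R\<bar> \<le> 2 * \<sigma>1" "log_ratio y \<le> 2 * K0" and T: "0 \<le> T"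
  shows "(T * (R - gap) - R\<^sup>2 / 2 - y\<^sup>2 / 2) / \<sigma>2\<^sup>2 - (1 + 2 * K0) \<le> lmg \<sigma>2 T - lmg \<sigma>2 y"
proof -
  define p where "p = prob {R - gap<..}"
  note le = mg_le_mass_near_boundary[OF y, folded p_def]
  have "0 < exp (- y\<^sup>2 / (2 * \<sigma>2\<^sup>2)) * mg \<sigma>2 y" using mg_pos by simp
  with le have "0 < 2 * exp (2 * K0) * p" by linarith
  then have p: "0 < p" by (simp add: zero_less_mult_iff)
  have "ln (exp (- y\<^sup>2 / (2 * \<sigma>2\<^sup>2)) * mg \<sigma>2 y) \<le> ln (2 * exp (2 * K0) * p)"
    using le mg_pos p by (subst ln_le_cancel_iff) auto
  then have 1: "lmg \<sigma>2 y - y\<^sup>2 / (2 * \<sigma>2\<^sup>2) \<le> ln 2 + 2 * K0 + ln p"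
    using mg_pos[of \<sigma>2 y] p by (simp add: ln_mult)
  have "exp ((T * (R - gap) - R\<^sup>2 / 2) / \<sigma>2\<^sup>2) * p \<le> mg \<sigma>2 T"
  proof -
    have "(\<integral>x. exp ((T * (R - gap) - R\<^sup>2 / 2) / \<sigma>2\<^sup>2) * indicator {R - gap<..} x \<partial>P) \<le> mg \<sigma>2 T"
      unfolding mg_def
    proof (rule integral_mono_AE[OF _ mg_integrable])
      show "integrable P (\<lambda>x. exp ((T * (R - gap) - R\<^sup>2 / 2) / \<sigma>2\<^sup>2) * indicator {R - gap<..} x)"
        by (intro integrable_mult_right integrable_real_indicator) (auto simp: sets_P emeasure_eq_measure)
      show "AE x in P. exp ((T * (R - gap) - R\<^sup>2 / 2) / \<sigma>2\<^sup>2) * indicator {R - gap<..} x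
        \<le> exp (- x\<^sup>2 / (2 * \<sigma>2\<^sup>2)) * exp (T / \<sigma>2\<^sup>2 * x)"
        using AE_abs_le
      proof eventually_elim
        fix x assume x: "\<bar>x\<bar> \<le> R"
        show "exp ((T * (R - gap) - R\<^sup>2 / 2) / \<sigma>2\<^sup>2) * indicator {R - gap<..} x
          \<le> exp (- x\<^sup>2 / (2 * \<sigma>2\<^sup>2)) * exp (T / \<sigma>2\<^sup>2 * x)"
        proof (cases "R - gap < x")
          case True
          have "T * (R - gap) \<le> T * x" using True T by (intro mult_left_mono) auto
          moreover have "x\<^sup>2 \<le> R\<^sup>2" using x by (simp add: abs_le_square_iff[symmetric])
          ultimately have "(T * (R - gap) - R\<^sup>2 / 2) / \<sigma>2\<^sup>2 \<le> (T * x - x\<^sup>2 / 2) / \<sigma>2\<^sup>2"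
            by (intro divide_right_mono) auto
          moreover have "(T * x - x\<^sup>2 / 2) / \<sigma>2\<^sup>2 = - x\<^sup>2 / (2 * \<sigma>2\<^sup>2) + T / \<sigma>2\<^sup>2 * x"
            using \<sigma>2_pos by (simp add: field_simps)
          ultimately show ?thesis using True by (simp flip: exp_add)
        qed simp
      qed
    qed
    then show ?thesis by (simp add: p_def sets_P)
  qed
  then have "ln (exp ((T * (R - gap) - R\<^sup>2 / 2) / \<sigma>2\<^sup>2) * p) \<le> lmg \<sigma>2 T"
    using mg_pos[of \<sigma>2 T] p by (subst ln_le_cancel_iff) auto
  then have 2: "(T * (R - gap) - R\<^sup>2 / 2) / \<sigma>2\<^sup>2 + ln p \<le> lmg \<sigma>2 T"
    using p by (simp add: ln_mult)
  have "ln (2 :: real) \<le> 1" using ln_le_minus_one[of 2] by simp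
  with 1 2 show ?thesis by (simp add: diff_divide_distrib)
qed

text \<open>The chord from a point near R to 3 R / 2 already has almost the maximal slope R /
  \<sigma>2^2; convexity passes this to every chord further right.\<close>

lemma lmg_slope_past_boundary:
  assumes K: "(\<integral>y. normal_density R \<sigma>1 y * g_fun \<sigma>1 \<sigma>2 P y \<partial>lborel) \<le> 0"
    and R: "large_radius \<le> R" and st: "3 / 2 * R \<le> s" "s < t"
  shows "(R - K1) / \<sigma>2\<^sup>2 \<le> (lmg \<sigma>2 t - lmg \<sigma>2 s) / (t - s)"
proof -
  have R8: "1 \<le> R" "8 * \<sigma>1 \<le> R"
    using R K1_pos K2_nonneg \<tau>_pos \<sigma>1_pos divide_nonneg_pos[of "K2 + 1" \<tau>] unfolding large_radius_def by linarith+
  obtain y where y: "\<bar>y - R\<bar> \<le> 2 * \<sigma>1" "log_ratio y \<le> 2 * K0"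
    using log_ratio_small_near_boundary[OF K] by blast
  define e where "e = y - R"
  define c where "c = (1 + 2 * K0) * \<sigma>2\<^sup>2"
  have e: "\<bar>e\<bar> \<le> 2 * \<sigma>1" "e\<^sup>2 \<le> 4 * \<sigma>1\<^sup>2"
  proof -
    show "\<bar>e\<bar> \<le> 2 * \<sigma>1" using y by (simp add: e_def)
    then have "e\<^sup>2 \<le> (2 * \<sigma>1)\<^sup>2" using \<sigma>1_pos abs_le_square_iff[of e "2 * \<sigma>1"] by simp
    then show "e\<^sup>2 \<le> 4 * \<sigma>1\<^sup>2" by (simp add: power_mult_distrib)
  qed
  have c: "0 \<le> c" using K0_pos by (simp add: c_def)
  have yT: "y < 3 / 2 * R" using e R8 \<sigma>1_pos by (simp add: e_def)
  \<comment> \<open>Up to e^2 / 2 the main terms are R times the chord length R / 2 - e. The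
    remaining losses are at most linear in R, and the chord is at least R / 4 long; the quotient is
    \<open>K1\<close>, whence its 6 = 4 * 3 / 2 and its 4.\<close>
  have "(R - K1) * (3 / 2 * R - y) \<le> 3 / 2 * R * (R - gap) - R\<^sup>2 / 2 - y\<^sup>2 / 2 - c"
  proof -
    have "3 / 2 * gap * R + e\<^sup>2 / 2 + c \<le> 3 / 2 * gap * R + (2 * \<sigma>1\<^sup>2 + c) * 1" using e(2) by simp
    also have "\<dots> \<le> 3 / 2 * gap * R + (2 * \<sigma>1\<^sup>2 + c) * R" using R8 c by (intro add_left_mono mult_left_mono) auto
    also have "\<dots> = K1 * (R / 4)" by (simp add: K1_def c_def algebra_simps)
    also have "\<dots> \<le> K1 * (R / 2 - e)" using e R8 K1_pos by (intro mult_left_mono) auto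
    finally have "3 / 2 * gap * R + e\<^sup>2 / 2 + c \<le> K1 * (R / 2 - e)" .
    moreover have "3 / 2 * R * (R - gap) - R\<^sup>2 / 2 - y\<^sup>2 / 2 - c - (R - K1) * (3 / 2 * R - y)
      = K1 * (R / 2 - e) - (3 / 2 * gap * R + e\<^sup>2 / 2 + c)"
      by (simp add: e_def power2_eq_square field_simps)
    ultimately show ?thesis by linarith
  qed
  then have "(R - K1) * (3 / 2 * R - y) / \<sigma>2\<^sup>2 \<le> (3 / 2 * R * (R - gap) - R\<^sup>2 / 2 - y\<^sup>2 / 2 - c) / \<sigma>2\<^sup>2"
    by (intro divide_right_mono) auto
  also have "\<dots> = (3 / 2 * R * (R - gap) - R\<^sup>2 / 2 - y\<^sup>2 / 2) / \<sigma>2\<^sup>2 - (1 + 2 * K0)"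
    using \<sigma>2_pos by (simp add: c_def diff_divide_distrib)
  also have "\<dots> \<le> lmg \<sigma>2 (3 / 2 * R) - lmg \<sigma>2 y"
    using R8 by (intro lmg_growth_past_boundary y) auto
  finally have "(R - K1) / \<sigma>2\<^sup>2 * (3 / 2 * R - y) \<le> lmg \<sigma>2 (3 / 2 * R) - lmg \<sigma>2 y" by simp
  then have "(R - K1) / \<sigma>2\<^sup>2 \<le> (lmg \<sigma>2 (3 / 2 * R) - lmg \<sigma>2 y) / (3 / 2 * R - y)"
    using yT by (simp only: pos_le_divide_eq diff_gt_0_iff_gt)
  also have "\<dots> \<le> (lmg \<sigma>2 t - lmg \<sigma>2 s) / (t - s)"
    by (rule lmg_slope_mono[OF \<sigma>2_pos yT st])
  finally show ?thesis .
qed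

text \<open>For y at least 2 R the shifted point y + z is past 3 R / 2 unless z < - R / 2. The
  slopes R / \<sigma>2^2 and R / \<sigma>1^2 then combine with 2 \<tau> R to leave \<tau> R minus a
  loss independent of R.\<close>

lemma slope_ge_one:
  assumes K: "(\<integral>y. normal_density R \<sigma>1 y * g_fun \<sigma>1 \<sigma>2 P y \<partial>lborel) \<le> 0"
    and R: "large_radius \<le> R" and y: "2 * R \<le> y"
  shows "1 \<le> slope y"
proof -
  define \<kappa> where "\<kappa> = (R - K1) / \<sigma>2\<^sup>2"
  \<comment> \<open>The least coefficient for which the quadratic allowance at |z| = R / 2 covers
    the fall from the good slope \<kappa> to the extreme slope - R / \<sigma>2^2.\<close>
  define c where "c = (\<kappa> + R / \<sigma>2\<^sup>2) / (R / 2)\<^sup>2"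
  have R1: "1 \<le> R" "K1 \<le> R" "(K2 + 1) / \<tau> \<le> R"
    using R K1_pos K2_nonneg \<tau>_pos \<sigma>1_pos divide_nonneg_pos[of "K2 + 1" \<tau>] unfolding large_radius_def by linarith+
  have \<kappa>: "0 \<le> \<kappa> + R / \<sigma>2\<^sup>2" "\<kappa> + R / \<sigma>2\<^sup>2 \<le> 2 * R / \<sigma>2\<^sup>2"
    using R1 K1_pos by (simp_all add: \<kappa>_def divide_right_mono flip: add_divide_distrib)
  have c: "0 \<le> c" "c \<le> 8 / \<sigma>2\<^sup>2"
  proof -
    show "0 \<le> c" using \<kappa> by (simp add: c_def)
    have "c \<le> (2 * R / \<sigma>2\<^sup>2) / (R / 2)\<^sup>2" unfolding c_def by (intro divide_right_mono \<kappa>) simp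
    also have "\<dots> = 8 / \<sigma>2\<^sup>2 / R" using R1 by (simp add: power2_eq_square field_simps)
    also have "\<dots> \<le> 8 / \<sigma>2\<^sup>2" using R1 divide_left_mono[of 1 R "8 / \<sigma>2\<^sup>2"] by simp
    finally show "c \<le> 8 / \<sigma>2\<^sup>2" .
  qed
  have "\<tau> * y + (\<kappa> - c * noise_sd\<^sup>2) - R / \<sigma>1\<^sup>2 \<le> slope y"
  proof (rule slope_ge)
    fix t z :: real assume t: "y < t"
    show "\<kappa> - c * z\<^sup>2 \<le> (lmg \<sigma>2 (t + z) - lmg \<sigma>2 (y + z)) / (t - y)"
    proof (cases "- (R / 2) \<le> z")
      case True
      have "\<kappa> \<le> (lmg \<sigma>2 (t + z) - lmg \<sigma>2 (y + z)) / ((t + z) - (y + z))"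
        unfolding \<kappa>_def using True y t by (intro lmg_slope_past_boundary[OF K R]) auto
      moreover have "0 \<le> c * z\<^sup>2" using c by simp
      ultimately show ?thesis by simp
    next
      case False
      then have "(R / 2)\<^sup>2 \<le> (- z)\<^sup>2" using R1 by (intro power_mono) auto
      then have "c * (R / 2)\<^sup>2 \<le> c * z\<^sup>2" using c by (intro mult_left_mono) auto
      moreover have "c * (R / 2)\<^sup>2 = \<kappa> + R / \<sigma>2\<^sup>2" using R1 by (simp add: c_def)
      ultimately show ?thesis
        using lmg_difference_quotient[OF \<sigma>2_pos t, of z] by simp
    qed
  qed
  moreover have "c * noise_sd\<^sup>2 \<le> 8 * noise_sd\<^sup>2 / \<sigma>2\<^sup>2"
    using mult_right_mono[OF c(2), of "noise_sd\<^sup>2"] by simp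
  moreover have "\<tau> * (2 * R) \<le> \<tau> * y" using y \<tau>_pos by (intro mult_left_mono) auto
  moreover have "\<kappa> - R / \<sigma>1\<^sup>2 = - (\<tau> * R) - K1 / \<sigma>2\<^sup>2"
    by (simp add: \<kappa>_def \<tau>_def algebra_simps diff_divide_distrib)
  moreover have "K2 + 1 \<le> \<tau> * R" using R1(3) \<tau>_pos by (simp add: pos_divide_le_eq mult.commute)
  ultimately show ?thesis unfolding K2_def by linarith
qed

text \<open>The left boundary is reduced to the right one by x -> -x, which turns g(y) into g(-y).
  The localisation is phrased with the integral inequality at the boundary point, which reflection
  carries over directly.\<close>

definition reflected :: "real measure" where "reflected = distr P borel uminus"

lemma reflected_wiretap: "wiretap R reflected \<sigma>1 \<sigma>2"
proof unfold_locales
  have [measurable]: "uminus \<in> measurable P borel" by measurable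
  have "emeasure reflected {-R..R} = emeasure P (uminus -` {-R..R} \<inter> space P)"
    unfolding reflected_def by (rule emeasure_distr) auto
  also have "uminus -` {-R..R} \<inter> space P = {-R..R}" by auto
  finally show "admissible_input R reflected"
    using admissible prob_space_distr[of uminus borel] by (auto simp: admissible_input_def reflected_def)
qed (use \<sigma>1_pos \<sigma>1_less in auto)

lemma out_density_reflected: "out_density \<sigma> reflected y = out_density \<sigma> P (- y)"
proof -
  have "out_density \<sigma> reflected y = (\<integral>x. normal_density (- x) \<sigma> y \<partial>P)"
    unfolding out_density_def reflected_def
  proof (rule integral_distr)
    show "(\<lambda>x. normal_density x \<sigma> y) \<in> borel_measurable borel"
      unfolding normal_density_def by measurable
  qed measurable
  moreover have "normal_density (- x) \<sigma> y = normal_density x \<sigma> (- y)" for x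
    by (simp add: normal_density_def power2_eq_square algebra_simps)
  ultimately show ?thesis by (simp add: out_density_def)
qed

lemma g_fun_reflected: "g_fun \<sigma>1 \<sigma>2 reflected y = g_fun \<sigma>1 \<sigma>2 P (- y)"
  unfolding g_fun_def out_density_reflected
  using integral_normal_reflect[of "sqrt (\<sigma>2\<^sup>2 - \<sigma>1\<^sup>2)" "\<lambda>t. ln (out_density \<sigma>2 P t / out_density \<sigma>1 P (- y))" "- y"]
  by simp

lemma slope_le_minus_one:
  assumes K: "(\<integral>y. normal_density (- R) \<sigma>1 y * g_fun \<sigma>1 \<sigma>2 P y \<partial>lborel) \<le> 0"
    and R: "large_radius \<le> R" and y: "y \<le> - 2 * R"
  shows "slope y \<le> -1"
proof -
  interpret Q: wiretap R reflected \<sigma>1 \<sigma>2 by (rule reflected_wiretap)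
  have "1 \<le> Q.slope (- y)"
  proof (rule Q.slope_ge_one)
    have "(\<integral>y. normal_density R \<sigma>1 y * g_fun \<sigma>1 \<sigma>2 reflected y \<partial>lborel)
       = (\<integral>y. normal_density (- R) \<sigma>1 (- y) * g_fun \<sigma>1 \<sigma>2 P (- y) \<partial>lborel)"
      by (intro Bochner_Integration.integral_cong refl) (simp add: g_fun_reflected normal_density_def power2_commute)
    then show "(\<integral>y. normal_density R \<sigma>1 y * g_fun \<sigma>1 \<sigma>2 reflected y \<partial>lborel) \<le> 0"
      using K integral_lborel_reflect[of "\<lambda>y. normal_density (- R) \<sigma>1 y * g_fun \<sigma>1 \<sigma>2 P y"] by simp
  qed (use R y in auto)
  moreover have "Q.slope (- y) = - slope y"
  proof -
    have "((\<lambda>t. g_fun \<sigma>1 \<sigma>2 P (- t) + 0) has_real_derivative Q.slope (- y)) (at (- y))"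
      using Q.g_fun_derivative[of 0 "- y"] by (simp add: g_fun_reflected)
    moreover have "((\<lambda>t. g_fun \<sigma>1 \<sigma>2 P (- t) + 0) has_real_derivative slope y * (- 1)) (at (- y))"
      using g_fun_derivative[of 0 y] by (intro DERIV_chain2[of "\<lambda>y. g_fun \<sigma>1 \<sigma>2 P y + 0"]) (auto intro!: derivative_eq_intros)
    ultimately show ?thesis using DERIV_unique by fastforce
  qed
  ultimately show ?thesis by simp
qed

end

section \<open>The quantitative bound\<close>

text \<open>Cauchy's estimate on the unit circle; it accounts for the \<open>+ 1\<close> added to
  the radii in the growth bounds.\<close>

lemma norm_deriv_le:
  assumes f: "f holomorphic_on UNIV" and B: "\<And>w. norm (\<zeta> - w) = 1 \<Longrightarrow> norm (f w) \<le> B"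
  shows "norm (deriv f \<zeta>) \<le> B"
proof -
  have "norm ((deriv ^^ 1) f \<zeta>) \<le> fact 1 * B / 1 ^ 1"
    using holomorphic_on_subset[OF f] holomorphic_on_imp_continuous_on[OF holomorphic_on_subset[OF f]] B
    by (intro Cauchy_inequality) auto
  then show ?thesis by simp
qed

context wiretap
begin

lemma norm_csmoothed_le:
  "norm (csmoothed w) \<le> exp ((Im w)\<^sup>2 / (2 * noise_sd\<^sup>2)) *
    (R / \<sigma>2\<^sup>2 * (1 + noise_sd\<^sup>2 + (Re w)\<^sup>2) + R\<^sup>2 / \<sigma>2\<^sup>2)"
proof -
  have le: "\<bar>lmg \<sigma>2 t\<bar> \<le> (R / \<sigma>2\<^sup>2 + R\<^sup>2 / \<sigma>2\<^sup>2) + R / \<sigma>2\<^sup>2 * t\<^sup>2" for t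
  proof -
    have "0 \<le> (\<bar>t\<bar> - 1)\<^sup>2" by simp
    then have "\<bar>t\<bar> \<le> 1 + t\<^sup>2" unfolding power2_diff using abs_ge_zero[of t] by simp
    then have "R / \<sigma>2\<^sup>2 * \<bar>t\<bar> \<le> R / \<sigma>2\<^sup>2 * (1 + t\<^sup>2)" using R_nonneg by (intro mult_left_mono) auto
    moreover have "R\<^sup>2 / (2 * \<sigma>2\<^sup>2) \<le> R\<^sup>2 / \<sigma>2\<^sup>2" using \<sigma>2_pos by (intro divide_left_mono) auto
    ultimately show ?thesis using lmg_abs_le[OF \<sigma>2_pos, of t] by (simp add: distrib_left)
  qed
  have "norm (csmoothed w) \<le> exp ((Im w)\<^sup>2 / (2 * noise_sd\<^sup>2)) * (\<integral>y. normal_density (Re w) noise_sd y * \<bar>lmg \<sigma>2 y\<bar> \<partial>lborel)"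
    unfolding csmoothed_def by (rule gauss_transform_bound[OF noise_sd_pos lmg_quad_growth[OF \<sigma>2_pos]])
  also have "\<dots> \<le> exp ((Im w)\<^sup>2 / (2 * noise_sd\<^sup>2)) * ((R / \<sigma>2\<^sup>2 + R\<^sup>2 / \<sigma>2\<^sup>2) + R / \<sigma>2\<^sup>2 * (noise_sd\<^sup>2 + (Re w)\<^sup>2))"
    by (intro mult_left_mono integral_normal_quad_le noise_sd_pos quad_growth_abs lmg_quad_growth \<sigma>2_pos le) simp
  finally show ?thesis by (simp add: algebra_simps)
qed

text \<open>The smoothed term grows exponentially only with the imaginary part, at most r + 1, and
  \<open>cmg\<close> only with the real part, at most p + r + 1. Everything else is polynomial and
  ends inside the logarithm.\<close>

lemma norm_slope_numerator_le:
  assumes z: "norm (z - of_real p) = r" and p: "0 \<le> p"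
  shows "norm (slope_numerator z) \<le> exp ((r + 1)\<^sup>2 / (2 * noise_sd\<^sup>2) + (p + r + 1) * R / \<sigma>1\<^sup>2) *
    (R / \<sigma>2\<^sup>2 * (1 + noise_sd\<^sup>2 + (p + r + 1)\<^sup>2) + R\<^sup>2 / \<sigma>2\<^sup>2 + \<tau> * (p + r) + 1)"
proof -
  define E1 where "E1 = exp ((r + 1)\<^sup>2 / (2 * noise_sd\<^sup>2))"
  define E2 where "E2 = exp ((p + r + 1) * R / \<sigma>1\<^sup>2)"
  define q where "q = R / \<sigma>2\<^sup>2 * (1 + noise_sd\<^sup>2 + (p + r + 1)\<^sup>2) + R\<^sup>2 / \<sigma>2\<^sup>2"
  have r: "0 \<le> r" using z by (metis norm_ge_zero)
  have z': "norm z \<le> p + r"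
    using norm_triangle_ineq2[of z "of_real p"] z p by simp
  have w: "\<bar>Re w\<bar> \<le> p + r + 1" "\<bar>Im w\<bar> \<le> r + 1" if w: "norm (z - w) \<le> 1" for w
  proof -
    have "norm w \<le> norm z + norm (w - z)" using norm_triangle_ineq[of z "w - z"] by simp
    then show "\<bar>Re w\<bar> \<le> p + r + 1" using abs_Re_le_cmod[of w] w z' by (simp add: norm_minus_commute)
    have "norm (w - of_real p) \<le> norm (w - z) + norm (z - of_real p)" using norm_triangle_ineq[of "w - z" "z - of_real p"] by simp
    then show "\<bar>Im w\<bar> \<le> r + 1" using abs_Im_le_cmod[of "w - of_real p"] w z by (simp add: norm_minus_commute)
  qed
  have cmg: "norm (cmg \<sigma>1 w) \<le> E2" if "norm (z - w) \<le> 1" for w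
  proof -
    have "norm (cmg \<sigma>1 w) \<le> exp (\<bar>Re w\<bar> * R / \<sigma>1\<^sup>2)" by (rule norm_cmg_le[OF \<sigma>1_pos])
    also have "\<dots> \<le> E2" unfolding E2_def using w(1)[OF that] R_nonneg
      by (simp add: divide_right_mono mult_right_mono)
    finally show ?thesis .
  qed
  have csm: "norm (csmoothed w) \<le> E1 * q" if "norm (z - w) \<le> 1" for w
  proof -
    have "(Im w)\<^sup>2 \<le> (r + 1)\<^sup>2" "(Re w)\<^sup>2 \<le> (p + r + 1)\<^sup>2"
      using w[OF that] r p abs_le_square_iff[of "Im w" "r + 1"] abs_le_square_iff[of "Re w" "p + r + 1"] by simp_all
    then have "exp ((Im w)\<^sup>2 / (2 * noise_sd\<^sup>2)) * (R / \<sigma>2\<^sup>2 * (1 + noise_sd\<^sup>2 + (Re w)\<^sup>2) + R\<^sup>2 / \<sigma>2\<^sup>2) \<le> E1 * q"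
      unfolding E1_def q_def using R_nonneg
      by (intro mult_mono add_mono mult_left_mono add_nonneg_nonneg) (auto simp: divide_right_mono)
    then show ?thesis using norm_csmoothed_le[of w] by linarith
  qed
  have d1: "norm (deriv csmoothed z) \<le> E1 * q"
    by (rule norm_deriv_le[OF csmoothed_holomorphic]) (rule csm, simp)
  have d2: "norm (deriv (cmg \<sigma>1) z) \<le> E2"
    by (rule norm_deriv_le[OF cmg_holomorphic[OF \<sigma>1_pos]]) (rule cmg, simp)
  have "norm (slope_numerator z) \<le> norm ((deriv csmoothed z + of_real \<tau> * z) * cmg \<sigma>1 z) + norm (deriv (cmg \<sigma>1) z)"
    unfolding slope_numerator_def by (rule norm_triangle_ineq4)
  also have "\<dots> \<le> (E1 * q + \<tau> * (p + r)) * E2 + E2"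
  proof -
    have "norm (deriv csmoothed z + of_real \<tau> * z) \<le> norm (deriv csmoothed z) + norm (of_real \<tau> * z)"
      by (rule norm_triangle_ineq)
    also have "\<dots> \<le> E1 * q + \<tau> * (p + r)"
      using d1 z' \<tau>_pos by (simp add: norm_mult add_mono mult_left_mono)
    finally have le: "norm (deriv csmoothed z + of_real \<tau> * z) \<le> E1 * q + \<tau> * (p + r)" .
    show ?thesis
      unfolding norm_mult using cmg[of z] d2 order_trans[OF norm_ge_zero le]
      by (intro add_mono mult_mono le) auto
  qed
  \<comment> \<open>Since \<open>E1\<close> is at least 1 it can be inserted into the lower-order
    terms, which makes both exponentials common factors.\<close>
  also have "\<dots> \<le> (E1 * q + E1 * (\<tau> * (p + r))) * E2 + E1 * E2"
  proof -
    have E1: "1 \<le> E1" by (simp add: E1_def)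
    have "\<tau> * (p + r) \<le> E1 * (\<tau> * (p + r))"
      using mult_right_mono[OF E1, of "\<tau> * (p + r)"] \<tau>_pos p r by simp
    moreover have "E2 \<le> E1 * E2" using mult_right_mono[OF E1, of E2] by (simp add: E2_def)
    ultimately show ?thesis by (intro add_mono mult_right_mono add_left_mono) (auto simp: E2_def)
  qed
  also have "\<dots> = (E1 * E2) * (q + \<tau> * (p + r) + 1)" by (simp add: algebra_simps)
  finally show ?thesis unfolding E1_def E2_def q_def exp_add[symmetric] .
qed

end

text \<open>For large R the critical points lie in [-2 R, 2 R], hence within 4 R of the centre 2 R,
  where \<open>slope\<close> is at least 1; the counting lemma measures growth on a circle e + 1
  times as large.\<close>

definition radius_factor :: real where "radius_factor = 4 * (exp 1 + 1)"

lemma (in optimal_wiretap) zero_count_explicit: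
  assumes R: "large_radius \<le> R"
  shows "\<exists>n. zero_count \<sigma>1 \<sigma>2 R P = enat n \<and> real n \<le> 1 +
    (radius_factor * R + 1)\<^sup>2 / (2 * noise_sd\<^sup>2) + (2 * R + radius_factor * R + 1) * R / \<sigma>1\<^sup>2 + 5 / 2 * R\<^sup>2 / \<sigma>1\<^sup>2 +
    ln (R / \<sigma>2\<^sup>2 * (1 + noise_sd\<^sup>2 + (2 * R + radius_factor * R + 1)\<^sup>2) + R\<^sup>2 / \<sigma>2\<^sup>2 + \<tau> * (2 * R + radius_factor * R) + 1)"
proof -
  define r where "r = radius_factor * R"
  define e where "e = (r + 1)\<^sup>2 / (2 * noise_sd\<^sup>2) + (2 * R + r + 1) * R / \<sigma>1\<^sup>2"
  define q where "q = R / \<sigma>2\<^sup>2 * (1 + noise_sd\<^sup>2 + (2 * R + r + 1)\<^sup>2) + R\<^sup>2 / \<sigma>2\<^sup>2 + \<tau> * (2 * R + r) + 1"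
  have R1: "1 \<le> R"
    using R K1_pos K2_nonneg \<tau>_pos \<sigma>1_pos divide_nonneg_pos[of "K2 + 1" \<tau>] unfolding large_radius_def by linarith
  have r: "0 \<le> r" using R1 by (simp add: r_def radius_factor_def)
  have q: "1 \<le> q"
    using R1 r \<tau>_pos unfolding q_def by (intro le_add_same_cancel2[THEN iffD2] add_nonneg_nonneg mult_nonneg_nonneg) auto
  \<comment> \<open>The optimality condition bounds the average of g by an entropy difference, which
    is at most 0.\<close>
  have g_le: "(\<integral>y. normal_density x \<sigma>1 y * g_fun \<sigma>1 \<sigma>2 P y \<partial>lborel) \<le> 0" if "\<bar>x\<bar> \<le> R" for x
    using cross_entropy_difference_le[OF that] neg_entropy_mono unfolding cross_entropy_difference by linarith
  have right: "1 \<le> slope y" if "2 * R \<le> y" for y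
    using slope_ge_one[OF g_le R that] R1 by simp
  have left: "slope y \<le> -1" if "y \<le> - 2 * R" for y
    using slope_le_minus_one[OF g_le R that] R1 by simp
  have "\<exists>n. num_zeros {- L_bound \<sigma>1 \<sigma>2 R..L_bound \<sigma>1 \<sigma>2 R} (\<lambda>y. g_fun \<sigma>1 \<sigma>2 P y + kappa1 \<sigma>1 \<sigma>2 R) = enat n \<and>
     real n \<le> 1 + ln (exp e * q / (\<bar>slope (2 * R)\<bar> * mg \<sigma>1 (2 * R)))"
  proof (rule slope_num_zeros_bound[where \<rho> = "4 * R"])
    show "slope (2 * R) \<noteq> 0" using right[of "2 * R"] by simp
    show "0 < 4 * R" using R1 by simp
    fix x assume "slope x = 0"
    then show "\<bar>x - 2 * R\<bar> \<le> 4 * R"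
      using right[of x] left[of x] by (cases "2 * R \<le> x"; cases "x \<le> - 2 * R") auto
  next
    fix z assume "norm (z - complex_of_real (2 * R)) = (exp 1 + 1) * (4 * R)"
    then have "norm (z - complex_of_real (2 * R)) = r" by (simp add: r_def radius_factor_def)
    then show "norm (slope_numerator z) \<le> exp e * q"
      unfolding e_def q_def by (intro norm_slope_numerator_le) (use R1 in auto)
  qed
  then obtain n where n: "zero_count \<sigma>1 \<sigma>2 R P = enat n"
    "real n \<le> 1 + ln (exp e * q / (\<bar>slope (2 * R)\<bar> * mg \<sigma>1 (2 * R)))"
    unfolding zero_count_def by blast
  have "ln (exp e * q / (\<bar>slope (2 * R)\<bar> * mg \<sigma>1 (2 * R))) = e + ln q - ln \<bar>slope (2 * R)\<bar> - lmg \<sigma>1 (2 * R)"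
    using q mg_pos[of \<sigma>1 "2 * R"] right[of "2 * R"] by (simp add: ln_div ln_mult)
  also have "\<dots> \<le> e + ln q + 5 / 2 * R\<^sup>2 / \<sigma>1\<^sup>2"
  proof -
    \<comment> \<open>The worst mean, -R, gives the 5 / 2 as 2 + 1 / 2.\<close>
    obtain m where m: "\<bar>m\<bar> \<le> R" "(2 * R * m - R\<^sup>2 / 2) / \<sigma>1\<^sup>2 \<le> lmg \<sigma>1 (2 * R)"
      using lmg_lower[OF \<sigma>1_pos] by blast
    have "2 * R * (- R) \<le> 2 * R * m" using m R1 by (intro mult_left_mono) auto
    then have "- (5 / 2 * R\<^sup>2) \<le> 2 * R * m - R\<^sup>2 / 2" by (simp add: power2_eq_square)
    then have "- (5 / 2 * R\<^sup>2) / \<sigma>1\<^sup>2 \<le> (2 * R * m - R\<^sup>2 / 2) / \<sigma>1\<^sup>2" by (intro divide_right_mono) auto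
    moreover have "0 \<le> ln \<bar>slope (2 * R)\<bar>" using right[of "2 * R"] by simp
    ultimately show ?thesis using m(2) by simp
  qed
  finally have "real n \<le> 1 + (e + ln q + 5 / 2 * R\<^sup>2 / \<sigma>1\<^sup>2)" using n(2) by linarith
  then show ?thesis using n(1) unfolding e_def q_def r_def by (intro exI[of _ n]) linarith
qed

text \<open>The growth term enters through \<beta>, which is at most (c - 1) / 4 and so linear in c,
  while the target is quadratic in c. Strictness leaves a positive multiple of R^2 in
  reserve.\<close>

lemma leading_constant_less:
  fixes \<sigma>1 \<sigma>2 :: real
  assumes "0 < \<sigma>1" "\<sigma>1 < \<sigma>2"
  shows "radius_factor\<^sup>2 / (2 * (\<sigma>2\<^sup>2 - \<sigma>1\<^sup>2)) + (2 + radius_factor + 5 / 2) / \<sigma>1\<^sup>2 < rho_const \<sigma>1 \<sigma>2 / \<sigma>1\<^sup>2"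
proof -
  define c where "c = (\<sigma>2 + \<sigma>1) / (\<sigma>2 - \<sigma>1)"
  define \<beta> where "\<beta> = \<sigma>1\<^sup>2 / (\<sigma>2\<^sup>2 - \<sigma>1\<^sup>2)"
  define u where "u = (exp 1 :: real)"
  have u: "2 \<le> u" using exp_ge_add_one_self[of 1] by (simp add: u_def)
  have c: "1 < c" using assms by (simp add: c_def)
  have \<beta>: "4 * \<beta> \<le> c - 1"
  proof -
    have "4 * \<beta> = 4 * \<sigma>1\<^sup>2 / ((\<sigma>2 - \<sigma>1) * (\<sigma>2 + \<sigma>1))" by (simp add: \<beta>_def power2_eq_square algebra_simps)
    also have "\<dots> = (2 * \<sigma>1 / (\<sigma>2 - \<sigma>1)) * (2 * \<sigma>1 / (\<sigma>2 + \<sigma>1))" by (simp add: power2_eq_square)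
    also have "\<dots> \<le> (2 * \<sigma>1 / (\<sigma>2 - \<sigma>1)) * 1" using assms by (intro mult_left_mono) auto
    also have "\<dots> = c - 1" using assms by (simp add: c_def field_simps)
    finally show ?thesis .
  qed
  have "8 * (u + 1)\<^sup>2 * \<beta> + (4 * u + 17 / 2) < (2 * u + 1)\<^sup>2 * c\<^sup>2 + (c + 1)\<^sup>2"
  proof -
    have "8 * (u + 1)\<^sup>2 * \<beta> \<le> 2 * (u + 1)\<^sup>2 * (c - 1)"
      using mult_left_mono[OF \<beta>, of "2 * (u + 1)\<^sup>2"] by simp
    also have "\<dots> \<le> 2 * (2 * u + 1)\<^sup>2 * (c - 1)"
      using u c by (intro mult_right_mono mult_left_mono power_mono) auto
    finally have 1: "8 * (u + 1)\<^sup>2 * \<beta> \<le> (2 * u + 1)\<^sup>2 * (2 * c - 2)" by (simp add: algebra_simps)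
    have "0 \<le> (c - 1)\<^sup>2" by simp
    then have "2 * c - 1 \<le> c\<^sup>2" by (simp add: power2_diff)
    then have 2: "(2 * u + 1)\<^sup>2 * (2 * c - 1) \<le> (2 * u + 1)\<^sup>2 * c\<^sup>2" by (intro mult_left_mono) auto
    have 3: "(2 * u + 1)\<^sup>2 * (2 * c - 1) = (2 * u + 1)\<^sup>2 * (2 * c - 2) + (2 * u + 1)\<^sup>2" by (simp add: algebra_simps)
    have "2 * 2 \<le> u * u" using u by (intro mult_mono) auto
    then have 4: "4 * u + 17 \<le> (2 * u + 1)\<^sup>2" by (simp add: power2_eq_square algebra_simps)
    have "0 \<le> (c + 1)\<^sup>2" by simp
    with 1 2 3 4 show ?thesis by linarith
  qed
  then have "(8 * (u + 1)\<^sup>2 * \<beta> + (4 * u + 17 / 2)) / \<sigma>1\<^sup>2 < ((2 * u + 1)\<^sup>2 * c\<^sup>2 + (c + 1)\<^sup>2) / \<sigma>1\<^sup>2"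
    using assms by (intro divide_strict_right_mono) auto
  moreover have "8 * (u + 1)\<^sup>2 * \<beta> / \<sigma>1\<^sup>2 = radius_factor\<^sup>2 / (2 * (\<sigma>2\<^sup>2 - \<sigma>1\<^sup>2))"
  proof -
    have "radius_factor\<^sup>2 = 16 * (u + 1)\<^sup>2"
      unfolding radius_factor_def u_def power_mult_distrib by simp
    moreover have "8 * (u + 1)\<^sup>2 * (\<sigma>1\<^sup>2 / w) / \<sigma>1\<^sup>2 = 16 * (u + 1)\<^sup>2 / (2 * w)" for w
      using assms by simp
    ultimately show ?thesis unfolding \<beta>_def by (simp only:)
  qed
  ultimately show ?thesis
    by (simp add: rho_const_def c_def u_def radius_factor_def add_divide_distrib)
qed

text \<open>The reserve absorbs the linear terms and the logarithm of the polynomial factor.\<close>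

lemma eventually_quadratic_dominates:
  fixes b c0 c1 c2 c3 d :: real
  assumes "0 < d" "0 < c3"
  shows "\<forall>\<^sub>F R in at_top. b * R + c0 + ln (c1 * R + c2 * R\<^sup>2 + c3 * R ^ 3 + 1) \<le> d * R\<^sup>2"
  using assms by real_asymp

theorem theorem4:
  fixes \<sigma>1 \<sigma>2 :: real
  assumes "0 < \<sigma>1" and "\<sigma>1 < \<sigma>2"
  shows "(\<forall>R P. 0 < R \<longrightarrow> capacity_achieving \<sigma>1 \<sigma>2 R P \<longrightarrow>
            finite (dist_support P) \<and>
            enat (card (dist_support P)) \<le> zero_count \<sigma>1 \<sigma>2 R P \<and>
            zero_count \<sigma>1 \<sigma>2 R P < \<infinity>)
       \<and> (\<exists>C R0. \<forall>R P. R \<ge> R0 \<longrightarrow> capacity_achieving \<sigma>1 \<sigma>2 R P \<longrightarrow>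
            (\<exists>n. zero_count \<sigma>1 \<sigma>2 R P = enat n \<and>
                 real n \<le> rho_const \<sigma>1 \<sigma>2 * R\<^sup>2 / \<sigma>1\<^sup>2 + C * ln R))"
proof -
  have loc: "optimal_wiretap R P \<sigma>1 \<sigma>2" if "capacity_achieving \<sigma>1 \<sigma>2 R P" for R P
    using that assms by unfold_locales (auto simp: capacity_achieving_def)
  define S where "S = radius_factor"
  define D where "D = \<sigma>2\<^sup>2 - \<sigma>1\<^sup>2"
  define t where "t = 1 / \<sigma>1\<^sup>2 - 1 / \<sigma>2\<^sup>2"
  \<comment> \<open>The reserve in the leading constant; \<open>c1\<close>, \<open>c2\<close>,
    \<open>c3\<close> are the coefficients of the expanded polynomial under the logarithm.\<close>
  define d where "d = rho_const \<sigma>1 \<sigma>2 / \<sigma>1\<^sup>2 - (S\<^sup>2 / (2 * D) + (2 + S + 5 / 2) / \<sigma>1\<^sup>2)"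
  define c1 where "c1 = (2 + D) / \<sigma>2\<^sup>2 + t * (2 + S)"
  define c2 where "c2 = 2 * (2 + S) / \<sigma>2\<^sup>2 + 1 / \<sigma>2\<^sup>2"
  define c3 where "c3 = (2 + S)\<^sup>2 / \<sigma>2\<^sup>2"
  have "0 < S" using add_pos_pos[OF exp_gt_zero[of 1] zero_less_one] by (simp add: S_def radius_factor_def)
  then have "0 < c3" using assms by (simp add: c3_def)
  moreover have "0 < d" using leading_constant_less[OF assms] by (simp add: d_def S_def D_def)
  ultimately obtain R1 where R1: "\<And>R. R1 \<le> R \<Longrightarrow>
    (S / D + 1 / \<sigma>1\<^sup>2) * R + (1 + 1 / (2 * D)) + ln (c1 * R + c2 * R\<^sup>2 + c3 * R ^ 3 + 1) \<le> d * R\<^sup>2"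
    using eventually_quadratic_dominates unfolding eventually_at_top_linorder by meson
  \<comment> \<open>The constant in front of ln R is 0, because the reserve swallows the logarithm.
    The threshold depends on \<sigma>1 and \<sigma>2 alone, so it is uniform over the optimal
    inputs.\<close>
  have "\<exists>n. zero_count \<sigma>1 \<sigma>2 R P = enat n \<and> real n \<le> rho_const \<sigma>1 \<sigma>2 * R\<^sup>2 / \<sigma>1\<^sup>2 + 0 * ln R"
    if R: "max R1 (wiretap.large_radius \<sigma>1 \<sigma>2) \<le> R" and P: "capacity_achieving \<sigma>1 \<sigma>2 R P" for R P
  proof -
    interpret optimal_wiretap R P \<sigma>1 \<sigma>2 by (rule loc[OF P])
    have "R / \<sigma>2\<^sup>2 * (1 + D + (2 * R + S * R + 1)\<^sup>2) + R\<^sup>2 / \<sigma>2\<^sup>2 + t * (2 * R + S * R) + 1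
        = c1 * R + c2 * R\<^sup>2 + c3 * R ^ 3 + 1"
      using \<sigma>2_pos by (simp add: c1_def c2_def c3_def power2_eq_square power3_eq_cube field_simps)
    moreover have "1 + (S * R + 1)\<^sup>2 / (2 * D) + (2 * R + S * R + 1) * R / \<sigma>1\<^sup>2 + 5 / 2 * R\<^sup>2 / \<sigma>1\<^sup>2
        = (rho_const \<sigma>1 \<sigma>2 / \<sigma>1\<^sup>2 - d) * R\<^sup>2 + ((S / D + 1 / \<sigma>1\<^sup>2) * R + (1 + 1 / (2 * D)))"
    proof -
      have "D \<noteq> 0" using square_less by (simp add: D_def)
      then show ?thesis using \<sigma>1_pos by (simp add: d_def power2_eq_square field_simps)
    qed
    moreover obtain n where "zero_count \<sigma>1 \<sigma>2 R P = enat n" "real n \<le> 1 + (S * R + 1)\<^sup>2 / (2 * D)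
       + (2 * R + S * R + 1) * R / \<sigma>1\<^sup>2 + 5 / 2 * R\<^sup>2 / \<sigma>1\<^sup>2
       + ln (R / \<sigma>2\<^sup>2 * (1 + D + (2 * R + S * R + 1)\<^sup>2) + R\<^sup>2 / \<sigma>2\<^sup>2 + t * (2 * R + S * R) + 1)"
      using zero_count_explicit R unfolding noise_sd_square \<tau>_def S_def D_def t_def by auto
    ultimately show ?thesis
      using R1[of R] R by (intro exI[of _ n]) (simp add: left_diff_distrib)
  qed
  then show ?thesis
    using optimal_wiretap.support_card_le[OF loc] by blast
qed

end
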